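(* Let $d\in\{1,2,\ldots\}$, $0<\alpha<2\wedge d$, $\delta\in[0,\frac{d-\alpha}{2}]$, $\kappa=\kappa_\delta$, and let $\tilde p$ be the Schrödinger perturbation of the heat kernel of $\Delta^{\alpha/2}$ by $q(x)=\kappa|x|^{-\alpha}$. Then $$\int_{\mathbb{R}^d}\tilde p(t,x,y)|y|^{-\delta}\,dy=|x|^{-\delta},\qquad t>0,\ x\in\mathbb{R}^d.$$ Furthermore, for $\beta\in[0,d-\alpha-\delta)$, $t>0$ and $x\ne0$, $$\int_{\mathbb{R}^d}\tilde p(t,x,y)|y|^{-\beta}\,dy=|x|^{-\beta}+(\kappa-\kappa_\beta)\int_0^t\int_{\mathbb{R}^d}\tilde p(s,x,y)|y|^{-\beta-\alpha}\,dy\,ds<\infty.$$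
   Context: For $\beta\in(0,d-\alpha)$ let $\kappa_\beta=\frac{2^\alpha\Gamma(\frac{\beta+\alpha}{2})\Gamma(\frac{d-\beta}{2})}{\Gamma(\frac{\beta}{2})\Gamma(\frac{d-\beta-\alpha}{2})}$, and let $\kappa_0=0$. The heat kernel of $\Delta^{\alpha/2}$ is $p(t,x,y)=p_t(y-x)$, where $p_t(x)=(2\pi)^{-d}\int_{\mathbb{R}^d}e^{-t|\xi|^\alpha}e^{-ix\cdot\xi}\,d\xi$. The Schrödinger perturbation of $p$ by $q(x)=\kappa|x|^{-\alpha}$ is $\tilde p=\sum_{n=0}^\infty p_n$ with $p_0=p$ and $p_n(t,x,y)=\int_0^t\int_{\mathbb{R}^d}p(s,x,z)q(z)p_{n-1}(t-s,z,y)\,dz\,ds$ for $n\ge1$ (values in $[0,\infty]$; $\tilde p=p$ if $\delta=0$). Conventions: $|0|^{-\beta}=\infty$ for $\beta>0$ and $|0|^{0}=1$. *)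

theory Defs
  imports "HOL-Analysis.Analysis"
begin

definition kappa_const :: "nat \<Rightarrow> real \<Rightarrow> real \<Rightarrow> real" where
  "kappa_const d \<alpha> \<beta> =
     (if \<beta> = 0 then 0
      else 2 powr \<alpha> * Gamma ((\<beta> + \<alpha>) / 2) * Gamma ((real d - \<beta>) / 2) /
           (Gamma (\<beta> / 2) * Gamma ((real d - \<beta> - \<alpha>) / 2)))"

text \<open>The weight $|x|^{-\beta}$ for $\beta \ge 0$, with $|0|^{-\beta} = \infty$ for $\beta > 0$
  and $|0|^0 = 1$.  (Plain \<open>powr\<close> would give the value 0 at the origin in both cases.)\<close>

definition norm_neg_pow :: "real \<Rightarrow> 'a::euclidean_space \<Rightarrow> ennreal" where
  "norm_neg_pow \<beta> x =
     (if x = 0 then (if \<beta> = 0 then 1 else \<infinity>) else ennreal (norm x powr (-\<beta>)))"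

text \<open>The density $p_t(x)$.  The Fourier integral is real because its weight is even in $\xi$;
  \<open>Re\<close> only changes the type.\<close>

definition stable_density :: "real \<Rightarrow> real \<Rightarrow> 'a::euclidean_space \<Rightarrow> real" where
  "stable_density \<alpha> t x =
     Re (1 / (2 * of_real pi) ^ DIM('a) *
         (LINT \<xi>|(lborel :: 'a measure).
            of_real (exp (- t * norm \<xi> powr \<alpha>)) * exp (- \<i> * of_real (x \<bullet> \<xi>))))"

text \<open>Since $p_t \ge 0$ for $t > 0$ and $0 < \alpha < 2$, \<open>ennreal\<close> is a mere embedding
  here.\<close>

definition heat_kernel :: "real \<Rightarrow> real \<Rightarrow> 'a::euclidean_space \<Rightarrow> 'a \<Rightarrow> ennreal" where
  "heat_kernel \<alpha> t x y = ennreal (stable_density \<alpha> t (y - x))"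

primrec perturb_term ::
  "(real \<Rightarrow> 'a \<Rightarrow> 'a \<Rightarrow> ennreal) \<Rightarrow> ('a \<Rightarrow> ennreal) \<Rightarrow> nat \<Rightarrow>
     real \<Rightarrow> 'a::euclidean_space \<Rightarrow> 'a \<Rightarrow> ennreal" where
  "perturb_term p q 0 = p"
| "perturb_term p q (Suc n) =
     (\<lambda>t x y. \<integral>\<^sup>+s\<in>{0<..<t}. (\<integral>\<^sup>+z. p s x z * q z * perturb_term p q n (t - s) z y \<partial>lborel) \<partial>lborel)"

definition schroedinger_perturbation ::
  "(real \<Rightarrow> 'a \<Rightarrow> 'a \<Rightarrow> ennreal) \<Rightarrow> ('a \<Rightarrow> ennreal) \<Rightarrow>
     real \<Rightarrow> 'a::euclidean_space \<Rightarrow> 'a \<Rightarrow> ennreal" where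
  "schroedinger_perturbation p q t x y = (\<Sum>n. perturb_term p q n t x y)"

end

theory Submission
  imports Defs "HOL-Probability.Probability"
begin

text \<open>Write $h_\beta(x) = |x|^{-\beta}$, and let $p_n$ be the terms of the perturbation series for $\kappa = 1$.
  Up to a constant, $h_\beta$ is $\int_0^\infty u^{a-1} p_u\,du$ with $a = (d-\beta)/\alpha$, so by the
  semigroup property the heat flow only shifts the weight $u^{a-1}$; integrating its derivative gives
  $P_t h_\beta + \kappa_\beta \int_0^t P_s h_{\beta+\alpha}\,ds = h_\beta$ off the origin. Feeding this into the
  recursion for $p_n$ yields $B_0 + \kappa_\beta A_0 = h_\beta$ and $B_{n+1} + \kappa_\beta A_{n+1} = A_n$ for
  $B_n = p_n(t) h_\beta$ and $A_n = \int_0^t p_n(s) h_{\beta+\alpha}\,ds$. Summing against $\kappa^n$ gives the second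
  assertion whenever $\sum_n \kappa^n A_n < \infty$. For $\kappa < \kappa_\beta$ the series is dominated by a
  geometric one, and the remaining exponents below the critical coupling follow by interpolation between
  powers of $|x|$. At $\kappa = \kappa_\delta$ and $\beta < \delta$ one bounds the sums uniformly in
  $\kappa' < \kappa_\delta$. The invariance of $h_\delta$ is the limit $\beta \to \delta$ of the second assertion;
  at the origin, scaling makes $P_r h_\delta(0)$ unbounded as $r \to 0$.\<close>

section \<open>Radial integrals and Gaussian Fourier transforms\<close>

text \<open>The kernel is given only as a Fourier integral, so positivity, radial symmetry, total
  mass 1 and the semigroup law have to be derived first. Positivity comes from approximating
  exp(-t|\<xi>|^\<alpha>) by mixtures of Gaussians, and it in turn yields integrability. The second
  obstacle is that all series take values in [0,\<infinity>], where nothing may be cancelled: the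
  identities are written with sums only, and each real-valued consequence needs a finiteness proof
  beforehand. For \<delta> < (d-\<alpha>)/2 finiteness is obtained at an exponent strictly between
  \<delta> and d-\<alpha>-\<delta>, where the coupling exceeds \<kappa>_\<delta>; this is where the
  range of \<beta> comes from. For \<delta> = (d-\<alpha>)/2 that interval is empty,
  \<kappa>_\<delta> being the largest coupling, and only bounds uniform in smaller couplings remain.
  Invariance of h_\<delta> cannot be read off the identity at \<beta> = \<delta>, because the
  integral term to be cancelled there may be infinite; hence the approach through exponents below
  \<delta>.\<close>

lemma nn_integral_lborel_affine:
  fixes t :: "'a::euclidean_space"
  assumes [measurable]: "f \<in> borel_measurable borel" and c: "c \<noteq> 0"
  shows "(\<integral>\<^sup>+x. f x \<partial>lborel) = ennreal (\<bar>c\<bar> ^ DIM('a)) * (\<integral>\<^sup>+x. f (t + c *\<^sub>R x) \<partial>lborel)"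
  by (subst lborel_affine[OF c, of t])
     (simp add: nn_integral_density nn_integral_distr nn_integral_cmult)

lemma integral_lborel_affine:
  fixes t :: "'a::euclidean_space" and f :: "'a \<Rightarrow> 'b::{banach, second_countable_topology}"
  assumes [measurable]: "f \<in> borel_measurable borel" and c: "c \<noteq> 0"
  shows "(\<integral>x. f x \<partial>lborel) = (\<bar>c\<bar> ^ DIM('a)) *\<^sub>R (\<integral>x. f (t + c *\<^sub>R x) \<partial>lborel)"
  by (subst lborel_affine[OF c, of t])
     (simp add: integral_density integral_distr)

lemma nn_integral_powr_Icc_0:
  fixes b s :: real
  assumes b: "0 < b" and s: "0 \<le> s"
  shows "(\<integral>\<^sup>+r. ennreal (b * r powr (b - 1)) * indicator {0..s} r \<partial>lborel) = ennreal (s powr b)"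
proof -
  have "((\<lambda>r. r powr (b - 1)) has_integral s powr (b - 1 + 1) / (b - 1 + 1)) {0..s}"
    using b s by (intro has_integral_powr_from_0) auto
  then have "((\<lambda>r. b * r powr (b - 1)) has_integral b * (s powr b / b)) {0..s}"
    by (intro has_integral_mult_right) simp
  then have "((\<lambda>r. b * r powr (b - 1)) has_integral s powr b) {0..s}"
    using b by simp
  from nn_integral_has_integral_lebesgue'[OF _ this] show ?thesis
    using b by (simp add: mult.commute)
qed

text \<open>This replaces polar coordinates: the image of Lebesgue measure under \<open>f\<close>
  agrees with the density c b s^(b-1) on all half-lines \<open>{..s}\<close>, and these form an
  intersection-stable generator of the Borel sets.\<close>

lemma nn_integral_power_sublevels:
  fixes f :: "'a::euclidean_space \<Rightarrow> real" and b c :: real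
  assumes [measurable]: "f \<in> borel_measurable borel" "g \<in> borel_measurable borel"
    and f0: "\<And>x. 0 \<le> f x" and b: "0 < b" and c: "0 \<le> c"
    and sub: "\<And>s. 0 \<le> s \<Longrightarrow> emeasure lborel {x. f x \<le> s} = ennreal (c * s powr b)"
  shows "(\<integral>\<^sup>+x. g (f x) \<partial>lborel) =
    (\<integral>\<^sup>+s\<in>{0<..}. g s * ennreal (c * b * s powr (b - 1)) \<partial>lborel)"
proof -
  define h where "h s = ennreal (c * b * s powr (b - 1)) * indicator {0<..} s" for s :: real
  have [measurable]: "h \<in> borel_measurable borel"
    unfolding h_def by measurable
  have M: "emeasure (distr lborel borel f) {..s} = (if s < 0 then 0 else ennreal (c * s powr b))" for s
  proof (cases "s < 0")
    case True
    then have "{x. f x \<le> s} = {}" using f0 by (auto simp: not_le intro: less_le_trans)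
    with True show ?thesis by (simp add: emeasure_distr vimage_def)
  next
    case False
    then show ?thesis by (simp add: emeasure_distr sub vimage_def)
  qed
  have N: "emeasure (density lborel h) {..s} = (if s < 0 then 0 else ennreal (c * s powr b))" for s
  proof (cases "s < 0")
    case True
    then have z: "h r * indicator {..s} r = 0" for r unfolding h_def by (auto split: split_indicator)
    have "(\<integral>\<^sup>+r. h r * indicator {..s} r \<partial>lborel) = (\<integral>\<^sup>+r. 0 \<partial>(lborel :: real measure))"
      by (rule nn_integral_cong, rule z)
    with True show ?thesis by (simp add: emeasure_density)
  next
    case False
    have "emeasure (density lborel h) {..s} = (\<integral>\<^sup>+r. h r * indicator {..s} r \<partial>lborel)"
      by (simp add: emeasure_density)
    also have "\<dots> = (\<integral>\<^sup>+r. ennreal c * (ennreal (b * r powr (b - 1)) * indicator {0..s} r) \<partial>lborel)"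
    proof (rule nn_integral_cong_AE, use AE_lborel_singleton[of "0::real"] in eventually_elim)
      fix r :: real assume "r \<noteq> 0"
      then show "h r * indicator {..s} r = ennreal c * (ennreal (b * r powr (b - 1)) * indicator {0..s} r)"
        using b c unfolding h_def
        by (auto split: split_indicator simp: ennreal_mult[symmetric] mult_ac)
    qed
    also have "\<dots> = ennreal c * ennreal (s powr b)"
      using b False by (subst nn_integral_cmult) (auto simp: nn_integral_powr_Icc_0)
    finally show ?thesis using False c by (simp add: ennreal_mult)
  qed
  have "distr lborel borel f = density lborel h"
  proof (rule measure_eqI_generator_eq[where E="range (\<lambda>s::real. {..s})" and A="\<lambda>n::nat. {..real n}" and \<Omega>=UNIV])
    show "Int_stable (range (\<lambda>s::real. {..s}))"
      by (auto simp: Int_stable_def Int_atMost)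
    show "sets (distr lborel borel f) = sigma_sets UNIV (range (\<lambda>s::real. {..s}))"
      "sets (density lborel h) = sigma_sets UNIV (range (\<lambda>s::real. {..s}))"
      by (simp_all add: borel_eq_atMost)
    show "(\<Union>i. {..real i}) = UNIV" by (auto simp: real_arch_simple)
  qed (auto simp: M N)
  then have "(\<integral>\<^sup>+s. g s \<partial>distr lborel borel f) = (\<integral>\<^sup>+s. g s \<partial>density lborel h)" by simp
  then show ?thesis
    by (simp add: nn_integral_distr nn_integral_density) (simp add: h_def mult_ac)
qed

text \<open>The exponent \<open>p\<close> is left free because two instances are needed: p =
  \<alpha> for the stable exponent and p = 2 for Gaussians.\<close>

lemma nn_integral_norm_powr:
  fixes p :: real and g :: "real \<Rightarrow> ennreal"
  assumes [measurable]: "g \<in> borel_measurable borel" and p: "0 < p"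
  shows "(\<integral>\<^sup>+x. g (norm (x::'a::euclidean_space) powr p) \<partial>lborel) =
    (\<integral>\<^sup>+s\<in>{0<..}. g s * ennreal (unit_ball_vol (real DIM('a)) * (DIM('a) / p) * s powr (DIM('a) / p - 1)) \<partial>lborel)"
proof (rule nn_integral_power_sublevels)
  fix s :: real assume s: "0 \<le> s"
  have eq: "norm x powr p \<le> s \<longleftrightarrow> norm x \<le> s powr (1 / p)" for x :: 'a
  proof -
    have "norm x powr p \<le> s \<longleftrightarrow> (norm x powr p) powr (1 / p) \<le> s powr (1 / p)"
      using p s powr_mono2[of "1/p" "norm x powr p" s] powr_less_mono2[of "1/p" s "norm x powr p"]
      by (auto simp: not_le[symmetric] simp del: powr_powr)
    then show ?thesis using p by (simp add: powr_powr)
  qed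
  have "emeasure lborel {x::'a. norm x powr p \<le> s} = emeasure lborel (cball (0::'a) (s powr (1/p)))"
    by (simp only: eq) (simp add: cball_def)
  also have "\<dots> = ennreal (unit_ball_vol (real DIM('a)) * (s powr (1 / p)) ^ DIM('a))"
    by (intro emeasure_cball) simp
  also have "(s powr (1 / p)) ^ DIM('a) = s powr (DIM('a) / p)"
    using s DIM_positive[where 'a='a] p by (cases "s = 0") (simp_all add: powr_power)
  finally show "emeasure lborel {x::'a. norm x powr p \<le> s} = ennreal (unit_ball_vol (real DIM('a)) * s powr (DIM('a) / p))" .
qed (use p DIM_positive[where 'a='a] in \<open>simp_all\<close>)

lemma nn_integral_Gamma:
  fixes b t :: real
  assumes b: "0 < b" and t: "0 < t"
  shows "(\<integral>\<^sup>+s\<in>{0<..}. ennreal (s powr (b - 1) * exp (- t * s)) \<partial>lborel) = ennreal (Gamma b * t powr (- b))"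
proof -
  let ?f = "\<lambda>s. ennreal (indicator {0..} (0 + t * s) * (0 + t * s) powr (b - 1) / exp (0 + t * s))"
  let ?I = "(\<integral>\<^sup>+s\<in>{0<..}. ennreal (s powr (b - 1) * exp (- t * s)) \<partial>lborel)"
  have "ennreal (Gamma b) = (\<integral>\<^sup>+s. ennreal (indicator {0..} s * s powr (b - 1) / exp s) \<partial>lborel)"
    using Gamma_conv_nn_integral_real[OF b] .
  also have "\<dots> = ennreal \<bar>t\<bar> * (\<integral>\<^sup>+s. ?f s \<partial>lborel)"
    using t by (intro nn_integral_real_affine) auto
  also have "(\<integral>\<^sup>+s. ?f s \<partial>lborel)
    = (\<integral>\<^sup>+s. ennreal (t powr (b - 1)) * (ennreal (s powr (b - 1) * exp (- t * s)) * indicator {0<..} s) \<partial>lborel)"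
  proof (rule nn_integral_cong_AE, use AE_lborel_singleton[of "0::real"] in eventually_elim)
    fix s :: real assume "s \<noteq> 0"
    then show "?f s =
      ennreal (t powr (b - 1)) * (ennreal (s powr (b - 1) * exp (- t * s)) * indicator {0<..} s)"
      using t by (auto simp: ennreal_mult[symmetric] powr_mult exp_minus field_simps zero_le_mult_iff
          split: split_indicator)
  qed
  also have "\<dots> = ennreal (t powr (b - 1)) * ?I"
    by (rule nn_integral_cmult) simp
  finally have eq: "ennreal (Gamma b) = ennreal (t powr b) * ?I"
    using t by (simp add: mult.assoc[symmetric] ennreal_mult[symmetric] powr_mult_base)
  have "ennreal (t powr (-b)) * ennreal (Gamma b) = ?I"
    unfolding eq using t by (simp add: mult.assoc[symmetric] ennreal_mult[symmetric] powr_add[symmetric])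
  then show ?thesis
    using b by (simp add: ennreal_mult[symmetric] mult.commute Gamma_real_nonneg)
qed

lemma nn_integral_exp_norm_powr:
  fixes p t :: real
  assumes p: "0 < p" and t: "0 < t"
  shows "(\<integral>\<^sup>+x. ennreal (exp (- t * norm (x::'a::euclidean_space) powr p)) \<partial>lborel) =
    ennreal (unit_ball_vol (real DIM('a)) * (DIM('a) / p) * (Gamma (DIM('a) / p) * t powr (- (DIM('a) / p))))"
proof -
  let ?c = "unit_ball_vol (real DIM('a)) * (DIM('a) / p)"
  have "(\<integral>\<^sup>+x. ennreal (exp (- t * norm (x::'a) powr p)) \<partial>lborel) =
    (\<integral>\<^sup>+s\<in>{0<..}. ennreal (exp (- t * s)) * ennreal (?c * s powr (DIM('a) / p - 1)) \<partial>lborel)"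
    using p by (intro nn_integral_norm_powr) auto
  also have "\<dots> = (\<integral>\<^sup>+s. ennreal ?c * (ennreal (s powr (DIM('a) / p - 1) * exp (- t * s)) * indicator {0<..} s) \<partial>lborel)"
    using p by (intro nn_integral_cong) (auto simp: ennreal_mult[symmetric] mult_ac split: split_indicator)
  also have "\<dots> = ennreal ?c * ennreal (Gamma (DIM('a) / p) * t powr (- (DIM('a) / p)))"
    using p t by (subst nn_integral_cmult, measurable, subst nn_integral_Gamma) auto
  also have "\<dots> = ennreal (?c * (Gamma (DIM('a) / p) * t powr (- (DIM('a) / p))))"
    using p by (intro ennreal_mult'[symmetric]) simp
  finally show ?thesis .
qed

lemma integrable_exp_norm_powr:
  fixes p t :: real
  assumes p: "0 < p" and t: "0 < t"
  shows "integrable lborel (\<lambda>x::'a::euclidean_space. exp (- t * norm x powr p))"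
  by (rule integrableI_nonneg) (use nn_integral_exp_norm_powr[OF assms, where 'a='a] in \<open>auto simp: less_top[symmetric]\<close>)

lemma integrable_exp_norm_square:
  fixes t :: real
  assumes t: "0 < t"
  shows "integrable lborel (\<lambda>x::'a::euclidean_space. exp (- t * (norm x)\<^sup>2))"
  using integrable_exp_norm_powr[of 2 t, where 'a='a] t by simp

lemma nn_integral_norm_powr_Gaussian:
  fixes \<beta> t :: real
  assumes \<beta>: "\<beta> < DIM('a)" and t: "0 < t"
  shows "(\<integral>\<^sup>+x. ennreal (norm (x::'a::euclidean_space) powr (-\<beta>) * exp (- t * (norm x)\<^sup>2)) \<partial>lborel) =
    ennreal (unit_ball_vol (real DIM('a)) * (DIM('a) / 2) * (Gamma ((DIM('a) - \<beta>) / 2) * t powr (- ((DIM('a) - \<beta>) / 2))))"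
proof -
  let ?c = "unit_ball_vol (real DIM('a)) * (DIM('a) / 2)"
  let ?e = "((DIM('a) - \<beta>) / 2)"
  have "(\<integral>\<^sup>+x. ennreal (norm (x::'a) powr (-\<beta>) * exp (- t * (norm x)\<^sup>2)) \<partial>lborel) =
    (\<integral>\<^sup>+x. (\<lambda>s. ennreal (s powr (-\<beta>/2) * exp (- t * s))) (norm (x::'a) powr 2) \<partial>lborel)"
    by (intro nn_integral_cong) (simp add: powr_powr del: powr_numeral, simp)
  also have "\<dots> =
    (\<integral>\<^sup>+s\<in>{0<..}. ennreal (s powr (-\<beta>/2) * exp (- t * s)) * ennreal (?c * s powr (DIM('a) / 2 - 1)) \<partial>lborel)"
    by (intro nn_integral_norm_powr) auto
  also have "\<dots> = (\<integral>\<^sup>+s. ennreal ?c * (ennreal (s powr ((DIM('a) - \<beta>) / 2 - 1) * exp (- t * s)) * indicator {0<..} s) \<partial>lborel)"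
  proof (rule nn_integral_cong)
    fix s :: real
    have "s powr (-\<beta>/2) * s powr (DIM('a) / 2 - 1) = s powr ((DIM('a) - \<beta>) / 2 - 1)"
      unfolding powr_add[symmetric] by (rule arg_cong[where f="(powr) s"]) (simp add: field_simps)
    then have "s powr (-\<beta>/2) * exp (- t * s) * (?c * s powr (DIM('a) / 2 - 1)) =
        ?c * (s powr ((DIM('a) - \<beta>) / 2 - 1) * exp (- t * s))"
      by (simp only: mult_ac)
    then show "ennreal (s powr (-\<beta>/2) * exp (- t * s)) * ennreal (?c * s powr (DIM('a) / 2 - 1)) * indicator {0<..} s =
        ennreal ?c * (ennreal (s powr ((DIM('a) - \<beta>) / 2 - 1) * exp (- t * s)) * indicator {0<..} s)"
      by (auto simp: ennreal_mult[symmetric] split: split_indicator)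
  qed
  also have "\<dots> = ennreal ?c * ennreal (Gamma ?e * t powr (- ?e))"
    using t \<beta> by (subst nn_integral_cmult, measurable, subst nn_integral_Gamma) auto
  also have "\<dots> = ennreal (?c * (Gamma ?e * t powr (- ?e)))"
    by (intro ennreal_mult'[symmetric]) simp
  finally show ?thesis .
qed

lemma Gaussian_Fourier_real:
  fixes c y :: real
  assumes c: "0 < c"
  shows "integrable lborel (\<lambda>s. complex_of_real (exp (- c * s\<^sup>2)) * iexp (y * s))"
    and "(\<integral>s. complex_of_real (exp (- c * s\<^sup>2)) * iexp (y * s) \<partial>lborel) = complex_of_real (sqrt (pi / c) * exp (- y\<^sup>2 / (4 * c)))"
proof -
  let ?I = "(\<integral>s. complex_of_real (exp (- c * s\<^sup>2)) * iexp (y * s) \<partial>lborel)"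
  have i: "integrable lborel (\<lambda>s::real. complex_of_real (exp (- c * s\<^sup>2)))"
    using integrable_exp_norm_square[OF c, where 'a=real] by (intro integrable_of_real) simp
  show "integrable lborel (\<lambda>s. complex_of_real (exp (- c * s\<^sup>2)) * iexp (y * s))"
    by (rule Bochner_Integration.integrable_bound[OF i]) (auto simp: norm_mult)
  \<comment> \<open>The substitution x = k s turns the standard normal exponent x^2/2 into c
    s^2.\<close>
  define k where "k = sqrt (2 * c)"
  have k: "0 < k" "k\<^sup>2 = 2 * c" using c by (auto simp: k_def)
  have "complex_of_real (exp (- ((y / k)\<^sup>2) / 2)) = char std_normal_distribution (y / k)"
    by (simp only: char_std_normal_distribution)
  also have "\<dots> = (\<integral>x. std_normal_density x *\<^sub>R iexp (y / k * x) \<partial>lborel)"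
    unfolding char_def by (subst integral_density) auto
  also have "\<dots> = k *\<^sub>R (\<integral>s. std_normal_density (0 + k * s) *\<^sub>R iexp (y / k * (0 + k * s)) \<partial>lborel)"
    using k by (subst lborel_integral_real_affine[where c=k and t=0]) auto
  also have "(\<integral>s. std_normal_density (0 + k * s) *\<^sub>R iexp (y / k * (0 + k * s)) \<partial>lborel) =
    (\<integral>s. (1 / sqrt (2 * pi)) *\<^sub>R (complex_of_real (exp (- c * s\<^sup>2)) * iexp (y * s)) \<partial>lborel)"
    using k by (intro Bochner_Integration.integral_cong refl)
      (simp add: normal_density_def power_mult_distrib scaleR_conv_of_real mult_ac)
  also have "k *\<^sub>R \<dots> = (k / sqrt (2 * pi)) *\<^sub>R ?I"
    by (subst integral_scaleR_right) (simp only: scaleR_scaleR, simp)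
  finally have "(sqrt (2 * pi) / k) *\<^sub>R complex_of_real (exp (- ((y / k)\<^sup>2) / 2)) =
    (sqrt (2 * pi) / k) *\<^sub>R ((k / sqrt (2 * pi)) *\<^sub>R ?I)"
    by (simp only:)
  also have "\<dots> = ?I"
    using k by (simp only: scaleR_scaleR) simp
  moreover have "sqrt (2 * pi) / k = sqrt (pi / c)"
    using c by (simp add: k_def real_sqrt_mult real_sqrt_divide)
  moreover have "(y / k)\<^sup>2 / 2 = y\<^sup>2 / (4 * c)" using k by (simp add: power_divide)
  ultimately show "?I = complex_of_real (sqrt (pi / c) * exp (- y\<^sup>2 / (4 * c)))"
    by (simp add: scaleR_conv_of_real)
qed

lemma integral_lborel_prod:
  fixes f :: "'a::euclidean_space \<Rightarrow> real \<Rightarrow> 'b::{real_normed_field, banach, second_countable_topology}"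
  assumes f: "\<And>b. b \<in> Basis \<Longrightarrow> integrable lborel (f b)"
  shows "(\<integral>x. (\<Prod>b\<in>Basis. f b (x \<bullet> b)) \<partial>lborel) = (\<Prod>b\<in>Basis. (\<integral>s. f b s \<partial>lborel))"
proof -
  interpret product_sigma_finite "\<lambda>_::'a. lborel :: real measure" ..
  have [measurable]: "b \<in> Basis \<Longrightarrow> f b \<in> borel_measurable borel" for b
    using borel_measurable_integrable[OF f] by simp
  have "(\<integral>x. (\<Prod>b\<in>Basis. f b (x \<bullet> b)) \<partial>lborel) =
    (\<integral>x. (\<Prod>b\<in>Basis. f b (x b)) \<partial>(\<Pi>\<^sub>M b\<in>Basis. lborel))"
    unfolding lborel_eq[where 'a='a]
    by (subst integral_distr) (auto intro!: Bochner_Integration.integral_cong prod.cong)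
  also have "\<dots> = (\<Prod>b\<in>Basis. (\<integral>s. f b s \<partial>lborel))"
    by (rule product_integral_prod) (auto intro: f)
  finally show ?thesis .
qed

lemma Gaussian_Fourier:
  fixes c :: real and x :: "'a::euclidean_space"
  assumes c: "0 < c"
  shows "(\<integral>\<xi>. exp (- c * (norm \<xi>)\<^sup>2) * cos (x \<bullet> \<xi>) \<partial>lborel) = sqrt (pi / c) ^ DIM('a) * exp (- (norm x)\<^sup>2 / (4 * c))"
proof -
  let ?f = "\<lambda>b s. complex_of_real (exp (- c * s\<^sup>2)) * iexp ((x \<bullet> b) * s)"
  have prod: "(\<Prod>b\<in>Basis. ?f b (\<xi> \<bullet> b)) = complex_of_real (exp (- c * (norm \<xi>)\<^sup>2)) * iexp (x \<bullet> \<xi>)" for \<xi> :: 'a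
  proof -
    have "(norm \<xi>)\<^sup>2 = (\<Sum>b\<in>Basis. (\<xi> \<bullet> b)\<^sup>2)"
      unfolding power2_norm_eq_inner by (subst euclidean_inner) (simp add: power2_eq_square)
    moreover have "x \<bullet> \<xi> = (\<Sum>b\<in>Basis. (x \<bullet> b) * (\<xi> \<bullet> b))"
      by (rule euclidean_inner)
    ultimately show ?thesis
      by (simp add: prod.distrib exp_sum[symmetric] sum_distrib_left sum_negf of_real_prod[symmetric] del: of_real_prod)
  qed
  have i: "integrable lborel (\<lambda>\<xi>::'a. complex_of_real (exp (- c * (norm \<xi>)\<^sup>2)))"
    using integrable_exp_norm_square[OF c, where 'a='a] by (intro integrable_of_real) simp
  have i2: "integrable lborel (\<lambda>\<xi>. complex_of_real (exp (- c * (norm \<xi>)\<^sup>2)) * iexp (x \<bullet> \<xi>))"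
    by (rule Bochner_Integration.integrable_bound[OF i]) (auto simp: norm_mult)
  have "(\<integral>\<xi>. exp (- c * (norm \<xi>)\<^sup>2) * cos (x \<bullet> \<xi>) \<partial>lborel) =
    Re (\<integral>\<xi>. complex_of_real (exp (- c * (norm \<xi>)\<^sup>2)) * iexp (x \<bullet> \<xi>) \<partial>lborel)"
    by (subst integral_Re[OF i2, symmetric]) (simp add: Re_exp)
  also have "(\<integral>\<xi>. complex_of_real (exp (- c * (norm \<xi>)\<^sup>2)) * iexp (x \<bullet> \<xi>) \<partial>lborel) =
    (\<integral>\<xi>. (\<Prod>b\<in>Basis. ?f b (\<xi> \<bullet> b)) \<partial>lborel)"
    by (simp only: prod)
  also have "\<dots> = (\<Prod>b\<in>Basis. complex_of_real (sqrt (pi / c) * exp (- (x \<bullet> b)\<^sup>2 / (4 * c))))"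
    using c by (subst integral_lborel_prod) (simp_all only: Gaussian_Fourier_real)
  also have "\<dots> = complex_of_real (\<Prod>b\<in>Basis. sqrt (pi / c) * exp (- (x \<bullet> b)\<^sup>2 / (4 * c)))"
    by simp
  also have "(\<Prod>b\<in>Basis. sqrt (pi / c) * exp (- (x \<bullet> b)\<^sup>2 / (4 * c))) = sqrt (pi / c) ^ DIM('a) * exp (- (norm x)\<^sup>2 / (4 * c))"
  proof -
    have "(norm x)\<^sup>2 = (\<Sum>b\<in>Basis. (x \<bullet> b)\<^sup>2)"
      unfolding power2_norm_eq_inner by (subst euclidean_inner) (simp add: power2_eq_square)
    then have "- (norm x)\<^sup>2 / (4 * c) = (\<Sum>b\<in>Basis. - (x \<bullet> b)\<^sup>2 / (4 * c))"
      by (simp add: sum_divide_distrib sum_negf)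
    then show ?thesis by (simp add: prod.distrib exp_sum)
  qed
  finally show ?thesis by simp
qed

text \<open>Bernstein representation of a power with exponent in (0,1). Since (1 - e^(-ls))/s is the
  integral of e^(-us) over u in [0,l], exchanging the integrals leaves a Gamma integral in s, and
  then the integral of u^(\<gamma>-1) over [0,l].\<close>

lemma nn_integral_Levy:
  fixes \<gamma> l :: real
  assumes \<gamma>: "0 < \<gamma>" "\<gamma> < 1" and l: "0 \<le> l"
  shows "(\<integral>\<^sup>+s\<in>{0<..}. ennreal (\<gamma> / Gamma (1 - \<gamma>) * ((1 - exp (- l * s)) * s powr (-1 - \<gamma>))) \<partial>lborel) = ennreal (l powr \<gamma>)"
proof -
  let ?C = "\<gamma> / Gamma (1 - \<gamma>)"
  let ?f = "\<lambda>s u. ennreal (s powr (- \<gamma>) * exp (- u * s)) * indicator {0..l} u * indicator {0<..} s"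
  have G: "0 < Gamma (1 - \<gamma>)" using \<gamma> by simp
  have E: "(\<integral>\<^sup>+u. ennreal (s powr (- \<gamma>) * exp (- u * s)) * indicator {0..l} u \<partial>lborel) =
      ennreal ((1 - exp (- l * s)) * s powr (-1 - \<gamma>))" if s: "0 < s" for s
  proof -
    have "((\<lambda>u. s powr (- \<gamma>) * exp (- u * s)) has_integral
      (- (s powr (-1 - \<gamma>)) * exp (- l * s)) - (- (s powr (-1 - \<gamma>)) * exp (- 0 * s))) {0..l}"
    proof (rule fundamental_theorem_of_calculus[OF l])
      fix u assume "u \<in> {0..l}"
      have "s powr (- \<gamma>) = s powr (-1 - \<gamma>) * s"
        using s powr_add[of s "-1 - \<gamma>" 1] by simp
      then show "((\<lambda>u. - (s powr (-1 - \<gamma>)) * exp (- u * s)) has_vector_derivative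
          s powr (- \<gamma>) * exp (- u * s)) (at u within {0..l})"
        unfolding has_real_derivative_iff_has_vector_derivative[symmetric]
        by (auto intro!: derivative_eq_intros)
    qed
    from nn_integral_has_integral_lebesgue'[OF _ this] show ?thesis
      using s by (simp add: algebra_simps)
  qed
  have "(\<integral>\<^sup>+s\<in>{0<..}. ennreal (?C * ((1 - exp (- l * s)) * s powr (-1 - \<gamma>))) \<partial>lborel) =
    ennreal (?C) * (\<integral>\<^sup>+s. (\<integral>\<^sup>+u. ?f s u \<partial>lborel) \<partial>lborel)"
  proof (subst nn_integral_cmult[symmetric], measurable, rule nn_integral_cong)
    fix s :: real
    show "ennreal (?C * ((1 - exp (- l * s)) * s powr (-1 - \<gamma>))) * indicator {0<..} s =
      ennreal (?C) * (\<integral>\<^sup>+u. ?f s u \<partial>lborel)"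
      using E[of s] \<gamma> G by (auto split: split_indicator simp: ennreal_mult'[symmetric])
  qed
  also have "(\<integral>\<^sup>+s. (\<integral>\<^sup>+u. ?f s u \<partial>lborel) \<partial>lborel) =
    (\<integral>\<^sup>+u. (\<integral>\<^sup>+s. ?f s u \<partial>lborel) \<partial>lborel)"
    by (rule lborel_pair.Fubini') measurable
  also have "\<dots> = (\<integral>\<^sup>+u. ennreal (Gamma (1 - \<gamma>) / \<gamma>) * (ennreal (\<gamma> * u powr (\<gamma> - 1)) * indicator {0..l} u) \<partial>lborel)"
  proof (rule nn_integral_cong_AE, use AE_lborel_singleton[of "0::real"] in eventually_elim)
    fix u :: real assume u: "u \<noteq> 0"
    show "(\<integral>\<^sup>+s. ?f s u \<partial>lborel) =
      ennreal (Gamma (1 - \<gamma>) / \<gamma>) * (ennreal (\<gamma> * u powr (\<gamma> - 1)) * indicator {0..l} u)"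
    proof (cases "u \<in> {0..l}")
      case True
      with u have "0 < u" by simp
      from nn_integral_Gamma[of "1 - \<gamma>" u, OF _ this] True \<gamma> G show ?thesis
        by (simp add: ennreal_mult'[symmetric])
    qed simp
  qed
  also have "\<dots> = ennreal (Gamma (1 - \<gamma>) / \<gamma>) * ennreal (l powr \<gamma>)"
    using \<gamma> l by (subst nn_integral_cmult) (simp_all add: nn_integral_powr_Icc_0)
  finally show ?thesis using \<gamma> G by (simp add: ennreal_mult'[symmetric])
qed

section \<open>Positivity of Fourier transforms of Gaussian mixtures\<close>

text \<open>Both properties survive nonnegative combinations, averages and pointwise limits, so they
  travel together from the explicit Gaussian formula to the stable density. Radial symmetry is thus
  inherited from Gaussians instead of being deduced from rotations of the Fourier integral.\<close>

definition radial_nonneg :: "('a::euclidean_space \<Rightarrow> real) \<Rightarrow> bool" where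
  "radial_nonneg f \<longleftrightarrow> (\<forall>x. 0 \<le> f x) \<and> (\<forall>x y. norm x = norm y \<longrightarrow> f x = f y)"

lemma radial_nonnegI:
  assumes "\<And>x. 0 \<le> f x" and "\<And>x y. norm x = norm y \<Longrightarrow> f x = f y"
  shows "radial_nonneg f"
  unfolding radial_nonneg_def by (intro conjI allI impI assms)

lemma radial_nonnegD:
  assumes "radial_nonneg f"
  shows "0 \<le> f x" and "norm x = norm y \<Longrightarrow> f x = f y"
  by (rule assms[unfolded radial_nonneg_def, THEN conjunct1, rule_format])
    (rule assms[unfolded radial_nonneg_def, THEN conjunct2, rule_format])

lemma radial_nonneg_LIMSEQ:
  assumes f: "\<And>n. radial_nonneg (f n)" and lim: "\<And>x. (\<lambda>n. f n x) \<longlonglongrightarrow> g x"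
  shows "radial_nonneg g"
proof (rule radial_nonnegI)
  fix x show "0 \<le> g x"
    by (rule LIMSEQ_le_const[OF lim]) (simp add: radial_nonnegD(1)[OF f])
next
  fix x y :: 'a assume "norm x = norm y"
  then have eq: "f n x = f n y" for n by (rule radial_nonnegD(2)[OF f])
  show "g x = g y" by (rule LIMSEQ_unique[OF lim[of x]], unfold eq, rule lim)
qed

lemma radial_nonneg_cmult:
  assumes "0 \<le> c" "radial_nonneg f"
  shows "radial_nonneg (\<lambda>x. c * f x)"
  by (intro radial_nonnegI arg_cong[where f="(*) c"] radial_nonnegD(2)[OF assms(2)])
     (simp_all add: assms(1) radial_nonnegD(1)[OF assms(2)])

lemma radial_nonneg_sum:
  assumes f: "\<And>i. i \<in> I \<Longrightarrow> radial_nonneg (f i)"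
  shows "radial_nonneg (\<lambda>x. \<Sum>i\<in>I. f i x)"
  by (rule radial_nonnegI) (auto intro!: sum_nonneg intro: radial_nonnegD(1)[OF f] sum.cong[OF refl] radial_nonnegD(2)[OF f])

lemma integrable_mult_cos:
  fixes f :: "'a::euclidean_space \<Rightarrow> real"
  assumes "integrable lborel f"
  shows "integrable lborel (\<lambda>\<xi>. f \<xi> * cos (x \<bullet> \<xi>))"
  by (rule Bochner_Integration.integrable_bound[OF assms])
     (use borel_measurable_integrable[OF assms] in \<open>simp_all add: abs_mult mult_left_le\<close>)

lemma integral_mult_cos_LIMSEQ:
  fixes f :: "nat \<Rightarrow> 'a::euclidean_space \<Rightarrow> real"
  assumes w: "integrable lborel w" and bound: "\<And>n \<xi>. \<bar>f n \<xi>\<bar> \<le> w \<xi>"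
    and lim: "\<And>\<xi>. (\<lambda>n. f n \<xi>) \<longlonglongrightarrow> g \<xi>"
    and [measurable]: "\<And>n. f n \<in> borel_measurable borel" "g \<in> borel_measurable borel"
  shows "(\<lambda>n. \<integral>\<xi>. f n \<xi> * cos (x \<bullet> \<xi>) \<partial>lborel) \<longlonglongrightarrow> (\<integral>\<xi>. g \<xi> * cos (x \<bullet> \<xi>) \<partial>lborel)"
proof (rule integral_dominated_convergence[OF _ _ w])
  show "AE \<xi> in lborel. (\<lambda>n. f n \<xi> * cos (x \<bullet> \<xi>)) \<longlonglongrightarrow> g \<xi> * cos (x \<bullet> \<xi>)"
    by (intro AE_I2 tendsto_intros lim)
  show "AE \<xi> in lborel. norm (f n \<xi> * cos (x \<bullet> \<xi>)) \<le> w \<xi>" for n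
  proof (rule AE_I2)
    fix \<xi> :: 'a
    have "norm (f n \<xi> * cos (x \<bullet> \<xi>)) \<le> \<bar>f n \<xi>\<bar>" by (simp add: abs_mult mult_left_le)
    also note bound
    finally show "norm (f n \<xi> * cos (x \<bullet> \<xi>)) \<le> w \<xi>" .
  qed
qed measurable

lemma radial_nonneg_Gaussian: 
  assumes "0 < c"
  shows "radial_nonneg (\<lambda>x::'a::euclidean_space. \<integral>\<xi>. exp (- c * (norm \<xi>)\<^sup>2) * cos (x \<bullet> \<xi>) \<partial>lborel)"
  unfolding Gaussian_Fourier[OF assms] by (rule radial_nonnegI) (use assms in simp_all)

locale Gaussian_mixture = finite_measure M for M :: "real measure" +
  assumes sets_M [measurable_cong]: "sets M = sets borel"
    and M_nonneg: "AE s in M. 0 \<le> s"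
begin

text \<open>The Laplace transform of \<open>M\<close>, evaluated at |\<xi>|^2.\<close>

definition mix :: "'a::euclidean_space \<Rightarrow> real" where
  "mix \<xi> = (\<integral>s. exp (- s * (norm \<xi>)\<^sup>2) \<partial>M)"

lemma mix_measurable [measurable]: "mix \<in> borel_measurable borel"
  unfolding mix_def by measurable

lemma integrable_mix: "integrable M (\<lambda>s. exp (- s * (norm \<xi>)\<^sup>2))"
  using M_nonneg by (intro integrable_const_bound[where B=1]) auto

lemma mix_nonneg: "0 \<le> mix \<xi>"
  unfolding mix_def by (intro integral_nonneg_AE) auto

lemma mix_le: "mix \<xi> \<le> measure M (space M)"
proof -
  have "mix \<xi> \<le> (\<integral>s. 1 \<partial>M)"
    unfolding mix_def using M_nonneg by (intro integral_mono_AE integrable_mix) auto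
  then show ?thesis by simp
qed

lemma mix_power_le: "mix \<xi> ^ m \<le> measure M (space M) ^ m"
  by (intro power_mono mix_le mix_nonneg)

lemma integrable_mix_power:
  assumes "0 < c"
  shows "integrable lborel (\<lambda>\<xi>::'a::euclidean_space. mix \<xi> ^ m * exp (- c * (norm \<xi>)\<^sup>2))"
  using integrable_mult_right[OF integrable_exp_norm_square[OF assms], of "measure M (space M) ^ m"]
  by (rule Bochner_Integration.integrable_bound)
     (auto intro!: mult_right_mono mix_power_le simp: abs_mult mix_nonneg)

text \<open>A factor \<open>mix\<close> only averages over the parameter $c$ of the Gaussian, so nonnegativity and
  radial symmetry of the Fourier transform pass from one power to the next.\<close>

lemma mix_power_Suc_Fourier:
  fixes x :: "'a::euclidean_space"
  assumes c: "0 < c"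
  shows "(\<integral>\<xi>. mix \<xi> ^ Suc m * exp (- c * (norm \<xi>)\<^sup>2) * cos (x \<bullet> \<xi>) \<partial>lborel) =
    (\<integral>s. (\<integral>\<xi>. mix \<xi> ^ m * exp (- (c + s) * (norm \<xi>)\<^sup>2) * cos (x \<bullet> \<xi>) \<partial>lborel) \<partial>M)"
proof -
  interpret P: pair_sigma_finite M "lborel :: 'a measure" ..
  let ?f = "\<lambda>s (\<xi>::'a). mix \<xi> ^ m * exp (- (c + s) * (norm \<xi>)\<^sup>2) * cos (x \<bullet> \<xi>)"
  let ?g = "\<lambda>(\<xi>::'a). mix \<xi> ^ m * exp (- c * (norm \<xi>)\<^sup>2)"
  have fg: "?f s \<xi> = exp (- s * (norm \<xi>)\<^sup>2) * (?g \<xi> * cos (x \<bullet> \<xi>))" for s \<xi>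
    by (simp add: algebra_simps exp_add[symmetric])
  have int: "integrable (M \<Otimes>\<^sub>M lborel) (\<lambda>(s, \<xi>). ?f s \<xi>)"
  proof (rule P.Fubini_integrable)
    show "(\<lambda>(s, \<xi>). ?f s \<xi>) \<in> borel_measurable (M \<Otimes>\<^sub>M lborel)" by measurable
    have bound: "norm (?f s \<xi>) \<le> ?g \<xi>" if "0 \<le> s" for s \<xi>
    proof -
      have "norm (?f s \<xi>) = exp (- s * (norm \<xi>)\<^sup>2) * (?g \<xi> * \<bar>cos (x \<bullet> \<xi>)\<bar>)"
        unfolding fg using mix_nonneg[of \<xi>] by (simp add: abs_mult)
      also have "\<dots> \<le> 1 * (?g \<xi> * 1)"
        using that mix_nonneg[of \<xi>] by (intro mult_mono) auto
      finally show ?thesis by simp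
    qed
    have int1: "integrable lborel (?f s)" if "0 \<le> s" for s
      by (rule Bochner_Integration.integrable_bound[OF integrable_mix_power[OF c, of m]])
         (use bound[OF that] in \<open>auto intro: order.trans[OF _ abs_ge_self]\<close>)
    show "AE s in M. integrable lborel (\<lambda>\<xi>. (\<lambda>(s, \<xi>). ?f s \<xi>) (s, \<xi>))"
      using M_nonneg by eventually_elim (simp only: split int1)
    show "integrable M (\<lambda>s. \<integral>\<xi>. norm ((\<lambda>(s, \<xi>). ?f s \<xi>) (s, \<xi>)) \<partial>lborel)"
    proof (rule integrable_const_bound[where B="\<integral>\<xi>. ?g \<xi> \<partial>lborel"])
      show "AE s in M. norm (\<integral>\<xi>. norm ((\<lambda>(s, \<xi>). ?f s \<xi>) (s, \<xi>)) \<partial>lborel) \<le> (\<integral>\<xi>. ?g \<xi> \<partial>lborel)"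
        using M_nonneg
      proof eventually_elim
        case (elim s)
        have "(\<integral>\<xi>. norm (?f s \<xi>) \<partial>lborel) \<le> (\<integral>\<xi>. ?g \<xi> \<partial>lborel)"
          using bound[OF elim] int1[OF elim] by (intro integral_mono integrable_norm integrable_mix_power c)
        then show ?case by (simp add: integral_nonneg_AE)
      qed
    qed measurable
  qed
  have "(\<integral>s. (\<integral>\<xi>. ?f s \<xi> \<partial>lborel) \<partial>M) = (\<integral>\<xi>. (\<integral>s. ?f s \<xi> \<partial>M) \<partial>lborel)"
    by (rule P.Fubini_integral[OF int, symmetric])
  also have "\<dots> = (\<integral>\<xi>. mix \<xi> ^ Suc m * exp (- c * (norm \<xi>)\<^sup>2) * cos (x \<bullet> \<xi>) \<partial>lborel)"
    unfolding fg by (intro Bochner_Integration.integral_cong refl)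
      (simp only: integral_mult_left_zero mix_def[symmetric] power_Suc mult.assoc)
  finally show ?thesis ..
qed

lemma radial_nonneg_mix_power:
  assumes "0 < c"
  shows "radial_nonneg (\<lambda>x::'a::euclidean_space. \<integral>\<xi>. mix \<xi> ^ m * exp (- c * (norm \<xi>)\<^sup>2) * cos (x \<bullet> \<xi>) \<partial>lborel)"
  using assms
proof (induction m arbitrary: c)
  case 0
  then show ?case using radial_nonneg_Gaussian by simp
next
  case (Suc m)
  have "AE s in M. radial_nonneg (\<lambda>x::'a. \<integral>\<xi>. mix \<xi> ^ m * exp (- (c + s) * (norm \<xi>)\<^sup>2) * cos (x \<bullet> \<xi>) \<partial>lborel)"
    using M_nonneg by eventually_elim (rule Suc.IH, use Suc.prems in simp)
  then show ?case
    unfolding mix_power_Suc_Fourier[OF Suc.prems]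
    by (intro radial_nonnegI integral_nonneg_AE integral_cong_AE)
       (measurable, auto elim!: eventually_mono intro: radial_nonnegD)
qed

text \<open>The exponential series has nonnegative coefficients, so the result for the powers of
  \<open>mix\<close> carries over. The Gaussian factor provides integrability, as
  \<open>exp (t * mix \<xi>)\<close> is at least 1; it is removed in
  \<open>radial_nonneg_stable_Fourier\<close>.\<close>

lemma radial_nonneg_exp_mix:
  assumes c: "0 < c" and t: "0 \<le> t"
  shows "radial_nonneg (\<lambda>x::'a::euclidean_space. \<integral>\<xi>. exp (t * mix \<xi>) * exp (- c * (norm \<xi>)\<^sup>2) * cos (x \<bullet> \<xi>) \<partial>lborel)"
proof (rule radial_nonneg_LIMSEQ)
  let ?B = "measure M (space M)"
  let ?S = "\<lambda>N (\<xi>::'a). (\<Sum>m<N. (t * mix \<xi>) ^ m /\<^sub>R fact m)"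
  fix x :: 'a
  show "(\<lambda>N. \<integral>\<xi>. ?S N \<xi> * exp (- c * (norm \<xi>)\<^sup>2) * cos (x \<bullet> \<xi>) \<partial>lborel)
     \<longlonglongrightarrow> (\<integral>\<xi>. exp (t * mix \<xi>) * exp (- c * (norm \<xi>)\<^sup>2) * cos (x \<bullet> \<xi>) \<partial>lborel)"
  proof (rule integral_mult_cos_LIMSEQ)
    show "integrable lborel (\<lambda>\<xi>::'a. exp (t * ?B) * exp (- c * (norm \<xi>)\<^sup>2))"
      by (intro integrable_mult_right integrable_exp_norm_square c)
    show "(\<lambda>N. ?S N \<xi> * exp (- c * (norm \<xi>)\<^sup>2)) \<longlonglongrightarrow> exp (t * mix \<xi>) * exp (- c * (norm \<xi>)\<^sup>2)" for \<xi> :: 'a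
      by (intro tendsto_intros exp_converges[unfolded sums_def])
    fix N and \<xi> :: 'a
    have nn: "0 \<le> t * mix \<xi>" using t mix_nonneg[of \<xi>] by simp
    then have S0: "0 \<le> ?S N \<xi>" by (intro sum_nonneg) simp
    have "?S N \<xi> \<le> exp (t * mix \<xi>)"
      unfolding sums_unique[OF exp_converges]
      using nn by (intro sum_le_suminf sums_summable[OF exp_converges]) auto
    also have "\<dots> \<le> exp (t * ?B)" using mix_le[of \<xi>] t by (simp add: mult_left_mono)
    finally show "\<bar>?S N \<xi> * exp (- c * (norm \<xi>)\<^sup>2)\<bar> \<le> exp (t * ?B) * exp (- c * (norm \<xi>)\<^sup>2)"
      using S0 by (simp add: abs_mult)
  qed measurable
next
  fix N :: nat
  have i: "integrable lborel (\<lambda>\<xi>. mix \<xi> ^ m * exp (- c * (norm \<xi>)\<^sup>2) * cos (x \<bullet> \<xi>))" for m and x :: 'a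
    by (intro integrable_mult_cos integrable_mix_power c)
  have "(\<integral>\<xi>. (\<Sum>m<N. (t * mix \<xi>) ^ m /\<^sub>R fact m) * exp (- c * (norm \<xi>)\<^sup>2) * cos (x \<bullet> \<xi>) \<partial>lborel) =
    (\<Sum>m<N. (t ^ m / fact m) * (\<integral>\<xi>. mix \<xi> ^ m * exp (- c * (norm \<xi>)\<^sup>2) * cos (x \<bullet> \<xi>) \<partial>lborel))" for x :: 'a
  proof -
    have "(\<integral>\<xi>. (\<Sum>m<N. (t * mix \<xi>) ^ m /\<^sub>R fact m) * exp (- c * (norm \<xi>)\<^sup>2) * cos (x \<bullet> \<xi>) \<partial>lborel) =
      (\<integral>\<xi>. (\<Sum>m<N. (t ^ m / fact m) * (mix \<xi> ^ m * exp (- c * (norm \<xi>)\<^sup>2) * cos (x \<bullet> \<xi>))) \<partial>lborel)"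
      by (intro Bochner_Integration.integral_cong refl)
         (simp add: sum_distrib_right sum_distrib_left power_mult_distrib divide_inverse mult_ac)
    also have "\<dots> = (\<Sum>m<N. (\<integral>\<xi>. (t ^ m / fact m) * (mix \<xi> ^ m * exp (- c * (norm \<xi>)\<^sup>2) * cos (x \<bullet> \<xi>)) \<partial>lborel))"
      by (intro Bochner_Integration.integral_sum integrable_mult_right i)
    finally show ?thesis by (simp only: integral_mult_right_zero)
  qed
  then show "radial_nonneg (\<lambda>x::'a. \<integral>\<xi>. (\<Sum>m<N. (t * mix \<xi>) ^ m /\<^sub>R fact m) * exp (- c * (norm \<xi>)\<^sup>2) * cos (x \<bullet> \<xi>) \<partial>lborel)"
    using t by (simp only:) (intro radial_nonneg_sum radial_nonneg_cmult radial_nonneg_mix_power c, simp)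
qed

end

text \<open>By \<open>nn_integral_Levy\<close>, $|\xi|^{2\gamma}$ is the limit of the exponents
  $\int (1 - e^{-s|\xi|^2})\,M(ds)$ for these finite measures $M$, and
  $e^{-t \int (1 - e^{-s|\xi|^2})\,M(ds)}$ is a constant times the exponential series of a Gaussian mixture.\<close>

definition Levy_cutoff :: "real \<Rightarrow> nat \<Rightarrow> real measure" where
  "Levy_cutoff \<gamma> n = density lborel
     (\<lambda>s. ennreal (\<gamma> / Gamma (1 - \<gamma>) * s powr (-1 - \<gamma>)) * indicator {1 / real (Suc n)<..} s)"

text \<open>The mass is finite because 1 - e^(-s) is bounded below beyond the cutoff: the density is
  at most a constant \<open>?k\<close> times the integrand of \<open>nn_integral_Levy\<close> at l =
  1.\<close>

lemma Gaussian_mixture_Levy_cutoff: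
  assumes \<gamma>: "0 < \<gamma>" "\<gamma> < 1"
  shows "Gaussian_mixture (Levy_cutoff \<gamma> n)"
proof (intro Gaussian_mixture.intro Gaussian_mixture_axioms.intro finite_measureI)
  let ?e = "1 / real (Suc n)" and ?C = "\<gamma> / Gamma (1 - \<gamma>)"
  let ?g = "\<lambda>s. ?C * ((1 - exp (- 1 * s)) * s powr (-1 - \<gamma>))"
  have C: "0 < ?C" using \<gamma> by simp
  let ?k = "1 / (1 - exp (- ?e))"
  have k: "0 < ?k" by simp
  show "emeasure (Levy_cutoff \<gamma> n) (space (Levy_cutoff \<gamma> n)) \<noteq> \<infinity>"
  proof -
    have "emeasure (Levy_cutoff \<gamma> n) (space (Levy_cutoff \<gamma> n)) =
      (\<integral>\<^sup>+s. ennreal (?C * s powr (-1 - \<gamma>)) * indicator {?e<..} s \<partial>lborel)"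
      unfolding Levy_cutoff_def by (simp add: emeasure_density)
    also have "\<dots> \<le> (\<integral>\<^sup>+s. ennreal ?k * (ennreal (?g s) * indicator {0<..} s) \<partial>lborel)"
    proof (rule nn_integral_mono)
      fix s :: real
      show "ennreal (?C * s powr (-1 - \<gamma>)) * indicator {?e<..} s \<le>
        ennreal ?k * (ennreal (?g s) * indicator {0<..} s)"
      proof (cases "?e < s")
        case True
        then have s: "0 < s" using order.strict_trans[of 0 ?e s] by simp
        have "1 - exp (- ?e) \<le> 1 - exp (- s)" using True by simp
        moreover have e: "0 < 1 - exp (- ?e)" by simp
        ultimately have "1 \<le> ?k * (1 - exp (- s))" by (simp only: le_divide_eq_1_pos times_divide_eq_left mult_1)
        then have "1 * (?C * s powr (-1 - \<gamma>)) \<le> ?k * (1 - exp (- s)) * (?C * s powr (-1 - \<gamma>))"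
          using C by (intro mult_right_mono mult_nonneg_nonneg[OF less_imp_le]) (assumption | simp)+
        then have "?C * s powr (-1 - \<gamma>) \<le> ?k * (?g s)"
          by (simp only: mult_minus1) (simp only: mult_ac mult_1)
        then have "ennreal (?C * s powr (-1 - \<gamma>)) \<le> ennreal (?k * (?g s))"
          by (rule ennreal_leI)
        also have "\<dots> = ennreal ?k * ennreal (?g s)"
          using k by (intro ennreal_mult') simp
        finally show ?thesis using True s by simp
      qed simp
    qed
    also have "\<dots> = ennreal ?k * (\<integral>\<^sup>+s\<in>{0<..}. ennreal (?g s) \<partial>lborel)"
      by (rule nn_integral_cmult) measurable
    also have "\<dots> = ennreal ?k * ennreal (1 powr \<gamma>)"
      by (subst nn_integral_Levy) (use \<gamma> in auto)
    finally show ?thesis by (auto simp: top_unique)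
  qed
  show "sets (Levy_cutoff \<gamma> n) = sets borel" unfolding Levy_cutoff_def by simp
  show "AE s in Levy_cutoff \<gamma> n. 0 \<le> s"
    unfolding Levy_cutoff_def
    by (subst AE_density) (auto split: split_indicator intro!: AE_I2 simp: less_imp_le order.strict_trans1[of 0 ?e])
qed

lemma Levy_cutoff_exponent_nonneg:
  assumes \<gamma>: "0 < \<gamma>" "\<gamma> < 1"
  shows "0 \<le> measure (Levy_cutoff \<gamma> n) (space (Levy_cutoff \<gamma> n)) - Gaussian_mixture.mix (Levy_cutoff \<gamma> n) \<xi>"
  using Gaussian_mixture.mix_le[OF Gaussian_mixture_Levy_cutoff[OF \<gamma>]] by simp

text \<open>The difference is the integral of the nonnegative function 1 - exp(-s|\<xi>|^2) over s >
  1/(n+1), so it increases in n to the integral of \<open>nn_integral_Levy\<close> with l =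
  |\<xi>|^2.\<close>

lemma Levy_cutoff_exponent_LIMSEQ:
  fixes \<xi> :: "'a::euclidean_space"
  assumes \<gamma>: "0 < \<gamma>" "\<gamma> < 1"
  shows "(\<lambda>n. measure (Levy_cutoff \<gamma> n) (space (Levy_cutoff \<gamma> n)) - Gaussian_mixture.mix (Levy_cutoff \<gamma> n) \<xi>)
    \<longlonglongrightarrow> norm \<xi> powr (2 * \<gamma>)"
proof -
  let ?C = "\<gamma> / Gamma (1 - \<gamma>)" and ?l = "(norm \<xi>)\<^sup>2"
  let ?v = "\<lambda>s. ennreal (?C * ((1 - exp (- ?l * s)) * s powr (-1 - \<gamma>)))"
  let ?w = "\<lambda>s. ennreal (?C * s powr (-1 - \<gamma>))"
  let ?D = "\<lambda>n. measure (Levy_cutoff \<gamma> n) (space (Levy_cutoff \<gamma> n)) - Gaussian_mixture.mix (Levy_cutoff \<gamma> n) \<xi>"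
  let ?f = "\<lambda>n s. ?v s * indicator {1 / real (Suc n)<..} s"
  have C: "0 < ?C" using \<gamma> by simp
  have D0: "0 \<le> ?D n" for n
    by (rule Levy_cutoff_exponent_nonneg[OF \<gamma>])
  have D: "ennreal (?D n) = (\<integral>\<^sup>+s. ?f n s \<partial>lborel)" for n
  proof -
    interpret Gaussian_mixture "Levy_cutoff \<gamma> n" by (rule Gaussian_mixture_Levy_cutoff[OF \<gamma>])
    have "?D n = (\<integral>s. 1 - exp (- s * ?l) \<partial>Levy_cutoff \<gamma> n)"
      unfolding mix_def by (subst Bochner_Integration.integral_diff[OF _ integrable_mix]) auto
    also have "ennreal \<dots> = (\<integral>\<^sup>+s. ennreal (1 - exp (- s * ?l)) \<partial>Levy_cutoff \<gamma> n)"
      using M_nonneg by (intro nn_integral_eq_integral[symmetric] Bochner_Integration.integrable_diff integrable_mix) auto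
    also have "\<dots> = (\<integral>\<^sup>+s. ?w s * indicator {1 / real (Suc n)<..} s * ennreal (1 - exp (- s * ?l)) \<partial>lborel)"
      unfolding Levy_cutoff_def by (subst nn_integral_density) auto
    also have "\<dots> = (\<integral>\<^sup>+s. ?f n s \<partial>lborel)"
    proof (rule nn_integral_cong)
      fix s :: real
      have "?w s * ennreal (1 - exp (- s * ?l)) =
          ennreal (?C * s powr (-1 - \<gamma>) * (1 - exp (- s * ?l)))"
        using C by (intro ennreal_mult'[symmetric] mult_nonneg_nonneg[OF less_imp_le]) auto
      then show "?w s * indicator {1 / real (Suc n)<..} s * ennreal (1 - exp (- s * ?l)) = ?f n s"
        by (auto split: split_indicator simp: mult_ac)
    qed
    finally show ?thesis .
  qed
  have "(\<lambda>n. \<integral>\<^sup>+s. ?f n s \<partial>lborel) \<longlonglongrightarrow> (\<integral>\<^sup>+s. ?v s * indicator {0<..} s \<partial>lborel)"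
  proof (rule nn_integral_LIMSEQ)
    show "incseq ?f"
    proof (intro incseq_SucI le_funI mult_left_mono)
      fix n and s :: real
      have "1 / real (Suc (Suc n)) \<le> 1 / real (Suc n)" by (simp add: field_simps)
      then show "indicator {1 / real (Suc n)<..} s \<le> (indicator {1 / real (Suc (Suc n))<..} s :: ennreal)"
        by (auto split: split_indicator)
    qed simp
    fix s :: real
    show "(\<lambda>n. ?f n s) \<longlonglongrightarrow> ?v s * indicator {0<..} s"
    proof (cases "0 < s")
      case True
      have "eventually (\<lambda>n. 1 / real (Suc n) < s) sequentially"
        using LIMSEQ_inverse_real_of_nat True by (auto simp: order_tendsto_iff inverse_eq_divide)
      then show ?thesis
        by (intro tendsto_eventually, elim eventually_mono) (use True in simp)
    next
      case False
      then have "\<not> 1 / real (Suc n) < s" for n using divide_nonneg_nonneg[of 1 "real (Suc n)"] by linarith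
      with False show ?thesis by simp
    qed
  qed measurable
  then have "(\<lambda>n. ennreal (?D n)) \<longlonglongrightarrow> ennreal (norm \<xi> powr (2 * \<gamma>))"
    unfolding D using \<gamma> by (subst (asm) nn_integral_Levy) (auto simp: powr_powr[symmetric])
  then show "?D \<longlonglongrightarrow> norm \<xi> powr (2 * \<gamma>)"
    using D0 by (subst (asm) tendsto_ennreal_iff) auto
qed

text \<open>Two limits in a fixed order. For fixed c > 0 the cutoff is removed, with the Gaussian
  factor as dominating function; here exp(-t(B - mix)) = exp(-tB) exp(t mix) reduces the
  approximants to \<open>radial_nonneg_exp_mix\<close>. Then c tends to 0, with
  exp(-t|\<xi>|^\<alpha>) itself as dominating function.\<close>

lemma radial_nonneg_stable_Fourier:
  assumes \<alpha>: "0 < \<alpha>" "\<alpha> < 2" and t: "0 < t"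
  shows "radial_nonneg (\<lambda>x::'a::euclidean_space. \<integral>\<xi>. exp (- t * norm \<xi> powr \<alpha>) * cos (x \<bullet> \<xi>) \<partial>lborel)"
proof -
  define \<gamma> where "\<gamma> = \<alpha> / 2"
  have \<gamma>: "0 < \<gamma>" "\<gamma> < 1" "\<alpha> = 2 * \<gamma>" using \<alpha> by (auto simp: \<gamma>_def)
  let ?D = "\<lambda>n (\<xi>::'a). measure (Levy_cutoff \<gamma> n) (space (Levy_cutoff \<gamma> n)) - Gaussian_mixture.mix (Levy_cutoff \<gamma> n) \<xi>"
  note GM = Gaussian_mixture_Levy_cutoff[OF \<gamma>(1,2)]
  have [measurable]: "Gaussian_mixture.mix (Levy_cutoff \<gamma> n) \<in> borel_measurable (borel :: 'a measure)" for n
    by (rule Gaussian_mixture.mix_measurable[OF GM])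
  have step: "radial_nonneg (\<lambda>x::'a. \<integral>\<xi>. exp (- t * norm \<xi> powr \<alpha>) * exp (- c * (norm \<xi>)\<^sup>2) * cos (x \<bullet> \<xi>) \<partial>lborel)"
    if c: "0 < c" for c
  proof (rule radial_nonneg_LIMSEQ)
    fix n
    let ?B = "measure (Levy_cutoff \<gamma> n) (space (Levy_cutoff \<gamma> n))"
    have "(\<integral>\<xi>. exp (- t * ?D n \<xi>) * exp (- c * (norm \<xi>)\<^sup>2) * cos (x \<bullet> \<xi>) \<partial>lborel) =
      exp (- t * ?B) * (\<integral>\<xi>. exp (t * Gaussian_mixture.mix (Levy_cutoff \<gamma> n) \<xi>) * exp (- c * (norm \<xi>)\<^sup>2) * cos (x \<bullet> \<xi>) \<partial>lborel)" for x :: 'a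
      by (subst integral_mult_right_zero[symmetric])
         (auto intro!: Bochner_Integration.integral_cong simp: exp_add[symmetric] right_diff_distrib exp_diff exp_minus field_simps)
    then show "radial_nonneg (\<lambda>x::'a. \<integral>\<xi>. exp (- t * ?D n \<xi>) * exp (- c * (norm \<xi>)\<^sup>2) * cos (x \<bullet> \<xi>) \<partial>lborel)"
      by (simp only:) (intro radial_nonneg_cmult Gaussian_mixture.radial_nonneg_exp_mix[OF GM], use c t in auto)
  next
    fix x :: 'a
    show "(\<lambda>n. \<integral>\<xi>. exp (- t * ?D n \<xi>) * exp (- c * (norm \<xi>)\<^sup>2) * cos (x \<bullet> \<xi>) \<partial>lborel)
       \<longlonglongrightarrow> (\<integral>\<xi>. exp (- t * norm \<xi> powr \<alpha>) * exp (- c * (norm \<xi>)\<^sup>2) * cos (x \<bullet> \<xi>) \<partial>lborel)"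
    proof (rule integral_mult_cos_LIMSEQ)
      show "integrable lborel (\<lambda>\<xi>::'a. exp (- c * (norm \<xi>)\<^sup>2))" by (rule integrable_exp_norm_square[OF c])
      show "(\<lambda>n. exp (- t * ?D n \<xi>) * exp (- c * (norm \<xi>)\<^sup>2)) \<longlonglongrightarrow> exp (- t * norm \<xi> powr \<alpha>) * exp (- c * (norm \<xi>)\<^sup>2)" for \<xi>
        unfolding \<gamma>(3) by (intro tendsto_intros Levy_cutoff_exponent_LIMSEQ \<gamma>)
      show "\<bar>exp (- t * ?D n \<xi>) * exp (- c * (norm \<xi>)\<^sup>2)\<bar> \<le> exp (- c * (norm \<xi>)\<^sup>2)" for n \<xi>
        using mult_nonneg_nonneg[OF less_imp_le[OF t] Levy_cutoff_exponent_nonneg[OF \<gamma>(1,2), of n \<xi>]] by (simp add: abs_mult)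
    qed measurable
  qed
  show ?thesis
  proof (rule radial_nonneg_LIMSEQ)
    show "radial_nonneg (\<lambda>x::'a. \<integral>\<xi>. exp (- t * norm \<xi> powr \<alpha>) * exp (- inverse (real (Suc n)) * (norm \<xi>)\<^sup>2) * cos (x \<bullet> \<xi>) \<partial>lborel)" for n
      by (rule step) simp
    fix x :: 'a
    show "(\<lambda>n. \<integral>\<xi>. exp (- t * norm \<xi> powr \<alpha>) * exp (- inverse (real (Suc n)) * (norm \<xi>)\<^sup>2) * cos (x \<bullet> \<xi>) \<partial>lborel)
      \<longlonglongrightarrow> (\<integral>\<xi>. exp (- t * norm \<xi> powr \<alpha>) * cos (x \<bullet> \<xi>) \<partial>lborel)"
    proof (rule integral_mult_cos_LIMSEQ)
      show "integrable lborel (\<lambda>\<xi>::'a. exp (- t * norm \<xi> powr \<alpha>))" by (rule integrable_exp_norm_powr[OF \<alpha>(1) t])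
      fix \<xi> :: 'a
      have "(\<lambda>n. exp (- t * norm \<xi> powr \<alpha>) * exp (- inverse (real (Suc n)) * (norm \<xi>)\<^sup>2))
        \<longlonglongrightarrow> exp (- t * norm \<xi> powr \<alpha>) * exp (- 0 * (norm \<xi>)\<^sup>2)"
        by (intro tendsto_intros LIMSEQ_inverse_real_of_nat)
      then show "(\<lambda>n. exp (- t * norm \<xi> powr \<alpha>) * exp (- inverse (real (Suc n)) * (norm \<xi>)\<^sup>2)) \<longlonglongrightarrow> exp (- t * norm \<xi> powr \<alpha>)"
        by simp
      show "\<bar>exp (- t * norm \<xi> powr \<alpha>) * exp (- inverse (real (Suc n)) * (norm \<xi>)\<^sup>2)\<bar> \<le> exp (- t * norm \<xi> powr \<alpha>)" for n
        by (simp add: abs_mult)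
    qed measurable
  qed
qed

section \<open>The stable density and its semigroup\<close>

lemma integrable_product_bounded:
  fixes f :: "'a::euclidean_space \<Rightarrow> real" and g :: "'b::euclidean_space \<Rightarrow> real"
  assumes f: "integrable lborel f" and g: "integrable lborel g"
    and [measurable]: "(\<lambda>(x, y). h x y) \<in> borel_measurable (borel \<Otimes>\<^sub>M borel)"
    and h: "\<And>x y. \<bar>h x y\<bar> \<le> 1"
  shows "integrable (lborel \<Otimes>\<^sub>M lborel) (\<lambda>(x, y). f x * g y * h x y)"
proof -
  have [measurable]: "f \<in> borel_measurable borel" "g \<in> borel_measurable borel"
    using borel_measurable_integrable[OF f] borel_measurable_integrable[OF g] by simp_all
  have "integrable (lborel \<Otimes>\<^sub>M lborel) (\<lambda>(x, y). f x * g y)"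
    by (rule lborel_pair.Fubini_integrable) (use f g in \<open>simp_all add: abs_mult\<close>)
  then show ?thesis
  proof (rule Bochner_Integration.integrable_bound)
    show "AE p in lborel \<Otimes>\<^sub>M lborel. norm (case p of (x, y) \<Rightarrow> f x * g y * h x y) \<le> norm (case p of (x, y) \<Rightarrow> f x * g y)"
    proof (intro AE_I2, clarify)
      fix x y
      show "norm (f x * g y * h x y) \<le> norm (f x * g y)"
        using h[of x y] by (simp add: abs_mult mult_left_le)
    qed
  qed measurable
qed

lemma integral_product_bounded_swap:
  fixes f :: "'a::euclidean_space \<Rightarrow> real" and g :: "'b::euclidean_space \<Rightarrow> real"
  assumes "integrable lborel f" and "integrable lborel g"
    and "(\<lambda>(x, y). h x y) \<in> borel_measurable (borel \<Otimes>\<^sub>M borel)"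
    and "\<And>x y. \<bar>h x y\<bar> \<le> 1"
  shows "(\<integral>x. (\<integral>y. f x * g y * h x y \<partial>lborel) \<partial>lborel) = (\<integral>y. (\<integral>x. f x * g y * h x y \<partial>lborel) \<partial>lborel)"
  using lborel_pair.Fubini_integral[OF integrable_product_bounded[OF assms]] by simp

lemma integral_lborel_uminus:
  fixes f :: "'a::euclidean_space \<Rightarrow> real"
  assumes "f \<in> borel_measurable borel"
  shows "(\<integral>x. f (- x) \<partial>lborel) = (\<integral>x. f x \<partial>lborel)"
  using integral_lborel_affine[OF assms, of "-1" 0] by simp

lemma measurable_stable_density [measurable (raw)]:
  fixes g :: "'b \<Rightarrow> 'a::euclidean_space"
  assumes [measurable]: "f \<in> borel_measurable M" "g \<in> borel_measurable M"
  shows "(\<lambda>w. stable_density \<alpha> (f w) (g w)) \<in> borel_measurable M"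
  unfolding stable_density_def by measurable

context
  fixes \<alpha> :: real
  assumes \<alpha>: "0 < \<alpha>" "\<alpha> < 2"
begin

lemma stable_density_cos:
  fixes x :: "'a::euclidean_space"
  assumes t: "0 < t"
  shows "stable_density \<alpha> t x = 1 / (2 * pi) ^ DIM('a) * (\<integral>\<xi>. exp (- t * norm \<xi> powr \<alpha>) * cos (x \<bullet> \<xi>) \<partial>lborel)"
proof -
  let ?f = "\<lambda>\<xi>. complex_of_real (exp (- t * norm \<xi> powr \<alpha>)) * exp (- \<i> * of_real (x \<bullet> \<xi>))"
  have i: "integrable lborel (\<lambda>\<xi>::'a. complex_of_real (exp (- t * norm \<xi> powr \<alpha>)))"
    by (intro integrable_of_real integrable_exp_norm_powr \<alpha> t)
  have i2: "integrable lborel ?f"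
    by (rule Bochner_Integration.integrable_bound[OF i]) (auto simp: norm_mult)
  have "stable_density \<alpha> t x = Re (of_real (1 / (2 * pi) ^ DIM('a)) * (\<integral>\<xi>. ?f \<xi> \<partial>lborel))"
    unfolding stable_density_def by simp
  also have "\<dots> = 1 / (2 * pi) ^ DIM('a) * Re (\<integral>\<xi>. ?f \<xi> \<partial>lborel)"
    by (simp only: Re_complex_of_real Im_complex_of_real times_complex.sel mult_zero_left diff_zero)
  also have "Re (\<integral>\<xi>. ?f \<xi> \<partial>lborel) = (\<integral>\<xi>. exp (- t * norm \<xi> powr \<alpha>) * cos (x \<bullet> \<xi>) \<partial>lborel)"
    by (subst integral_Re[OF i2, symmetric]) (simp add: Re_exp)
  finally show ?thesis .
qed

lemma radial_nonneg_stable_density: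
  assumes t: "0 < t"
  shows "radial_nonneg (stable_density \<alpha> t :: 'a::euclidean_space \<Rightarrow> real)"
proof -
  have "radial_nonneg (\<lambda>x::'a. 1 / (2 * pi) ^ DIM('a) * (\<integral>\<xi>. exp (- t * norm \<xi> powr \<alpha>) * cos (x \<bullet> \<xi>) \<partial>lborel))"
    by (intro radial_nonneg_cmult radial_nonneg_stable_Fourier \<alpha> t) simp
  then show ?thesis unfolding stable_density_cos[OF t, symmetric] .
qed

lemma stable_density_nonneg: "0 < t \<Longrightarrow> 0 \<le> stable_density \<alpha> t x"
  by (rule radial_nonnegD(1)[OF radial_nonneg_stable_density])

lemma stable_density_radial: "0 < t \<Longrightarrow> norm x = norm (y::'a::euclidean_space) \<Longrightarrow> stable_density \<alpha> t (x::'a) = stable_density \<alpha> t y"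
  by (rule radial_nonnegD(2)[OF radial_nonneg_stable_density])

lemma stable_density_uminus: "0 < t \<Longrightarrow> stable_density \<alpha> t (- x) = stable_density \<alpha> t x"
  by (rule stable_density_radial) simp_all

lemma stable_density_scale:
  fixes x :: "'a::euclidean_space"
  assumes t: "0 < t" and r: "0 < r"
  shows "stable_density \<alpha> (r powr \<alpha> * t) (r *\<^sub>R x) = r powr (- DIM('a)) * stable_density \<alpha> t x"
proof -
  let ?I = "(\<integral>\<xi>. exp (- t * norm (0 + r *\<^sub>R \<xi> :: 'a) powr \<alpha>) * cos (x \<bullet> (0 + r *\<^sub>R \<xi>)) \<partial>lborel)"
  have "(\<integral>\<xi>. exp (- t * norm (\<xi> :: 'a) powr \<alpha>) * cos (x \<bullet> \<xi>) \<partial>lborel) = r ^ DIM('a) *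
    ?I"
    using r by (subst integral_lborel_affine[where c=r and t=0]) auto
  also have "?I =
     (\<integral>\<xi>. exp (- (r powr \<alpha> * t) * norm (\<xi> :: 'a) powr \<alpha>) * cos ((r *\<^sub>R x) \<bullet> \<xi>) \<partial>lborel)"
    using r by (intro Bochner_Integration.integral_cong) (auto simp: powr_mult mult_ac)
  finally show ?thesis
    using r t by (simp add: stable_density_cos powr_minus powr_realpow)
qed

section \<open>Fourier inversion for the stable density\<close>

text \<open>Regularised inversion formula: integrability of the density is not known yet, and the
  weight exp(-e|x|^2) is what permits Fubini. The right-hand side averages the mollifications of
  exp(-t|.|^\<alpha>) at \<eta> and at -\<eta>, both of which come from the product formula for
  cosines.\<close>

lemma Gaussian_weighted_stable_density:
  fixes \<eta> :: "'a::euclidean_space"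
  assumes t: "0 < t" and e: "0 < e"
  shows "(\<integral>x. stable_density \<alpha> t x * exp (- e * (norm x)\<^sup>2) * cos (\<eta> \<bullet> x) \<partial>lborel) =
    1 / (2 * pi) ^ DIM('a) * sqrt (pi / e) ^ DIM('a) *
      (((\<integral>\<xi>. exp (- t * norm \<xi> powr \<alpha>) * exp (- (norm (\<xi> - \<eta>))\<^sup>2 / (4 * e)) \<partial>lborel) +
       (\<integral>\<xi>. exp (- t * norm \<xi> powr \<alpha>) * exp (- (norm (\<xi> + \<eta>))\<^sup>2 / (4 * e)) \<partial>lborel)) / 2)"
proof -
  let ?E = "\<lambda>\<xi>::'a. exp (- t * norm \<xi> powr \<alpha>)" and ?G = "\<lambda>x::'a. exp (- e * (norm x)\<^sup>2)"
  let ?H = "\<lambda>x \<xi>. ?G x * ?E \<xi> * (cos (x \<bullet> \<xi>) * cos (\<eta> \<bullet> x))"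
  let ?N = "\<lambda>\<xi>. ?E \<xi> * exp (- (norm (\<xi> + \<eta>))\<^sup>2 / (4 * e))"
  let ?M = "\<lambda>\<xi>. ?E \<xi> * exp (- (norm (\<xi> - \<eta>))\<^sup>2 / (4 * e))"
  let ?c = "1 / (2 * pi) ^ DIM('a)"
  have iE: "integrable lborel ?E" by (rule integrable_exp_norm_powr[OF \<alpha>(1) t])
  have iG: "integrable lborel ?G" by (rule integrable_exp_norm_square[OF e])
  have iEG: "integrable lborel (\<lambda>\<xi>. ?E \<xi> * exp (- (norm (\<xi> + v))\<^sup>2 / (4 * e)))" for v
    by (rule Bochner_Integration.integrable_bound[OF iE]) (use e in auto)
  have "(\<integral>x. stable_density \<alpha> t x * ?G x * cos (\<eta> \<bullet> x) \<partial>lborel) =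
    (\<integral>x. ?c * (\<integral>\<xi>. ?H x \<xi> \<partial>lborel) \<partial>lborel)"
    by (intro Bochner_Integration.integral_cong refl, subst stable_density_cos[OF t])
       (simp only: mult.assoc integral_mult_right_zero[symmetric] integral_mult_left_zero[symmetric],
        simp only: mult_ac)
  also have "\<dots> = ?c * (\<integral>\<xi>. (\<integral>x. ?H x \<xi> \<partial>lborel) \<partial>lborel)"
    by (subst integral_mult_right_zero, subst integral_product_bounded_swap[OF iG iE])
       (auto simp: abs_mult intro!: mult_le_one)
  also have "(\<lambda>\<xi>. \<integral>x. ?H x \<xi> \<partial>lborel) =
    (\<lambda>\<xi>. sqrt (pi / e) ^ DIM('a) * ((?M \<xi> + ?N \<xi>) / 2))"
  proof
    fix \<xi> :: 'a
    have "(\<integral>x. ?H x \<xi> \<partial>lborel) =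
      (\<integral>x. ?E \<xi> / 2 * (?G x * cos ((\<xi> - \<eta>) \<bullet> x) + ?G x * cos ((\<xi> + \<eta>) \<bullet> x)) \<partial>lborel)"
    proof (intro Bochner_Integration.integral_cong refl)
      fix x
      have "cos (x \<bullet> \<xi>) * cos (\<eta> \<bullet> x) = (cos ((\<xi> - \<eta>) \<bullet> x) + cos ((\<xi> + \<eta>) \<bullet> x)) / 2"
        unfolding cos_times_cos by (simp add: inner_diff_left inner_add_left inner_commute[of x \<xi>])
      moreover have "g * e * ((a + b) / 2) = e / 2 * (g * a + g * b)" for g e a b :: real
        by (simp add: field_simps)
      ultimately show "?H x \<xi> =
        ?E \<xi> / 2 * (?G x * cos ((\<xi> - \<eta>) \<bullet> x) + ?G x * cos ((\<xi> + \<eta>) \<bullet> x))"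
        by (simp only:)
    qed
    also have "\<dots> = ?E \<xi> / 2 * ((\<integral>x. ?G x * cos ((\<xi> - \<eta>) \<bullet> x) \<partial>lborel) + (\<integral>x. ?G x * cos ((\<xi> + \<eta>) \<bullet> x) \<partial>lborel))"
      by (subst integral_mult_right_zero, subst Bochner_Integration.integral_add) (intro integrable_mult_cos iG refl)+
    finally show "(\<integral>x. ?H x \<xi> \<partial>lborel) =
      sqrt (pi / e) ^ DIM('a) * ((?M \<xi> + ?N \<xi>) / 2)"
      by (simp only: Gaussian_Fourier[OF e]) (simp add: algebra_simps)
  qed
  also have "(\<integral>\<xi>. sqrt (pi / e) ^ DIM('a) * ((?M \<xi> + ?N \<xi>) / 2) \<partial>lborel) =
    sqrt (pi / e) ^ DIM('a) * (((\<integral>\<xi>. ?M \<xi> \<partial>lborel) + (\<integral>\<xi>. ?N \<xi> \<partial>lborel)) / 2)"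
    using iEG[of \<eta>] iEG[of "-\<eta>"]
    by (subst integral_mult_right_zero, subst integral_divide_zero, subst Bochner_Integration.integral_add) simp_all
  finally show ?thesis by (simp only: mult.assoc)
qed

text \<open>An approximate identity: putting \<xi> = \<eta> + 2 sqrt(e n) w turns the mollifier into
  the fixed Gaussian exp(-|w|^2), the powers of \<open>e n\<close> cancel against the prefactor, and
  dominated convergence applies.\<close>

lemma mollified_exp_LIMSEQ:
  fixes \<eta> :: "'a::euclidean_space"
  assumes t: "0 < t" and e: "e \<longlonglongrightarrow> 0" "\<And>n. 0 < e n"
  shows "(\<lambda>n. 1 / (2 * pi) ^ DIM('a) * sqrt (pi / e n) ^ DIM('a) *
      (\<integral>\<xi>. exp (- t * norm \<xi> powr \<alpha>) * exp (- (norm (\<xi> - \<eta>))\<^sup>2 / (4 * e n)) \<partial>lborel)) \<longlonglongrightarrow> exp (- t * norm \<eta> powr \<alpha>)"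
proof -
  let ?E = "\<lambda>\<xi>::'a. exp (- t * norm \<xi> powr \<alpha>)"
  let ?H = "\<lambda>n w. ?E (\<eta> + (2 * sqrt (e n)) *\<^sub>R w) * exp (- 1 * (norm w)\<^sup>2)"
  have G1: "(\<integral>w. exp (- 1 * (norm (w::'a))\<^sup>2) \<partial>lborel) = sqrt pi ^ DIM('a)"
    using Gaussian_Fourier[of 1 "0::'a"] by simp
  have eq: "1 / (2 * pi) ^ DIM('a) * sqrt (pi / e n) ^ DIM('a) * (\<integral>\<xi>. ?E \<xi> * exp (- (norm (\<xi> - \<eta>))\<^sup>2 / (4 * e n)) \<partial>lborel) =
    1 / sqrt pi ^ DIM('a) * (\<integral>w. ?H n w \<partial>lborel)" for n
  proof -
    have k: "0 < 2 * sqrt (e n)" using e by simp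
    have "(\<integral>\<xi>. ?E \<xi> * exp (- (norm (\<xi> - \<eta>))\<^sup>2 / (4 * e n)) \<partial>lborel) = (2 * sqrt (e n)) ^ DIM('a) *
      (\<integral>w. ?E (\<eta> + (2 * sqrt (e n)) *\<^sub>R w) * exp (- (norm (\<eta> + (2 * sqrt (e n)) *\<^sub>R w - \<eta>))\<^sup>2 / (4 * e n)) \<partial>lborel)"
      using k by (subst integral_lborel_affine[where c="2 * sqrt (e n)" and t=\<eta>]) auto
    also have "(\<lambda>w::'a. - (norm (\<eta> + (2 * sqrt (e n)) *\<^sub>R w - \<eta>))\<^sup>2 / (4 * e n)) = (\<lambda>w. - 1 * (norm w)\<^sup>2)"
      using e(2)[of n] by (intro ext) (simp add: power_mult_distrib)
    finally have *: "(\<integral>\<xi>. ?E \<xi> * exp (- (norm (\<xi> - \<eta>))\<^sup>2 / (4 * e n)) \<partial>lborel) = (2 * sqrt (e n)) ^ DIM('a) *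
      (\<integral>w. ?H n w \<partial>lborel)" .
    have "1 / (2 * pi) ^ DIM('a) * sqrt (pi / e n) ^ DIM('a) * (2 * sqrt (e n)) ^ DIM('a) =
        (1 / (2 * pi) * sqrt (pi / e n) * (2 * sqrt (e n))) ^ DIM('a)"
      by (simp only: power_mult_distrib power_divide power_one)
    also have "1 / (2 * pi) * sqrt (pi / e n) * (2 * sqrt (e n)) = 1 / sqrt pi"
      using e(2)[of n] by (simp add: real_sqrt_divide field_simps)
    finally show ?thesis by (simp only: * mult.assoc[symmetric] power_divide power_one)
  qed
  have "(\<lambda>n. \<integral>w. ?H n w \<partial>lborel) \<longlonglongrightarrow>
    (\<integral>w. ?E \<eta> * exp (- 1 * (norm (w::'a))\<^sup>2) \<partial>lborel)"
  proof (rule integral_dominated_convergence[where w="\<lambda>w::'a. exp (- 1 * (norm w)\<^sup>2)"])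
    show "integrable lborel (\<lambda>w::'a. exp (- 1 * (norm w)\<^sup>2))"
      by (rule integrable_exp_norm_square) simp
    show "AE w in lborel. (\<lambda>n. ?H n w) \<longlonglongrightarrow> ?E \<eta> * exp (- 1 * (norm w)\<^sup>2)"
    proof (rule AE_I2)
      fix w :: 'a
      have "(\<lambda>n. ?H n w) \<longlonglongrightarrow> ?E (\<eta> + (2 * sqrt 0) *\<^sub>R w) * exp (- 1 * (norm w)\<^sup>2)"
        using \<alpha> by (intro tendsto_intros tendsto_powr2 e) (auto intro: always_eventually)
      then show "(\<lambda>n. ?H n w) \<longlonglongrightarrow> ?E \<eta> * exp (- 1 * (norm w)\<^sup>2)"
        by simp
    qed
    show "AE w in lborel. norm (?H n w) \<le> exp (- 1 * (norm w)\<^sup>2)" for n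
      using t by (intro AE_I2) (simp add: abs_mult)
  qed measurable
  from tendsto_mult[OF tendsto_const[of "1 / sqrt pi ^ DIM('a)"] this]
  show ?thesis unfolding eq integral_mult_right_zero G1 by simp
qed

lemma Gaussian_weighted_LIMSEQ:
  fixes \<eta> :: "'a::euclidean_space"
  assumes t: "0 < t"
  shows "(\<lambda>n. \<integral>x. stable_density \<alpha> t x * exp (- inverse (real (Suc n)) * (norm x)\<^sup>2) * cos (\<eta> \<bullet> x) \<partial>lborel) \<longlonglongrightarrow> exp (- t * norm \<eta> powr \<alpha>)"
proof -
  let ?e = "\<lambda>n. inverse (real (Suc n))"
  let ?T = "\<lambda>n v. 1 / (2 * pi) ^ DIM('a) * sqrt (pi / ?e n) ^ DIM('a) *
      (\<integral>\<xi>. exp (- t * norm \<xi> powr \<alpha>) * exp (- (norm (\<xi> - v))\<^sup>2 / (4 * ?e n)) \<partial>lborel)"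
  have e: "0 < ?e n" for n by simp
  have "(\<lambda>n. (?T n \<eta> + ?T n (- \<eta>)) / 2) \<longlonglongrightarrow> (exp (- t * norm \<eta> powr \<alpha>) + exp (- t * norm (- \<eta>) powr \<alpha>)) / 2"
    by (intro tendsto_intros mollified_exp_LIMSEQ t e LIMSEQ_inverse_real_of_nat) simp
  also have "(exp (- t * norm \<eta> powr \<alpha>) + exp (- t * norm (- \<eta>) powr \<alpha>)) / 2 = exp (- t * norm \<eta> powr \<alpha>)"
    by simp
  finally have lim: "(\<lambda>n. (?T n \<eta> + ?T n (- \<eta>)) / 2) \<longlonglongrightarrow> exp (- t * norm \<eta> powr \<alpha>)" .
  have "(\<integral>x. stable_density \<alpha> t x * exp (- ?e n * (norm x)\<^sup>2) * cos (\<eta> \<bullet> x) \<partial>lborel) = (?T n \<eta> + ?T n (- \<eta>)) / 2" for n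
    unfolding Gaussian_weighted_stable_density[OF t e] by (simp only: diff_minus_eq_add distrib_left[symmetric] times_divide_eq_right)
  with lim show ?thesis by (simp only:)
qed

lemma integrable_stable_density_Gaussian:
  fixes e :: real
  assumes t: "0 < t" and e: "0 < e"
  shows "integrable lborel (\<lambda>x::'a::euclidean_space. stable_density \<alpha> t x * exp (- e * (norm x)\<^sup>2))"
proof (rule Bochner_Integration.integrable_bound)
  let ?f = "\<lambda>x::'a. stable_density \<alpha> t x * exp (- e * (norm x)\<^sup>2)"
  let ?B = "1 / (2 * pi) ^ DIM('a) * (\<integral>\<xi>. exp (- t * norm (\<xi>::'a) powr \<alpha>) \<partial>lborel)"
  show "integrable lborel (\<lambda>x::'a. ?B * exp (- e * (norm x)\<^sup>2))"
    by (intro integrable_mult_right integrable_exp_norm_square e)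
  show "AE x in lborel. norm (?f x) \<le> norm (?B * exp (- e * (norm (x::'a))\<^sup>2))"
  proof (rule AE_I2)
    fix x :: 'a
    have i: "integrable lborel (\<lambda>\<xi>::'a. exp (- t * norm \<xi> powr \<alpha>))" by (rule integrable_exp_norm_powr[OF \<alpha>(1) t])
    have "(\<integral>\<xi>. exp (- t * norm \<xi> powr \<alpha>) * cos (x \<bullet> \<xi>) \<partial>lborel) \<le> (\<integral>\<xi>. exp (- t * norm (\<xi>::'a) powr \<alpha>) \<partial>lborel)"
      by (intro integral_mono integrable_mult_cos i) simp
    then have "stable_density \<alpha> t x \<le> ?B"
      unfolding stable_density_cos[OF t] by (intro mult_left_mono) simp_all
    then have "?f x \<le> ?B * exp (- e * (norm x)\<^sup>2)"
      by (rule mult_right_mono) simp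
    then show "norm (?f x) \<le> norm (?B * exp (- e * (norm (x::'a))\<^sup>2))"
      using stable_density_nonneg[OF t, of x] by (simp only: real_norm_def abs_of_nonneg[OF mult_nonneg_nonneg[OF _ exp_ge_zero]] order.trans[OF _ abs_ge_self])
  qed
qed measurable

text \<open>The regularised inversion at \<eta> = 0. By positivity of the density, monotone
  convergence removes the Gaussian weight without prior integrability, which follows from this very
  result.\<close>

lemma nn_integral_stable_density:
  assumes t: "0 < t"
  shows "(\<integral>\<^sup>+x. ennreal (stable_density \<alpha> t (x::'a::euclidean_space)) \<partial>lborel) = 1"
proof -
  let ?e = "\<lambda>n. inverse (real (Suc n))"
  let ?f = "\<lambda>n x::'a. stable_density \<alpha> t x * exp (- ?e n * (norm x)\<^sup>2)"
  have f0: "0 \<le> ?f n x" for n x using stable_density_nonneg[OF t, of x] by simp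
  have "(\<lambda>n. \<integral>\<^sup>+x. ennreal (?f n x) \<partial>lborel) \<longlonglongrightarrow> (\<integral>\<^sup>+x. ennreal (stable_density \<alpha> t (x::'a)) \<partial>lborel)"
  proof (rule nn_integral_LIMSEQ)
    show "incseq (\<lambda>n x. ennreal (?f n x))"
    proof (intro incseq_SucI le_funI ennreal_leI mult_left_mono)
      fix n and x :: 'a
      have "?e (Suc n) * (norm x)\<^sup>2 \<le> ?e n * (norm x)\<^sup>2" by (intro mult_right_mono) auto
      then show "exp (- ?e n * (norm x)\<^sup>2) \<le> exp (- ?e (Suc n) * (norm x)\<^sup>2)" by simp
    qed (rule stable_density_nonneg[OF t])
    fix x :: 'a
    have "(\<lambda>n. ?f n x) \<longlonglongrightarrow> stable_density \<alpha> t x * exp (- 0 * (norm x)\<^sup>2)"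
      by (intro tendsto_intros LIMSEQ_inverse_real_of_nat)
    then show "(\<lambda>n. ennreal (?f n x)) \<longlonglongrightarrow> ennreal (stable_density \<alpha> t x)"
      by (intro tendsto_ennrealI) simp
  qed measurable
  moreover have "(\<integral>\<^sup>+x. ennreal (?f n x) \<partial>lborel) = ennreal (\<integral>x. ?f n x * cos (0 \<bullet> x) \<partial>lborel)" for n
    by (subst nn_integral_eq_integral[OF integrable_stable_density_Gaussian[OF t]]) (use f0 in auto)
  moreover have "(\<lambda>n. ennreal (\<integral>x. ?f n x * cos (0 \<bullet> x) \<partial>lborel)) \<longlonglongrightarrow> ennreal (exp (- t * norm (0::'a) powr \<alpha>))"
    by (intro tendsto_ennrealI Gaussian_weighted_LIMSEQ t)
  ultimately show ?thesis
    using LIMSEQ_unique[of "\<lambda>n. \<integral>\<^sup>+x. ennreal (?f n x) \<partial>lborel"] by auto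
qed

lemma integrable_stable_density:
  assumes t: "0 < t"
  shows "integrable lborel (stable_density \<alpha> t :: 'a::euclidean_space \<Rightarrow> real)"
  by (rule integrableI_nonneg) (auto simp: nn_integral_stable_density[OF t] stable_density_nonneg[OF t])

lemma integral_stable_density_cos:
  fixes \<eta> :: "'a::euclidean_space"
  assumes t: "0 < t"
  shows "(\<integral>x. stable_density \<alpha> t x * cos (x \<bullet> \<eta>) \<partial>lborel) = exp (- t * norm \<eta> powr \<alpha>)"
proof (rule LIMSEQ_unique)
  let ?f = "\<lambda>n x. stable_density \<alpha> t x * exp (- inverse (real (Suc n)) * (norm x)\<^sup>2)"
  show "(\<lambda>n. \<integral>x. ?f n x * cos (\<eta> \<bullet> x) \<partial>lborel) \<longlonglongrightarrow> exp (- t * norm \<eta> powr \<alpha>)"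
    by (rule Gaussian_weighted_LIMSEQ[OF t])
  have "(\<lambda>n. \<integral>x. ?f n x * cos (\<eta> \<bullet> x) \<partial>lborel) \<longlonglongrightarrow> (\<integral>x. stable_density \<alpha> t x * cos (\<eta> \<bullet> x) \<partial>lborel)"
  proof (rule integral_mult_cos_LIMSEQ[OF integrable_stable_density[OF t]])
    fix x :: 'a
    have "(\<lambda>n. ?f n x) \<longlonglongrightarrow> stable_density \<alpha> t x * exp (- 0 * (norm x)\<^sup>2)"
      by (intro tendsto_intros LIMSEQ_inverse_real_of_nat)
    then show "(\<lambda>n. ?f n x) \<longlonglongrightarrow> stable_density \<alpha> t x" by simp
    show "\<bar>?f n x\<bar> \<le> stable_density \<alpha> t x" for n
      using stable_density_nonneg[OF t, of x] by (simp add: abs_mult mult_left_le)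
  qed measurable
  then show "(\<lambda>n. \<integral>x. ?f n x * cos (\<eta> \<bullet> x) \<partial>lborel) \<longlonglongrightarrow> (\<integral>x. stable_density \<alpha> t x * cos (x \<bullet> \<eta>) \<partial>lborel)"
    by (simp only: inner_commute[of \<eta>])
qed

lemma integral_stable_density_sin:
  fixes \<eta> :: "'a::euclidean_space"
  assumes t: "0 < t"
  shows "(\<integral>x. stable_density \<alpha> t x * sin (x \<bullet> \<eta>) \<partial>lborel) = 0"
proof -
  have "(\<integral>x. stable_density \<alpha> t (- x) * sin (- x \<bullet> \<eta>) \<partial>lborel) = (\<integral>x. stable_density \<alpha> t x * sin (x \<bullet> \<eta>) \<partial>lborel)"
    by (rule integral_lborel_uminus) measurable
  then show ?thesis by (simp add: stable_density_uminus[OF t])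
qed

text \<open>The cosine integral is inserted for the second factor only; after Fubini the first
  factor is integrated against cos((v-w).\<xi>), where its cosine transform contributes
  exp(-s|\<xi>|^\<alpha>) and its sine transform vanishes by symmetry.\<close>

lemma stable_density_convolution:
  fixes v :: "'a::euclidean_space"
  assumes s: "0 < s" and t: "0 < t"
  shows "(\<integral>w. stable_density \<alpha> s w * stable_density \<alpha> t (v - w) \<partial>lborel) = stable_density \<alpha> (s + t) v"
proof -
  let ?c = "1 / (2 * pi) ^ DIM('a)" and ?p = "stable_density \<alpha> s :: 'a \<Rightarrow> real"
  let ?E = "\<lambda>\<xi>::'a. exp (- t * norm \<xi> powr \<alpha>)"
  let ?H = "\<lambda>w \<xi>. ?p w * ?E \<xi> * cos ((v - w) \<bullet> \<xi>)"
  have iE: "integrable lborel ?E" by (rule integrable_exp_norm_powr[OF \<alpha>(1) t])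
  have ip: "integrable lborel ?p" by (rule integrable_stable_density[OF s])
  have bd: "integrable lborel (\<lambda>w. ?p w * f w)" if "f \<in> borel_measurable borel" "\<And>w. \<bar>f w\<bar> \<le> 1" for f
    by (rule Bochner_Integration.integrable_bound[OF ip])
       (use that in \<open>auto simp: abs_mult mult_left_le\<close>)
  have "(\<integral>w. ?p w * stable_density \<alpha> t (v - w) \<partial>lborel) =
    (\<integral>w. ?c * (\<integral>\<xi>. ?H w \<xi> \<partial>lborel) \<partial>lborel)"
    by (intro Bochner_Integration.integral_cong refl, subst stable_density_cos[OF t])
       (simp only: mult.assoc integral_mult_right_zero, simp only: mult_ac)
  also have "\<dots> = ?c * (\<integral>\<xi>. (\<integral>w. ?H w \<xi> \<partial>lborel) \<partial>lborel)"
    by (subst integral_mult_right_zero, subst integral_product_bounded_swap[OF ip iE]) auto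
  also have "(\<lambda>\<xi>. \<integral>w. ?H w \<xi> \<partial>lborel) = (\<lambda>\<xi>. exp (- (s + t) * norm \<xi> powr \<alpha>) * cos (v \<bullet> \<xi>))"
  proof
    fix \<xi> :: 'a
    have "(\<integral>w. ?H w \<xi> \<partial>lborel) =
      (\<integral>w. ?E \<xi> * (cos (v \<bullet> \<xi>) * (?p w * cos (w \<bullet> \<xi>)) + sin (v \<bullet> \<xi>) * (?p w * sin (w \<bullet> \<xi>))) \<partial>lborel)"
      by (intro Bochner_Integration.integral_cong refl) (simp add: inner_diff_left cos_diff algebra_simps)
    also have "\<dots> = ?E \<xi> * (cos (v \<bullet> \<xi>) * (\<integral>w. ?p w * cos (w \<bullet> \<xi>) \<partial>lborel) + sin (v \<bullet> \<xi>) * (\<integral>w. ?p w * sin (w \<bullet> \<xi>) \<partial>lborel))"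
      by (subst integral_mult_right_zero, subst Bochner_Integration.integral_add)
         (simp only: integral_mult_right_zero | (intro integrable_mult_right bd; simp))+
    also have "\<dots> = exp (- (s + t) * norm \<xi> powr \<alpha>) * cos (v \<bullet> \<xi>)"
      by (simp add: integral_stable_density_cos[OF s] integral_stable_density_sin[OF s] exp_add[symmetric] algebra_simps)
    finally show "(\<integral>w. ?H w \<xi> \<partial>lborel) = exp (- (s + t) * norm \<xi> powr \<alpha>) * cos (v \<bullet> \<xi>)" .
  qed
  also have "?c * (\<integral>\<xi>. exp (- (s + t) * norm \<xi> powr \<alpha>) * cos (v \<bullet> \<xi>) \<partial>lborel) = stable_density \<alpha> (s + t) v"
    using s t by (simp only: stable_density_cos[of "s + t"] add_pos_pos)
  finally show ?thesis .
qed

lemma heat_kernel_semigroup: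
  fixes x y :: "'a::euclidean_space"
  assumes s: "0 < s" and t: "0 < t"
  shows "(\<integral>\<^sup>+z. heat_kernel \<alpha> s x z * heat_kernel \<alpha> t z y \<partial>lborel) = heat_kernel \<alpha> (s + t) x y"
proof -
  let ?p = "stable_density \<alpha> :: real \<Rightarrow> 'a \<Rightarrow> real"
  have "(\<integral>\<^sup>+z. heat_kernel \<alpha> s x z * heat_kernel \<alpha> t z y \<partial>lborel) = (\<integral>\<^sup>+z. ennreal (?p s (z - x) * ?p t (y - z)) \<partial>lborel)"
    unfolding heat_kernel_def by (simp add: ennreal_mult' stable_density_nonneg[OF s])
  also have "\<dots> = (\<integral>\<^sup>+w. ennreal (?p s w * ?p t (y - x - w)) \<partial>lborel)"
    by (subst nn_integral_lborel_affine[where c=1 and t=x]) (auto simp: algebra_simps)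
  also have "\<dots> = ennreal (\<integral>w. ?p s w * ?p t (y - x - w) \<partial>lborel)"
  proof (rule nn_integral_eq_integral)
    let ?B = "1 / (2 * pi) ^ DIM('a) * (\<integral>\<xi>. exp (- t * norm (\<xi>::'a) powr \<alpha>) \<partial>lborel)"
    have i: "integrable lborel (\<lambda>\<xi>::'a. exp (- t * norm \<xi> powr \<alpha>))" by (rule integrable_exp_norm_powr[OF \<alpha>(1) t])
    have B: "?p t u \<le> ?B" for u
      unfolding stable_density_cos[OF t] by (intro mult_left_mono integral_mono integrable_mult_cos i) simp_all
    show "integrable lborel (\<lambda>w. ?p s w * ?p t (y - x - w))"
    proof (rule Bochner_Integration.integrable_bound[OF integrable_mult_left[OF integrable_stable_density[OF s], of ?B]])
      show "AE w in lborel. norm (?p s w * ?p t (y - x - w)) \<le> norm (?p s w * ?B)"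
      proof (rule AE_I2)
        fix w :: 'a
        have "norm (?p t (y - x - w)) \<le> norm ?B"
          using B[of "y - x - w"] stable_density_nonneg[OF t, of "y - x - w"]
          by (simp only: real_norm_def abs_of_nonneg order.trans[OF _ abs_ge_self])
        then show "norm (?p s w * ?p t (y - x - w)) \<le> norm (?p s w * ?B)"
          unfolding norm_mult by (rule mult_left_mono) simp
      qed
    qed measurable
  qed (simp add: stable_density_nonneg[OF s] stable_density_nonneg[OF t])
  finally show ?thesis unfolding stable_density_convolution[OF s t] heat_kernel_def .
qed

end

section \<open>Riesz potentials of the heat kernel\<close>

lemma norm_neg_pow_0 [simp]: "norm_neg_pow 0 x = 1"
  by (simp add: norm_neg_pow_def)

lemma norm_neg_pow_nonzero: "x \<noteq> 0 \<Longrightarrow> norm_neg_pow \<beta> x = ennreal (norm x powr (-\<beta>))"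
  by (simp add: norm_neg_pow_def)

lemma measurable_norm_neg_pow [measurable]: "norm_neg_pow \<beta> \<in> borel_measurable borel"
  unfolding norm_neg_pow_def[abs_def] by measurable

lemma measurable_heat_kernel [measurable (raw)]:
  fixes g h :: "'b \<Rightarrow> 'a::euclidean_space"
  assumes [measurable]: "f \<in> borel_measurable M" "g \<in> borel_measurable M" "h \<in> borel_measurable M"
  shows "(\<lambda>w. heat_kernel \<alpha> (f w) (g w) (h w)) \<in> borel_measurable M"
  unfolding heat_kernel_def by measurable

lemma measurable_indicator_greaterThan [measurable (raw)]:
  fixes f g :: "'b \<Rightarrow> real"
  assumes [measurable]: "f \<in> borel_measurable M" "g \<in> borel_measurable M"
  shows "(\<lambda>w. indicator {f w<..} (g w) :: ennreal) \<in> borel_measurable M"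
  unfolding indicator_def greaterThan_iff greaterThanLessThan_iff by measurable

lemma measurable_indicator_greaterThanLessThan [measurable (raw)]:
  fixes f g h :: "'b \<Rightarrow> real"
  assumes [measurable]: "f \<in> borel_measurable M" "g \<in> borel_measurable M" "h \<in> borel_measurable M"
  shows "(\<lambda>w. indicator {f w<..<g w} (h w) :: ennreal) \<in> borel_measurable M"
  unfolding indicator_def greaterThan_iff greaterThanLessThan_iff by measurable

text \<open>The factor in $\int_0^\infty u^{a-1} p_u(x)\,du = C\,|x|^{-\beta}$, $a = (d-\beta)/\alpha$. Homogeneity
  gives the right-hand side with some $C$, whose value is read off by integrating both sides against
  $e^{-|x|^2/2}$.\<close>

definition Riesz_const :: "nat \<Rightarrow> real \<Rightarrow> real \<Rightarrow> real" where
  "Riesz_const d \<alpha> \<beta> = (2 * pi) powr (- d / 2) * Gamma ((d - \<beta>) / \<alpha>) *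
     (Gamma (\<beta> / 2) * 2 powr (\<beta> / 2)) / (Gamma ((d - \<beta>) / 2) * 2 powr ((d - \<beta>) / 2))"

lemma Riesz_const_pos:
  fixes \<alpha> \<beta> :: real
  assumes "0 < \<alpha>" "0 < \<beta>" "\<beta> < real d"
  shows "0 < Riesz_const d \<alpha> \<beta>"
  unfolding Riesz_const_def using assms by (intro mult_pos_pos divide_pos_pos Gamma_real_pos) auto

text \<open>This is how \<kappa>_\<beta> enters: h_\<beta> has the weight u^(a-1) and
  h_(\<beta>+\<alpha>) the weight u^(a-2), differentiating the first produces the factor a-1, and
  \<kappa>_\<beta> makes up for the different normalisations of the two potentials.\<close>

lemma kappa_const_Riesz_const:
  assumes "0 < \<alpha>" "0 < \<beta>" "\<beta> < d - \<alpha>"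
  shows "kappa_const d \<alpha> \<beta> / Riesz_const d \<alpha> (\<beta> + \<alpha>) = ((d - \<beta>) / \<alpha> - 1) / Riesz_const d \<alpha> \<beta>"
proof -
  \<comment> \<open>w = a - 1, so that Gamma(a) = w Gamma(w) supplies the factor
    (d-\<beta>)/\<alpha> - 1 of the claim.\<close>
  define w where "w = (d - (\<beta> + \<alpha>)) / \<alpha>"
  have w: "0 < w" using assms by (simp add: w_def)
  have dw: "(d - \<beta>) / \<alpha> = w + 1" using assms by (simp add: w_def field_simps)
  have "w \<notin> \<int>\<^sub>\<le>\<^sub>0" using w by (auto elim!: nonpos_Ints_cases)
  then have Gw: "Gamma (w + 1) = w * Gamma w" by (rule Gamma_plus1)
  have pos: "0 < Gamma w" "0 < Gamma (\<beta> / 2)" "0 < Gamma ((\<beta> + \<alpha>) / 2)"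
     "0 < Gamma ((d - \<beta>) / 2)" "0 < Gamma ((d - (\<beta> + \<alpha>)) / 2)"
    using assms w by (intro Gamma_real_pos; simp)+
  have k: "kappa_const d \<alpha> \<beta> = 2 powr \<alpha> * Gamma ((\<beta> + \<alpha>) / 2) * Gamma ((d - \<beta>) / 2) / (Gamma (\<beta> / 2) * Gamma ((d - (\<beta> + \<alpha>)) / 2))"
    using assms by (simp add: kappa_const_def diff_diff_eq)
  have p: "2 powr \<alpha> * (2 powr (\<beta> / 2) * 2 powr ((d - (\<beta> + \<alpha>)) / 2)) = 2 powr ((\<beta> + \<alpha>) / 2) * (2::real) powr ((d - \<beta>) / 2)"
    unfolding powr_add[symmetric] by (rule arg_cong[where f="(powr) 2"]) (simp add: field_simps)
  \<comment> \<open>Pure arithmetic of fractions, applied with G = Gamma(w) and A = w; the only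
    relation between the letters is \<open>h\<close>, the balance of the powers of 2.\<close>
  have alg: "kk * g1 * g2 / (g3 * g4) / (P * G * (g1 * p1) / (g4 * p2)) = A / (P * (A * G) * (g3 * p3) / (g2 * p4))"
    if h: "kk * (p3 * p2) = p1 * p4" and nz: "g1 \<noteq> 0" "g2 \<noteq> 0" "g3 \<noteq> 0" "g4 \<noteq> 0" "P \<noteq> 0" "G \<noteq> 0" "p1 \<noteq> 0" "p2 \<noteq> 0" "p3 \<noteq> 0" "p4 \<noteq> 0" "A \<noteq> 0"
    for kk g1 g2 g3 g4 P G p1 p2 p3 p4 A :: real
  proof -
    have "kk * g1 * g2 / (g3 * g4) / (P * G * (g1 * p1) / (g4 * p2)) = (kk * p2 / p1) * (g2 / (g3 * P * G))"
      using nz by (simp add: mult_ac)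
    also have "kk * p2 / p1 = p4 / p3"
      using nz h by (simp add: frac_eq_eq mult_ac)
    also have "p4 / p3 * (g2 / (g3 * P * G)) = A / (P * (A * G) * (g3 * p3) / (g2 * p4))"
      using nz by (simp add: mult_ac)
    finally show ?thesis .
  qed
  show ?thesis
    unfolding Riesz_const_def k w_def[symmetric] dw Gw add_diff_cancel_right'
    by (rule alg[OF p]) (use pos[THEN less_imp_neq] w in auto)
qed

context
  fixes \<alpha> :: real
  assumes \<alpha>: "0 < \<alpha>" "\<alpha> < 2"
begin

text \<open>Parseval's formula against exp(-|x|^2/2). The choice e = 1/2 in
  \<open>Gaussian_weighted_stable_density\<close> makes this Gaussian its own Fourier transform up
  to a constant, and \<eta> = 0 makes the two averaged terms equal.\<close>

lemma Gaussian_paired_stable_density: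
  assumes t: "0 < t"
  shows "(\<integral>\<^sup>+x. ennreal (stable_density \<alpha> t (x::'a::euclidean_space) * exp (- (1/2) * (norm x)\<^sup>2)) \<partial>lborel) =
    ennreal ((2 * pi) powr (- DIM('a) / 2)) * (\<integral>\<^sup>+\<xi>. ennreal (exp (- t * norm (\<xi>::'a) powr \<alpha>) * exp (- (1/2) * (norm \<xi>)\<^sup>2)) \<partial>lborel)"
proof -
  let ?P = "(2 * pi) powr (- DIM('a) / 2)"
  let ?f = "\<lambda>x::'a. stable_density \<alpha> t (x::'a) * exp (- (1/2) * (norm x)\<^sup>2)"
  let ?E = "\<lambda>\<xi>::'a. exp (- t * norm \<xi> powr \<alpha>) * exp (- (1/2) * (norm \<xi>)\<^sup>2)"
  have iE: "integrable lborel ?E"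
  proof (rule Bochner_Integration.integrable_bound[OF integrable_exp_norm_powr[OF \<alpha>(1) t]])
    show "AE \<xi> in lborel. norm (?E \<xi>) \<le> norm (exp (- t * norm (\<xi>::'a) powr \<alpha>))"
      by (rule AE_I2) (simp add: mult_left_le)
  qed measurable
  have c: "1 / (2 * pi) ^ DIM('a) * sqrt (pi / (1/2)) ^ DIM('a) = ?P"
  proof -
    have "sqrt (pi / (1/2)) ^ DIM('a) = ((2 * pi) powr (1/2)) powr real DIM('a)"
      by (subst powr_realpow) (simp_all add: powr_half_sqrt mult.commute)
    moreover have "1 / (2 * pi) ^ DIM('a) = (2 * pi) powr (- real DIM('a))"
      by (subst powr_minus, subst powr_realpow) (simp_all add: divide_inverse)
    moreover have "(2 * pi) powr (- real DIM('a)) * ((2 * pi) powr (1/2)) powr real DIM('a) = ?P"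
      unfolding powr_powr powr_add[symmetric] by (rule arg_cong[where f="(powr) (2 * pi)"]) (simp add: field_simps)
    ultimately show ?thesis by (simp only:)
  qed
  have "(\<integral>\<^sup>+x. ennreal (?f x) \<partial>lborel) =
      ennreal (\<integral>x. ?f x \<partial>lborel)"
    by (rule nn_integral_eq_integral[OF integrable_stable_density_Gaussian[OF \<alpha> t]])
       (simp_all add: stable_density_nonneg[OF \<alpha> t])
  also have "(\<integral>x. ?f x \<partial>lborel) =
      ?P * (\<integral>\<xi>. ?E \<xi> \<partial>lborel)"
  proof -
    have e: "- (norm \<xi>)\<^sup>2 / (4 * (1/2)) = - (1/2) * (norm \<xi>)\<^sup>2" for \<xi> :: 'a by simp
    have h: "(x + x) / 2 = x" for x :: real by simp
    have half: "(0::real) < 1/2" by simp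
    show ?thesis
      using Gaussian_weighted_stable_density[OF \<alpha> t half, of "0::'a"]
      unfolding diff_zero add_0_right inner_zero_left cos_zero mult_1_right e h c .
  qed
  also have "ennreal \<dots> = ennreal (?P) * ennreal (\<integral>\<xi>. ?E \<xi> \<partial>lborel)"
    by (rule ennreal_mult') (rule powr_ge_zero)
  also have "ennreal (\<integral>\<xi>. ?E \<xi> \<partial>lborel) = (\<integral>\<^sup>+\<xi>. ennreal (?E \<xi>) \<partial>lborel)"
    by (rule nn_integral_eq_integral[OF iE, symmetric]) simp
  finally show ?thesis .
qed

text \<open>The time change u = |x|^\<alpha> v, combined with the scaling of the density; radial
  symmetry allows an arbitrary unit vector \<open>e\<close> in place of x/|x|.\<close>

lemma stable_potential_homogeneous:
  fixes a \<beta> :: real and x e :: "'a::euclidean_space"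
  assumes a: "a = (DIM('a) - \<beta>) / \<alpha>" and x: "x \<noteq> 0" and e: "norm e = 1"
  shows "(\<integral>\<^sup>+u\<in>{0<..}. ennreal (u powr (a - 1) * stable_density \<alpha> u x) \<partial>lborel) =
    ennreal (norm x powr (-\<beta>)) * (\<integral>\<^sup>+u\<in>{0<..}. ennreal (u powr (a - 1) * stable_density \<alpha> u e) \<partial>lborel)"
proof -
  let ?V = "(\<integral>\<^sup>+v\<in>{0<..}. ennreal (v powr (a - 1) * stable_density \<alpha> v e) \<partial>lborel)"
  let ?r = "norm x"
  define k where "k = ?r powr \<alpha>"
  have r: "0 < ?r" and k: "0 < k" using x by (auto simp: k_def)
  have "(\<integral>\<^sup>+u\<in>{0<..}. ennreal (u powr (a - 1) * stable_density \<alpha> u x) \<partial>lborel) =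
    ennreal \<bar>k\<bar> * (\<integral>\<^sup>+v. ennreal ((0 + k * v) powr (a - 1) * stable_density \<alpha> (0 + k * v) x) * indicator {0<..} (0 + k * v) \<partial>lborel)"
    using k by (intro nn_integral_real_affine) auto
  also have "\<dots> = ennreal k * (\<integral>\<^sup>+v. ennreal (k powr (a - 1) * ?r powr (- DIM('a))) * (ennreal (v powr (a - 1) * stable_density \<alpha> v e) * indicator {0<..} v) \<partial>lborel)"
  proof -
    have "ennreal ((0 + k * v) powr (a - 1) * stable_density \<alpha> (0 + k * v) x) * indicator {0<..} (0 + k * v) =
      ennreal (k powr (a - 1) * ?r powr (- DIM('a))) * (ennreal (v powr (a - 1) * stable_density \<alpha> v e) * indicator {0<..} v)" for v
    proof (cases "0 < v")
      case True
      have "stable_density \<alpha> (k * v) x = stable_density \<alpha> (k * v) (?r *\<^sub>R e)"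
        using True k e by (intro stable_density_radial \<alpha>) auto
      also have "\<dots> = ?r powr (- DIM('a)) * stable_density \<alpha> v e"
        unfolding k_def by (rule stable_density_scale[OF \<alpha> True r])
      finally have "(k * v) powr (a - 1) * stable_density \<alpha> (k * v) x =
          k powr (a - 1) * ?r powr (- DIM('a)) * (v powr (a - 1) * stable_density \<alpha> v e)"
        using True k by (simp add: powr_mult)
      moreover have "ennreal (k powr (a - 1) * ?r powr (- DIM('a)) * (v powr (a - 1) * stable_density \<alpha> v e)) =
          ennreal (k powr (a - 1) * ?r powr (- DIM('a))) * ennreal (v powr (a - 1) * stable_density \<alpha> v e)"
        by (rule ennreal_mult') simp
      ultimately show ?thesis using True k by simp
    qed (use k in \<open>simp add: zero_less_mult_iff\<close>)
    then show ?thesis using k by (simp only: abs_of_pos)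
  qed
  also have "\<dots> = ennreal k * (ennreal (k powr (a - 1) * ?r powr (- DIM('a))) * ?V)"
    by (subst nn_integral_cmult) auto
  also have "\<dots> = ennreal (k * (k powr (a - 1) * ?r powr (- DIM('a)))) * ?V"
    using k by (simp add: ennreal_mult mult.assoc)
  also have "k * (k powr (a - 1) * ?r powr (- DIM('a))) = ?r powr (-\<beta>)"
  proof -
    have "k * (k powr (a - 1) * ?r powr (- DIM('a))) = ?r powr \<alpha> * (?r powr (\<alpha> * (a - 1)) * ?r powr (- DIM('a)))"
      by (simp add: k_def powr_powr)
    also have "\<dots> = ?r powr (-\<beta>)"
      unfolding powr_add[symmetric] by (rule arg_cong[where f="(powr) ?r"]) (use \<alpha> in \<open>simp add: a field_simps\<close>)
    finally show ?thesis .
  qed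
  finally show ?thesis .
qed

text \<open>The potential V is paired with exp(-|y|^2/2) in two ways: by homogeneity this gives
  \<open>V e\<close> times a Gaussian moment, and by Parseval the time integral of u^(a-1)
  exp(-u|\<xi>|^\<alpha>) gives Gamma(a)|\<xi>|^(-(d-\<beta>)), hence another Gaussian
  moment.\<close>

lemma stable_potential:
  fixes a \<beta> :: real and x :: "'a::euclidean_space"
  assumes a: "a = (DIM('a) - \<beta>) / \<alpha>" and \<beta>: "0 < \<beta>" "\<beta> < DIM('a)" and x: "x \<noteq> 0"
  shows "(\<integral>\<^sup>+u\<in>{0<..}. ennreal (u powr (a - 1) * stable_density \<alpha> u x) \<partial>lborel) =
    ennreal (Riesz_const DIM('a) \<alpha> \<beta> * norm x powr (-\<beta>))"
proof -
  let ?P = "ennreal ((2 * pi) powr (- DIM('a) / 2))"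
  obtain e :: 'a where "e \<in> Basis" using nonempty_Basis by blast
  then have e: "norm e = 1" by simp
  define V where "V y = (\<integral>\<^sup>+u\<in>{0<..}. ennreal (u powr (a - 1) * stable_density \<alpha> u y) \<partial>lborel)" for y :: 'a
  have V: "V y = ennreal (norm y powr (-\<beta>)) * V e" if "y \<noteq> 0" for y
    unfolding V_def by (rule stable_potential_homogeneous[OF a that e])
  let ?g = "\<lambda>y::'a. exp (- (1/2) * (norm y)\<^sup>2)"
  let ?W = "\<lambda>u (\<xi>::'a). (ennreal (?g \<xi>) * (ennreal (u powr (a - 1) * exp (- (norm \<xi> powr \<alpha>) * u)) * indicator {0<..} u))"
  let ?U = "\<lambda>u (y::'a). ennreal (u powr (a - 1)) * ennreal (stable_density \<alpha> u y * ?g y) * indicator {0<..} u"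
  let ?C = "unit_ball_vol (real DIM('a)) * (DIM('a) / 2)"
  let ?M = "?C * (Gamma ((DIM('a) - \<beta>) / 2) * (1/2) powr (- ((DIM('a) - \<beta>) / 2)))"
  let ?N = "?C * (Gamma (\<beta> / 2) * (1/2) powr (- (\<beta> / 2)))"
  have a0: "0 < a" and ad: "\<alpha> * a = DIM('a) - \<beta>" using \<beta> \<alpha> by (simp_all add: a)
  have C: "0 < ?C" by simp
  have M: "0 < ?M" using C \<beta> by (intro mult_pos_pos Gamma_real_pos) auto
  have ae0: "AE y in lborel. y \<noteq> (0::'a)" by (rule AE_lborel_singleton)
  have "(\<integral>\<^sup>+y. V y * ennreal (?g y) \<partial>lborel) = (\<integral>\<^sup>+y. V e * ennreal (norm y powr (-\<beta>) * ?g y) \<partial>lborel)"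
  proof (rule nn_integral_cong_AE, use ae0 in eventually_elim)
    fix y :: 'a assume "y \<noteq> 0"
    then show "V y * ennreal (?g y) = V e * ennreal (norm y powr (-\<beta>) * ?g y)"
      by (simp add: V ennreal_mult mult_ac)
  qed
  also have "\<dots> = V e * ennreal ?M"
    by (subst nn_integral_cmult, measurable, subst nn_integral_norm_powr_Gaussian) (use \<beta> in auto)
  finally have one: "(\<integral>\<^sup>+y. V y * ennreal (?g y) \<partial>lborel) = V e * ennreal ?M" .
  have "(\<integral>\<^sup>+y. V y * ennreal (?g y) \<partial>lborel) =
    (\<integral>\<^sup>+y. (\<integral>\<^sup>+u. ?U u y \<partial>lborel) \<partial>lborel)"
  proof (rule nn_integral_cong)
    fix y :: 'a
    have "V y * ennreal (?g y) = (\<integral>\<^sup>+u. ennreal (u powr (a - 1) * stable_density \<alpha> u y) * indicator {0<..} u * ennreal (?g y) \<partial>lborel)"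
      unfolding V_def by (rule nn_integral_multc[symmetric]) measurable
    also have "\<dots> = (\<integral>\<^sup>+u. ?U u y \<partial>lborel)"
      by (intro nn_integral_cong) (auto simp: stable_density_nonneg[OF \<alpha>] ennreal_mult mult_ac split: split_indicator)
    finally show "V y * ennreal (?g y) = (\<integral>\<^sup>+u. ?U u y \<partial>lborel)" .
  qed
  also have "\<dots> = (\<integral>\<^sup>+u. (\<integral>\<^sup>+y. ?U u y \<partial>lborel) \<partial>lborel)"
    by (rule lborel_pair.Fubini') measurable
  also have "\<dots> = (\<integral>\<^sup>+u. (\<integral>\<^sup>+\<xi>. ?P * ?W u \<xi> \<partial>lborel) \<partial>lborel)"
  proof (rule nn_integral_cong)
    fix u :: real
    show "(\<integral>\<^sup>+y. ?U u y \<partial>lborel) =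
      (\<integral>\<^sup>+\<xi>. ?P * ?W u \<xi> \<partial>lborel)"
    proof (cases "0 < u")
      case True
      have "(\<integral>\<^sup>+y. ?U u y \<partial>lborel) =
        ennreal (u powr (a - 1)) * (?P * (\<integral>\<^sup>+\<xi>. ennreal (exp (- u * norm (\<xi>::'a) powr \<alpha>) * ?g \<xi>) \<partial>lborel))"
        using True by (subst Gaussian_paired_stable_density[OF True, symmetric], subst nn_integral_cmult[symmetric]) auto
      also have "\<dots> = (\<integral>\<^sup>+\<xi>. ennreal (u powr (a - 1)) * (?P * ennreal (exp (- u * norm (\<xi>::'a) powr \<alpha>) * ?g \<xi>)) \<partial>lborel)"
        by (subst nn_integral_cmult, measurable, subst nn_integral_cmult) auto
      also have "\<dots> = (\<integral>\<^sup>+\<xi>. ?P * ?W u \<xi> \<partial>lborel)"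
        using True by (intro nn_integral_cong) (simp add: ennreal_mult'[symmetric] mult_ac)
      finally show ?thesis .
    qed simp
  qed
  also have "\<dots> = (\<integral>\<^sup>+\<xi>. (\<integral>\<^sup>+u. ?P * ?W u \<xi> \<partial>lborel) \<partial>lborel)"
    by (rule lborel_pair.Fubini') measurable
  also have "\<dots> = (\<integral>\<^sup>+\<xi>. ennreal ((2 * pi) powr (- DIM('a) / 2) * Gamma a) * ennreal (norm \<xi> powr (- (DIM('a) - \<beta>)) * ?g \<xi>) \<partial>lborel)"
  proof (rule nn_integral_cong_AE, use ae0 in eventually_elim)
    fix \<xi> :: 'a assume "\<xi> \<noteq> 0"
    then have "(\<integral>\<^sup>+u. ennreal (u powr (a - 1) * exp (- (norm \<xi> powr \<alpha>) * u)) * indicator {0<..} u \<partial>lborel) = ennreal (Gamma a * (norm \<xi> powr \<alpha>) powr (- a))"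
      by (intro nn_integral_Gamma a0) simp
    also have "(norm \<xi> powr \<alpha>) powr (- a) = norm \<xi> powr (- (DIM('a) - \<beta>))"
      using ad by (simp add: powr_powr)
    finally show "(\<integral>\<^sup>+u. ?P * ?W u \<xi> \<partial>lborel) =
      ennreal ((2 * pi) powr (- DIM('a) / 2) * Gamma a) * ennreal (norm \<xi> powr (- (DIM('a) - \<beta>)) * ?g \<xi>)"
      using a0 by (subst nn_integral_cmult, measurable, subst nn_integral_cmult, measurable)
         (simp add: ennreal_mult'[symmetric] Gamma_real_nonneg mult_ac)
  qed
  also have "\<dots> = ennreal ((2 * pi) powr (- DIM('a) / 2) * Gamma a) * ennreal ?N"
    by (subst nn_integral_cmult, measurable, subst nn_integral_norm_powr_Gaussian) (use \<beta> in auto)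
  finally have two: "V e * ennreal ?M = ennreal ((2 * pi) powr (- DIM('a) / 2) * Gamma a) * ennreal ?N"
    using one by simp
  \<comment> \<open>\<open>V e\<close> is not yet known to be finite; dividing by the positive real
    \<open>?M\<close> is legitimate in either case.\<close>
  have "v = v * ennreal m * ennreal (1 / m)" if "0 < m" for v m
    using that by (simp add: mult.assoc ennreal_mult'[symmetric])
  from this[OF M, of "V e"] have "V e = V e * ennreal ?M * ennreal (1 / ?M)" .
  also have "\<dots> = ennreal ((2 * pi) powr (- DIM('a) / 2) * Gamma a * ?N * (1 / ?M))"
    unfolding two using M a0 \<beta> C
    by (subst ennreal_mult[symmetric], simp add: Gamma_real_nonneg, simp add: Gamma_real_nonneg,
        subst ennreal_mult[symmetric]) (auto simp: Gamma_real_nonneg)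
  also have "(2 * pi) powr (- DIM('a) / 2) * Gamma a * ?N * (1 / ?M) = Riesz_const DIM('a) \<alpha> \<beta>"
    using less_imp_neq[OF unit_ball_vol_pos[of "real DIM('a)"]] by (simp add: Riesz_const_def a powr_minus powr_one_eq_one powr_divide field_simps)
  finally have "V e = ennreal (Riesz_const DIM('a) \<alpha> \<beta>)" .
  with V[OF x] show ?thesis
    using Riesz_const_pos[OF \<alpha>(1) \<beta>] by (simp add: V_def ennreal_mult' mult.commute)
qed

section \<open>The heat flow of powers of the norm\<close>

lemma heat_kernel_norm_neg_pow:
  fixes a \<beta> :: real and x :: "'a::euclidean_space"
  assumes a: "a = (DIM('a) - \<beta>) / \<alpha>" and \<beta>: "0 < \<beta>" "\<beta> < DIM('a)" and t: "0 < t"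
  shows "(\<integral>\<^sup>+y. heat_kernel \<alpha> t x y * norm_neg_pow \<beta> y \<partial>lborel) =
    ennreal (1 / Riesz_const DIM('a) \<alpha> \<beta>) * (\<integral>\<^sup>+v\<in>{t<..}. ennreal ((v - t) powr (a - 1)) * heat_kernel \<alpha> v x 0 \<partial>lborel)"
proof -
  let ?K = "Riesz_const DIM('a) \<alpha> \<beta>"
  let ?W = "\<lambda>u y. (ennreal (1 / ?K) * (ennreal (u powr (a - 1)) * heat_kernel \<alpha> u y 0 * indicator {0<..} u))"
  have K: "0 < ?K" by (rule Riesz_const_pos[OF \<alpha>(1) \<beta>])
  have "(\<integral>\<^sup>+y. heat_kernel \<alpha> t x y * norm_neg_pow \<beta> y \<partial>lborel) =
    (\<integral>\<^sup>+y. (\<integral>\<^sup>+u. heat_kernel \<alpha> t x y * ?W u y \<partial>lborel) \<partial>lborel)"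
  proof (rule nn_integral_cong_AE, use AE_lborel_singleton[of "0::'a"] in eventually_elim)
    fix y :: 'a assume y: "y \<noteq> 0"
    have "norm_neg_pow \<beta> y = ennreal (1 / ?K) * ennreal (?K * norm y powr (-\<beta>))"
      using y K by (simp add: norm_neg_pow_nonzero ennreal_mult'[symmetric])
    also have "\<dots> = ennreal (1 / ?K) * (\<integral>\<^sup>+u. ennreal (u powr (a - 1)) * heat_kernel \<alpha> u y 0 * indicator {0<..} u \<partial>lborel)"
      unfolding stable_potential[OF a \<beta> y, symmetric] heat_kernel_def
      by (rule arg_cong2[where f="(*)", OF refl], rule nn_integral_cong)
         (auto simp: ennreal_mult' stable_density_uminus[OF \<alpha>] split: split_indicator)
    finally show "heat_kernel \<alpha> t x y * norm_neg_pow \<beta> y = (\<integral>\<^sup>+u. heat_kernel \<alpha> t x y * ?W u y \<partial>lborel)"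
      by (subst nn_integral_cmult, measurable, subst nn_integral_cmult) auto
  qed
  also have "\<dots> = (\<integral>\<^sup>+u. (\<integral>\<^sup>+y. heat_kernel \<alpha> t x y * ?W u y \<partial>lborel) \<partial>lborel)"
    by (rule lborel_pair.Fubini') measurable
  also have "\<dots> = (\<integral>\<^sup>+u. ennreal (1 / ?K) * (ennreal (u powr (a - 1)) * heat_kernel \<alpha> (t + u) x 0 * indicator {0<..} u) \<partial>lborel)"
  proof (rule nn_integral_cong)
    fix u :: real
    show "(\<integral>\<^sup>+y. heat_kernel \<alpha> t x y * ?W u y \<partial>lborel) =
      ennreal (1 / ?K) * (ennreal (u powr (a - 1)) * heat_kernel \<alpha> (t + u) x 0 * indicator {0<..} u)"
    proof (cases "0 < u")
      case True
      have "(\<integral>\<^sup>+y. heat_kernel \<alpha> t x y * ?W u y \<partial>lborel) =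
        (\<integral>\<^sup>+y. (ennreal (1 / ?K) * ennreal (u powr (a - 1))) * (heat_kernel \<alpha> t x y * heat_kernel \<alpha> u y 0) \<partial>lborel)"
        using True by (intro nn_integral_cong) (simp add: mult_ac)
      also have "\<dots> = (ennreal (1 / ?K) * ennreal (u powr (a - 1))) * heat_kernel \<alpha> (t + u) x 0"
        by (subst nn_integral_cmult) (simp_all add: heat_kernel_semigroup[OF \<alpha> t True])
      finally show ?thesis using True by (simp add: mult_ac)
    qed simp
  qed
  also have "\<dots> = ennreal (1 / ?K) * (\<integral>\<^sup>+u. ennreal (u powr (a - 1)) * heat_kernel \<alpha> (t + u) x 0 * indicator {0<..} u \<partial>lborel)"
    by (rule nn_integral_cmult) measurable
  also have "(\<integral>\<^sup>+u. ennreal (u powr (a - 1)) * heat_kernel \<alpha> (t + u) x 0 * indicator {0<..} u \<partial>lborel) =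
    (\<integral>\<^sup>+v\<in>{t<..}. ennreal ((v - t) powr (a - 1)) * heat_kernel \<alpha> v x 0 \<partial>lborel)"
    by (subst (2) nn_integral_real_affine[where c=1 and t=t])
       (auto intro!: nn_integral_cong split: split_indicator)
  finally show ?thesis .
qed

text \<open>The fundamental theorem of calculus for s \<mapsto> (v-s)^b, extended by 0 beyond v,
  over [0,t]; the decrease is moved to the side of the final value so that no difference occurs in
  \<open>ennreal\<close>.\<close>

lemma nn_integral_powr_shift:
  fixes b t v :: real
  assumes b: "0 < b" and t: "0 < t" and v: "0 < v"
  shows "ennreal (max 0 (v - t) powr b) + ennreal b * (\<integral>\<^sup>+s\<in>{0<..<t}. ennreal ((v - s) powr (b - 1)) * indicator {s<..} v \<partial>lborel) = ennreal (v powr b)"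
proof -
  let ?f = "\<lambda>s. ennreal (b * (v - s) powr (b - 1))"
  let ?g = "\<lambda>s. (ennreal ((v - s) powr (b - 1)) * indicator {s<..} v * indicator {0<..<t} s)"
  have shift: "(\<integral>\<^sup>+s. ?f s * indicator {v - c..v} s \<partial>lborel) = ennreal (c powr b)" if "0 \<le> c" for c
  proof -
    have "ennreal (c powr b) = (\<integral>\<^sup>+r. ennreal (b * r powr (b - 1)) * indicator {0..c} r \<partial>lborel)"
      using nn_integral_powr_Icc_0[OF b that] by simp
    also have "\<dots> = (\<integral>\<^sup>+s. ?f s * indicator {v - c..v} s \<partial>lborel)"
      by (subst nn_integral_real_affine[where c="-1" and t=v]) (auto intro!: nn_integral_cong split: split_indicator)
    finally show ?thesis ..
  qed
  have "ennreal (v powr b) = (\<integral>\<^sup>+s. ?f s * indicator {v - v..v} s \<partial>lborel)"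
    using shift[of v] v by simp
  \<comment> \<open>[0,v] is split at min v t: the upper part yields the first summand, the lower
    part the integral over s < t. For v \<le> t the upper part degenerates to a point.\<close>
  also have "\<dots> = (\<integral>\<^sup>+s. ?f s * indicator {v - max 0 (v - t)..v} s + ennreal b * ?g s \<partial>lborel)"
  proof (rule nn_integral_cong_AE, use AE_lborel_singleton[of "0::real"] AE_lborel_singleton[of "t::real"] AE_lborel_singleton[of "v::real"] in eventually_elim)
    fix s :: real assume s: "s \<noteq> 0" "s \<noteq> t" "s \<noteq> v"
    have mx: "v - max 0 (v - t) = min v t" by (simp add: max_def min_def)
    have bm: "?f s = ennreal b * ennreal ((v - s) powr (b - 1))" using b by (intro ennreal_mult') simp
    consider "s < 0 \<or> v < s" | "0 < s" "s < v" "s < t" | "0 < s" "s < v" "t < s" using s by linarith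
    then show "?f s * indicator {v - v..v} s = ?f s * indicator {v - max 0 (v - t)..v} s + ennreal b * ?g s"
    proof cases
      case 1
      then have n: "s \<notin> {v - v..v}" "s \<notin> {min v t..v}" and "s \<notin> {0<..<t} \<or> v \<notin> {s<..}" using t v by auto
      from this(3) show ?thesis
        unfolding mx by (elim disjE) (simp_all only: n indicator_simps mult_zero_right mult_zero_left add_0_left not_False_eq_True)
    next
      case 2
      then have "s \<in> {v - v..v}" "s \<notin> {min v t..v}" "s \<in> {0<..<t}" "v \<in> {s<..}" by auto
      then show ?thesis unfolding mx by (simp only: indicator_simps not_False_eq_True mult_zero_right mult_1_right add_0_left bm)
    next
      case 3
      then have "s \<in> {v - v..v}" "s \<in> {min v t..v}" "s \<notin> {0<..<t}" by auto
      then show ?thesis unfolding mx by (simp only: indicator_simps not_False_eq_True mult_zero_right mult_1_right add_0_right)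
    qed
  qed
  also have "\<dots> = ennreal (max 0 (v - t) powr b) + ennreal b * (\<integral>\<^sup>+s. ennreal ((v - s) powr (b - 1)) * indicator {s<..} v * indicator {0<..<t} s \<partial>lborel)"
    by (subst nn_integral_add, measurable, subst shift, simp, subst nn_integral_cmult) auto
  finally show ?thesis ..
qed

text \<open>Both terms become integrals over v against p_v(x), and
  \<open>nn_integral_powr_shift\<close> adds their weights up to v^(a-1), which is the potential of
  h_\<beta> at x. The case \<beta> = 0 is conservation of mass.\<close>

lemma heat_kernel_norm_neg_pow_identity:
  fixes x :: "'a::euclidean_space"
  assumes \<beta>: "0 \<le> \<beta>" "\<beta> < DIM('a) - \<alpha>" and t: "0 < t" and x: "x \<noteq> 0"
  shows "(\<integral>\<^sup>+y. heat_kernel \<alpha> t x y * norm_neg_pow \<beta> y \<partial>lborel) +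
     ennreal (kappa_const DIM('a) \<alpha> \<beta>) * (\<integral>\<^sup>+s\<in>{0<..<t}. (\<integral>\<^sup>+y. heat_kernel \<alpha> s x y * norm_neg_pow (\<beta> + \<alpha>) y \<partial>lborel) \<partial>lborel)
    = norm_neg_pow \<beta> x"
proof (cases "\<beta> = 0")
  case True
  have "(\<integral>\<^sup>+y. heat_kernel \<alpha> t x y \<partial>lborel) = (\<integral>\<^sup>+w. ennreal (stable_density \<alpha> t (w::'a)) \<partial>lborel)"
    unfolding heat_kernel_def by (subst nn_integral_lborel_affine[where c=1 and t=x]) auto
  with True show ?thesis by (simp add: kappa_const_def nn_integral_stable_density[OF \<alpha> t])
next
  case False
  with \<beta> have \<beta>0: "0 < \<beta>" by simp
  define a where "a = (DIM('a) - \<beta>) / \<alpha>"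
  \<comment> \<open>b - 1 = a - 2 is the weight exponent belonging to \<beta>+\<alpha>, and b > 0
    expresses \<beta> < d-\<alpha>.\<close>
  define b where "b = a - 1"
  have b: "b - 1 = (DIM('a) - (\<beta> + \<alpha>)) / \<alpha> - 1" "0 < b" using \<alpha> \<beta> by (auto simp: a_def b_def field_simps)
  let ?K = "Riesz_const DIM('a) \<alpha> \<beta>" and ?K' = "Riesz_const DIM('a) \<alpha> (\<beta> + \<alpha>)" and ?\<kappa> = "kappa_const DIM('a) \<alpha> \<beta>"
  have K: "0 < ?K" "0 < ?K'" using \<alpha> \<beta> \<beta>0 by (auto intro!: Riesz_const_pos)
  have \<kappa>: "?\<kappa> / ?K' = b / ?K" unfolding b_def a_def using \<alpha> \<beta> \<beta>0 by (intro kappa_const_Riesz_const) auto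
  then have \<kappa>0: "0 < ?\<kappa>" using K b by (metis divide_pos_pos zero_less_divide_iff less_asym)
  let ?h = "\<lambda>v. heat_kernel \<alpha> v x 0"
  let ?I = "\<lambda>s. (\<integral>\<^sup>+y. heat_kernel \<alpha> s x y * norm_neg_pow (\<beta> + \<alpha>) y \<partial>lborel)"
  let ?H = "\<lambda>s v. ennreal ((v - s) powr (b - 1)) * ?h v * indicator {s<..} v * indicator {0<..<t} s"
  let ?G = "\<lambda>v. (\<integral>\<^sup>+s\<in>{0<..<t}. ennreal ((v - s) powr (b - 1)) * indicator {s<..} v \<partial>lborel)"
  have first: "(\<integral>\<^sup>+y. heat_kernel \<alpha> t x y * norm_neg_pow \<beta> y \<partial>lborel) =
      ennreal (1 / ?K) * (\<integral>\<^sup>+v\<in>{0<..}. ennreal (max 0 (v - t) powr b) * ?h v \<partial>lborel)"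
    using b t \<alpha> \<beta> \<beta>0 unfolding heat_kernel_norm_neg_pow[OF a_def \<beta>0 _ t] b_def
    by (subst heat_kernel_norm_neg_pow[OF a_def \<beta>0 _ t])
       (auto intro!: arg_cong2[where f="(*)", OF refl] nn_integral_cong split: split_indicator simp: max_def)
  have "ennreal ?\<kappa> * (\<integral>\<^sup>+s\<in>{0<..<t}. ?I s \<partial>lborel) =
    ennreal ?\<kappa> * (\<integral>\<^sup>+s. ennreal (1 / ?K') * (\<integral>\<^sup>+v. ?H s v \<partial>lborel) \<partial>lborel)"
  proof (rule arg_cong2[where f="(*)", OF refl], rule nn_integral_cong)
    fix s :: real
    show "?I s * indicator {0<..<t} s =
      ennreal (1 / ?K') * (\<integral>\<^sup>+v. ?H s v \<partial>lborel)"
    proof (cases "s \<in> {0<..<t}")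
      case True
      then have s: "0 < s" by simp
      show ?thesis using True \<alpha> \<beta> \<beta>0 heat_kernel_norm_neg_pow[OF refl _ _ s, of "\<beta> + \<alpha>" x] by (simp add: b(1))
    qed simp
  qed
  also have "\<dots> = ennreal ?\<kappa> * (ennreal (1 / ?K') * (\<integral>\<^sup>+s. (\<integral>\<^sup>+v. ?H s v \<partial>lborel) \<partial>lborel))"
    by (subst nn_integral_cmult) auto
  also have "(\<integral>\<^sup>+s. (\<integral>\<^sup>+v. ?H s v \<partial>lborel) \<partial>lborel) =
    (\<integral>\<^sup>+v. (\<integral>\<^sup>+s. ?H s v \<partial>lborel) \<partial>lborel)"
    by (rule lborel_pair.Fubini') measurable
  also have "\<dots> = (\<integral>\<^sup>+v\<in>{0<..}. ?G v * ?h v \<partial>lborel)"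
  proof (rule nn_integral_cong)
    fix v :: real
    have "(\<integral>\<^sup>+s. ?H s v \<partial>lborel) =
      (\<integral>\<^sup>+s. ennreal ((v - s) powr (b - 1)) * indicator {s<..} v * indicator {0<..<t} s * (?h v * indicator {0<..} v) \<partial>lborel)"
      by (intro nn_integral_cong) (auto split: split_indicator simp: mult_ac)
    also have "\<dots> = ?G v * (?h v * indicator {0<..} v)"
      by (rule nn_integral_multc) measurable
    finally show "(\<integral>\<^sup>+s. ?H s v \<partial>lborel) =
      ?G v * ?h v * indicator {0<..} v"
      by (simp add: mult.assoc)
  qed
  \<comment> \<open>By \<open>kappa_const_Riesz_const\<close> both terms acquire the common
    prefactor \<open>1 / ?K\<close>.\<close>
  also have "ennreal ?\<kappa> * (ennreal (1 / ?K') * \<dots>) = ennreal (1 / ?K) * (ennreal b * \<dots>)"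
  proof -
    have "ennreal ?\<kappa> * ennreal (1 / ?K') = ennreal (1 / ?K) * ennreal b"
      using K \<kappa> \<kappa>0 b(2) by (simp only: ennreal_mult[symmetric] less_imp_le zero_le_divide_1_iff times_divide_eq_right mult_1_right mult_1_left times_divide_eq_left)
    then show ?thesis by (simp only: mult.assoc[symmetric])
  qed
  finally have second: "ennreal ?\<kappa> * (\<integral>\<^sup>+s\<in>{0<..<t}. ?I s \<partial>lborel) =
    ennreal (1 / ?K) * (ennreal b * (\<integral>\<^sup>+v\<in>{0<..}. ?G v * ?h v \<partial>lborel))" .
  have "(\<integral>\<^sup>+v\<in>{0<..}. ennreal (max 0 (v - t) powr b) * ?h v \<partial>lborel) +
     ennreal b * (\<integral>\<^sup>+v\<in>{0<..}. ?G v * ?h v \<partial>lborel) =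
    (\<integral>\<^sup>+v. ennreal (max 0 (v - t) powr b) * ?h v * indicator {0<..} v +
       ennreal b * (?G v * ?h v * indicator {0<..} v) \<partial>lborel)"
    by (subst nn_integral_add, measurable, subst nn_integral_cmult) auto
  also have "\<dots> = (\<integral>\<^sup>+v\<in>{0<..}. ennreal (v powr (a - 1) * stable_density \<alpha> v x) \<partial>lborel)"
  proof (rule nn_integral_cong)
    fix v :: real
    show "ennreal (max 0 (v - t) powr b) * ?h v * indicator {0<..} v +
       ennreal b * (?G v * ?h v * indicator {0<..} v) =
       ennreal (v powr (a - 1) * stable_density \<alpha> v x) * indicator {0<..} v"
    proof (cases "0 < v")
      case True
      have "ennreal (v powr (a - 1) * stable_density \<alpha> v x) = ennreal (v powr b) * ?h v"
        using True by (simp add: heat_kernel_def b_def ennreal_mult' stable_density_uminus[OF \<alpha>])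
      also have "\<dots> = (ennreal (max 0 (v - t) powr b) + ennreal b * ?G v) * ?h v"
        by (simp only: nn_integral_powr_shift[OF b(2) t True])
      finally show ?thesis using True by (simp add: distrib_right mult.assoc)
    qed simp
  qed
  also have "\<dots> = ennreal (?K * norm x powr (-\<beta>))"
    using \<alpha> \<beta> by (intro stable_potential a_def \<beta>0 x) auto
  finally show ?thesis
    unfolding first second distrib_left[symmetric] using K x
    by (simp add: norm_neg_pow_nonzero ennreal_mult'[symmetric])
qed

end

section \<open>The perturbation series\<close>

lemma measurable_compose3:
  fixes F :: "real \<Rightarrow> 'a::euclidean_space \<Rightarrow> 'a \<Rightarrow> ennreal"
  assumes F: "(\<lambda>(t, x, y). F t x y) \<in> borel_measurable (borel \<Otimes>\<^sub>M borel \<Otimes>\<^sub>M borel)"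
    and [measurable]: "f \<in> borel_measurable M" "g \<in> borel_measurable M" "h \<in> borel_measurable M"
  shows "(\<lambda>w. F (f w) (g w) (h w)) \<in> borel_measurable M"
proof -
  have "(\<lambda>w. (f w, g w, h w)) \<in> M \<rightarrow>\<^sub>M borel \<Otimes>\<^sub>M borel \<Otimes>\<^sub>M borel" by measurable
  from measurable_compose[OF this F] show ?thesis by simp
qed

lemma measurable_perturb_term_joint:
  "(\<lambda>(t, x, y). perturb_term (heat_kernel \<alpha>) (norm_neg_pow \<beta>) n t x (y::'a::euclidean_space))
    \<in> borel_measurable (borel \<Otimes>\<^sub>M borel \<Otimes>\<^sub>M borel)"
proof (induction n)
  case 0
  show ?case by (simp add: case_prod_beta') measurable
next
  case (Suc n)
  note [measurable (raw)] = measurable_compose3[OF Suc.IH]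
  show ?case by (simp add: case_prod_beta') measurable
qed

lemmas measurable_perturb_term [measurable (raw)] = measurable_compose3[OF measurable_perturb_term_joint]

lemma perturb_term_cmult:
  fixes x y :: "'a::euclidean_space"
  shows "perturb_term (heat_kernel \<alpha>) (\<lambda>z. c * norm_neg_pow \<beta> z) n t x y =
    c ^ n * perturb_term (heat_kernel \<alpha>) (norm_neg_pow \<beta>) n t x y"
proof (induction n arbitrary: t x y)
  case (Suc n)
  let ?p = "perturb_term (heat_kernel \<alpha>) (norm_neg_pow \<beta>) n :: real \<Rightarrow> 'a \<Rightarrow> 'a \<Rightarrow> ennreal"
  have "perturb_term (heat_kernel \<alpha>) (\<lambda>z. c * norm_neg_pow \<beta> z) (Suc n) t x y =
    (\<integral>\<^sup>+s. (\<integral>\<^sup>+z. c ^ Suc n * (heat_kernel \<alpha> s x z * norm_neg_pow \<beta> z * ?p (t - s) z y) \<partial>lborel) * indicator {0<..<t} s \<partial>lborel)"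
    by (simp add: Suc.IH mult_ac)
  also have "\<dots> = (\<integral>\<^sup>+s. c ^ Suc n * ((\<integral>\<^sup>+z. heat_kernel \<alpha> s x z * norm_neg_pow \<beta> z * ?p (t - s) z y \<partial>lborel) * indicator {0<..<t} s) \<partial>lborel)"
    by (subst nn_integral_cmult) (auto simp: mult.assoc)
  also have "\<dots> = c ^ Suc n * perturb_term (heat_kernel \<alpha>) (norm_neg_pow \<beta>) (Suc n) t x y"
    by (subst nn_integral_cmult) auto
  finally show ?case .
qed simp

text \<open>The potential is taken with coupling constant 1, so that $\kappa$ becomes the variable of a power series.\<close>

definition perturb_op :: "real \<Rightarrow> nat \<Rightarrow> real \<Rightarrow> ('a::euclidean_space \<Rightarrow> ennreal) \<Rightarrow> 'a \<Rightarrow> ennreal" where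
  "perturb_op \<alpha> n t f x = (\<integral>\<^sup>+y. perturb_term (heat_kernel \<alpha>) (norm_neg_pow \<alpha>) n t x y * f y \<partial>lborel)"

definition perturb_int :: "real \<Rightarrow> nat \<Rightarrow> real \<Rightarrow> ('a::euclidean_space \<Rightarrow> ennreal) \<Rightarrow> 'a \<Rightarrow> ennreal" where
  "perturb_int \<alpha> n t f x = (\<integral>\<^sup>+s\<in>{0<..<t}. perturb_op \<alpha> n s f x \<partial>lborel)"

lemma measurable_perturb_op [measurable (raw)]:
  assumes [measurable]: "\<phi> \<in> borel_measurable borel" "f \<in> borel_measurable M" "g \<in> borel_measurable M"
  shows "(\<lambda>w. perturb_op \<alpha> n (f w) \<phi> (g w)) \<in> borel_measurable M"
  unfolding perturb_op_def by measurable

lemma measurable_perturb_int [measurable (raw)]: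
  assumes [measurable]: "\<phi> \<in> borel_measurable borel" "f \<in> borel_measurable M" "g \<in> borel_measurable M"
  shows "(\<lambda>w. perturb_int \<alpha> n (f w) \<phi> (g w)) \<in> borel_measurable M"
  unfolding perturb_int_def by measurable

lemma perturb_op_0: "perturb_op \<alpha> 0 t f x = (\<integral>\<^sup>+y. heat_kernel \<alpha> t x y * f y \<partial>lborel)"
  by (simp add: perturb_op_def)

lemma perturb_op_Suc:
  assumes [measurable]: "f \<in> borel_measurable borel"
  shows "perturb_op \<alpha> (Suc n) t f x =
    (\<integral>\<^sup>+s\<in>{0<..<t}. (\<integral>\<^sup>+z. heat_kernel \<alpha> s x z * norm_neg_pow \<alpha> z * perturb_op \<alpha> n (t - s) f z \<partial>lborel) \<partial>lborel)"
proof -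
  let ?k = "\<lambda>s z. heat_kernel \<alpha> s x z * norm_neg_pow \<alpha> z"
  let ?p = "perturb_term (heat_kernel \<alpha>) (norm_neg_pow \<alpha>) n"
  let ?J = "\<lambda>s y. (\<integral>\<^sup>+z. ?k s z * (?p (t - s) z y * f y) \<partial>lborel)"
  let ?I = "\<lambda>s y. (\<integral>\<^sup>+z. ?k s z * ?p (t - s) z y \<partial>lborel)"
  have "perturb_op \<alpha> (Suc n) t f x =
    (\<integral>\<^sup>+y. (\<integral>\<^sup>+s. ?J s y * indicator {0<..<t} s \<partial>lborel) \<partial>lborel)"
    unfolding perturb_op_def perturb_term.simps
  proof (rule nn_integral_cong)
    fix y
    have "(\<integral>\<^sup>+s\<in>{0<..<t}. ?I s y \<partial>lborel) * f y =
      (\<integral>\<^sup>+s. ?I s y * indicator {0<..<t} s * f y \<partial>lborel)"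
      by (rule nn_integral_multc[symmetric]) measurable
    also have "\<dots> = (\<integral>\<^sup>+s. ?I s y * f y * indicator {0<..<t} s \<partial>lborel)"
      by (simp only: mult_ac)
    also have "\<dots> = (\<integral>\<^sup>+s. (\<integral>\<^sup>+z. ?k s z * ?p (t - s) z y * f y \<partial>lborel) * indicator {0<..<t} s \<partial>lborel)"
      by (subst nn_integral_multc) auto
    finally show "(\<integral>\<^sup>+s\<in>{0<..<t}. ?I s y \<partial>lborel) * f y =
      (\<integral>\<^sup>+s. ?J s y * indicator {0<..<t} s \<partial>lborel)"
      by (simp only: mult.assoc)
  qed
  also have "\<dots> = (\<integral>\<^sup>+s. (\<integral>\<^sup>+y. ?J s y * indicator {0<..<t} s \<partial>lborel) \<partial>lborel)"
    by (rule lborel_pair.Fubini') measurable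
  also have "\<dots> = (\<integral>\<^sup>+s. (\<integral>\<^sup>+y. ?J s y \<partial>lborel) * indicator {0<..<t} s \<partial>lborel)"
    by (subst nn_integral_multc) auto
  also have "\<dots> = (\<integral>\<^sup>+s\<in>{0<..<t}. (\<integral>\<^sup>+z. ?k s z * perturb_op \<alpha> n (t - s) f z \<partial>lborel) \<partial>lborel)"
  proof (rule nn_integral_cong)
    fix s
    have "(\<integral>\<^sup>+y. ?J s y \<partial>lborel) =
      (\<integral>\<^sup>+z. (\<integral>\<^sup>+y. ?k s z * (?p (t - s) z y * f y) \<partial>lborel) \<partial>lborel)"
      by (rule lborel_pair.Fubini') measurable
    also have "\<dots> = (\<integral>\<^sup>+z. ?k s z * perturb_op \<alpha> n (t - s) f z \<partial>lborel)"
      unfolding perturb_op_def by (subst nn_integral_cmult) auto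
    finally show "(\<integral>\<^sup>+y. ?J s y \<partial>lborel) * indicator {0<..<t} s =
      (\<integral>\<^sup>+z. ?k s z * perturb_op \<alpha> n (t - s) f z \<partial>lborel) * indicator {0<..<t} s"
      by (simp only:)
  qed
  finally show ?thesis .
qed

text \<open>The substitution u = s - r on the triangle 0 < r < s < t.\<close>

lemma nn_integral_simplex_shift:
  fixes G :: "real \<Rightarrow> real \<Rightarrow> ennreal"
  assumes [measurable]: "(\<lambda>(r, u). G r u) \<in> borel_measurable (borel \<Otimes>\<^sub>M borel)"
  shows "(\<integral>\<^sup>+s\<in>{0<..<t}. (\<integral>\<^sup>+r\<in>{0<..<s}. G r (s - r) \<partial>lborel) \<partial>lborel) =
    (\<integral>\<^sup>+r\<in>{0<..<t}. (\<integral>\<^sup>+u\<in>{0<..<t - r}. G r u \<partial>lborel) \<partial>lborel)"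
proof -
  let ?I = "\<lambda>r u. G r u * indicator {0<..<t - r} u * indicator {0<..<t} r"
  let ?H = "\<lambda>r s. G r (s - r) * indicator {0<..<s} r * indicator {0<..<t} s"
  have [measurable (raw)]: "(\<lambda>w. G (f w) (g w)) \<in> borel_measurable M"
    if "f \<in> borel_measurable M" "g \<in> borel_measurable M" for f g and M :: "(real \<times> real) measure"
    using measurable_compose[OF measurable_Pair[OF that] assms] by simp
  have [measurable (raw)]: "(\<lambda>w. G (f w) (g w)) \<in> borel_measurable M"
    if "f \<in> borel_measurable M" "g \<in> borel_measurable M" for f g and M :: "real measure"
    using measurable_compose[OF measurable_Pair[OF that] assms] by simp
  have "(\<integral>\<^sup>+s\<in>{0<..<t}. (\<integral>\<^sup>+r\<in>{0<..<s}. G r (s - r) \<partial>lborel) \<partial>lborel) =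
    (\<integral>\<^sup>+s. (\<integral>\<^sup>+r. ?H r s \<partial>lborel) \<partial>lborel)"
    by (subst nn_integral_multc) auto
  also have "\<dots> = (\<integral>\<^sup>+r. (\<integral>\<^sup>+s. ?H r s \<partial>lborel) \<partial>lborel)"
    by (rule lborel_pair.Fubini') measurable
  also have "\<dots> = (\<integral>\<^sup>+r. (\<integral>\<^sup>+u. ?I r u \<partial>lborel) \<partial>lborel)"
  proof (rule nn_integral_cong)
    fix r :: real
    have "(\<integral>\<^sup>+s. ?H r s \<partial>lborel) =
      (\<integral>\<^sup>+u. G r (r + 1 * u - r) * indicator {0<..<r + 1 * u} r * indicator {0<..<t} (r + 1 * u) \<partial>lborel)"
      by (subst nn_integral_real_affine[where c=1 and t=r]) auto
    also have "\<dots> = (\<integral>\<^sup>+u. ?I r u \<partial>lborel)"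
      by (intro nn_integral_cong) (auto split: split_indicator)
    finally show "(\<integral>\<^sup>+s. ?H r s \<partial>lborel) =
      (\<integral>\<^sup>+u. ?I r u \<partial>lborel)" .
  qed
  also have "\<dots> = (\<integral>\<^sup>+r\<in>{0<..<t}. (\<integral>\<^sup>+u\<in>{0<..<t - r}. G r u \<partial>lborel) \<partial>lborel)"
    by (subst nn_integral_multc) auto
  finally show ?thesis .
qed

text \<open>The time integral obeys the same recursion as \<open>perturb_op\<close>; this is what
  allows B_n + \<kappa>_\<beta> A_n to be inserted into the recursion as one block.\<close>

lemma perturb_int_Suc:
  assumes [measurable]: "f \<in> borel_measurable borel"
  shows "perturb_int \<alpha> (Suc n) t f x =
    (\<integral>\<^sup>+s\<in>{0<..<t}. (\<integral>\<^sup>+z. heat_kernel \<alpha> s x z * norm_neg_pow \<alpha> z * perturb_int \<alpha> n (t - s) f z \<partial>lborel) \<partial>lborel)"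
proof -
  let ?k = "\<lambda>r z. heat_kernel \<alpha> r x z * norm_neg_pow \<alpha> z"
  let ?G = "\<lambda>r u. \<integral>\<^sup>+z. ?k r z * perturb_op \<alpha> n u f z \<partial>lborel"
  have "perturb_int \<alpha> (Suc n) t f x = (\<integral>\<^sup>+s\<in>{0<..<t}. (\<integral>\<^sup>+r\<in>{0<..<s}. ?G r (s - r) \<partial>lborel) \<partial>lborel)"
    unfolding perturb_int_def by (simp only: perturb_op_Suc[OF assms])
  also have "\<dots> = (\<integral>\<^sup>+r\<in>{0<..<t}. (\<integral>\<^sup>+u\<in>{0<..<t - r}. ?G r u \<partial>lborel) \<partial>lborel)"
    by (rule nn_integral_simplex_shift) measurable
  also have "\<dots> = (\<integral>\<^sup>+s\<in>{0<..<t}. (\<integral>\<^sup>+z. heat_kernel \<alpha> s x z * norm_neg_pow \<alpha> z * perturb_int \<alpha> n (t - s) f z \<partial>lborel) \<partial>lborel)"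
  proof (rule nn_integral_cong)
    fix r :: real
    have "(\<integral>\<^sup>+u\<in>{0<..<t - r}. ?G r u \<partial>lborel) =
      (\<integral>\<^sup>+u. (\<integral>\<^sup>+z. ?k r z * perturb_op \<alpha> n u f z * indicator {0<..<t - r} u \<partial>lborel) \<partial>lborel)"
      by (subst nn_integral_multc) auto
    also have "\<dots> = (\<integral>\<^sup>+z. (\<integral>\<^sup>+u. ?k r z * perturb_op \<alpha> n u f z * indicator {0<..<t - r} u \<partial>lborel) \<partial>lborel)"
      by (rule lborel_pair.Fubini') measurable
    also have "\<dots> = (\<integral>\<^sup>+z. (\<integral>\<^sup>+u. ?k r z * (perturb_op \<alpha> n u f z * indicator {0<..<t - r} u) \<partial>lborel) \<partial>lborel)"
      by (simp only: mult.assoc)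
    also have "\<dots> = (\<integral>\<^sup>+z. ?k r z * perturb_int \<alpha> n (t - r) f z \<partial>lborel)"
      unfolding perturb_int_def by (subst nn_integral_cmult) auto
    finally show "(\<integral>\<^sup>+u\<in>{0<..<t - r}. ?G r u \<partial>lborel) * indicator {0<..<t} r =
      (\<integral>\<^sup>+z. ?k r z * perturb_int \<alpha> n (t - r) f z \<partial>lborel) * indicator {0<..<t} r"
      by (simp only:)
  qed
  finally show ?thesis .
qed

lemma norm_neg_pow_mult:
  assumes "x \<noteq> 0"
  shows "norm_neg_pow \<alpha> x * norm_neg_pow \<beta> x = norm_neg_pow (\<beta> + \<alpha>) x"
proof -
  have "norm x powr (- \<alpha>) * norm x powr (- \<beta>) = norm x powr (- (\<beta> + \<alpha>))"
    unfolding powr_add[symmetric] by (rule arg_cong[where f="(powr) (norm x)"]) simp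
  with assms show ?thesis by (simp only: norm_neg_pow_nonzero not_False_eq_True ennreal_mult'[symmetric] powr_ge_zero)
qed

context
  fixes \<alpha> :: real
  assumes \<alpha>: "0 < \<alpha>" "\<alpha> < 2"
begin

lemma perturb_op_identity_0:
  fixes x :: "'a::euclidean_space"
  assumes "0 \<le> \<beta>" "\<beta> < DIM('a) - \<alpha>" "0 < t" "x \<noteq> 0"
  shows "perturb_op \<alpha> 0 t (norm_neg_pow \<beta>) x + ennreal (kappa_const DIM('a) \<alpha> \<beta>) * perturb_int \<alpha> 0 t (norm_neg_pow (\<beta> + \<alpha>)) x
    = norm_neg_pow \<beta> x"
  unfolding perturb_int_def perturb_op_0 by (rule heat_kernel_norm_neg_pow_identity[OF \<alpha> assms])

text \<open>At n = 0 the order-0 identity is applied inside the recursion at the point z and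
  remaining time t-s, leaving p_s against |z|^(-\<alpha>) h_\<beta>(z) = h_(\<beta>+\<alpha>)(z). It
  is used only for almost every z, so x = 0 is allowed here, unlike at order 0. Higher n follow from
  \<open>perturb_int_Suc\<close> read backwards.\<close>

lemma perturb_op_identity_Suc:
  fixes x :: "'a::euclidean_space"
  assumes \<beta>: "0 \<le> \<beta>" "\<beta> < DIM('a) - \<alpha>"
  shows "perturb_op \<alpha> (Suc n) t (norm_neg_pow \<beta>) x + ennreal (kappa_const DIM('a) \<alpha> \<beta>) * perturb_int \<alpha> (Suc n) t (norm_neg_pow (\<beta> + \<alpha>)) x
    = perturb_int \<alpha> n t (norm_neg_pow (\<beta> + \<alpha>)) x"
proof (induction n arbitrary: t x)
  let ?h = "norm_neg_pow \<beta> :: 'a \<Rightarrow> ennreal" and ?h' = "norm_neg_pow (\<beta> + \<alpha>) :: 'a \<Rightarrow> ennreal"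
  let ?k = "ennreal (kappa_const DIM('a) \<alpha> \<beta>)" and ?q = "norm_neg_pow \<alpha> :: 'a \<Rightarrow> ennreal"
  let ?p = "\<lambda>s x z. heat_kernel \<alpha> s x z * ?q z"
  let ?Y = "\<lambda>n t x s. (\<integral>\<^sup>+z. ?p s x z * perturb_int \<alpha> n (t - s) ?h' z \<partial>lborel)"
  let ?X = "\<lambda>n t x s. (\<integral>\<^sup>+z. ?p s x z * perturb_op \<alpha> n (t - s) ?h z \<partial>lborel)"
  let ?S = "\<lambda>n t x s. (\<integral>\<^sup>+z. ?p s x z * (perturb_op \<alpha> n (t - s) ?h z + ?k * perturb_int \<alpha> n (t - s) ?h' z) \<partial>lborel)"
  have comb: "perturb_op \<alpha> (Suc n) t ?h x + ?k * perturb_int \<alpha> (Suc n) t ?h' x =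
    (\<integral>\<^sup>+s\<in>{0<..<t}. ?S n t x s \<partial>lborel)" for n t x
  proof -
    have m: "?h \<in> borel_measurable borel" "?h' \<in> borel_measurable borel" by measurable
    have "perturb_op \<alpha> (Suc n) t ?h x + ?k * perturb_int \<alpha> (Suc n) t ?h' x =
      (\<integral>\<^sup>+s. ?X n t x s * indicator {0<..<t} s +
        ?k * (?Y n t x s * indicator {0<..<t} s) \<partial>lborel)"
      unfolding perturb_op_Suc[OF m(1)] perturb_int_Suc[OF m(2)]
      by (subst nn_integral_add, measurable, subst nn_integral_cmult) auto
    also have "\<dots> = (\<integral>\<^sup>+s\<in>{0<..<t}. ?S n t x s \<partial>lborel)"
    proof (rule nn_integral_cong)
      fix s
      have "?S n t x s =
        (\<integral>\<^sup>+z. ?p s x z * perturb_op \<alpha> n (t - s) ?h z + ?k * (?p s x z * perturb_int \<alpha> n (t - s) ?h' z) \<partial>lborel)"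
        by (intro nn_integral_cong) (simp only: distrib_left mult_ac)
      also have "\<dots> = ?X n t x s + ?k * ?Y n t x s"
        by (subst nn_integral_add, measurable, subst nn_integral_cmult) auto
      finally show "?X n t x s * indicator {0<..<t} s +
        ?k * (?Y n t x s * indicator {0<..<t} s) =
        ?S n t x s * indicator {0<..<t} s"
        by (simp only: distrib_right mult.assoc)
    qed
    finally show ?thesis .
  qed
  {
    case 0
    show ?case
      unfolding comb unfolding perturb_int_def perturb_op_0
    proof (rule nn_integral_cong)
      fix s
      have "(\<integral>\<^sup>+z. ?p s x z * (perturb_op \<alpha> 0 (t - s) ?h z + ?k * perturb_int \<alpha> 0 (t - s) ?h' z) \<partial>lborel)
        = (\<integral>\<^sup>+z. heat_kernel \<alpha> s x z * ?h' z \<partial>lborel)" if s: "s \<in> {0<..<t}"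
      proof (rule nn_integral_cong_AE, use AE_lborel_singleton[of "0::'a"] in eventually_elim)
        fix z :: 'a assume "z \<noteq> 0"
        then show "?p s x z * (perturb_op \<alpha> 0 (t - s) ?h z + ?k * perturb_int \<alpha> 0 (t - s) ?h' z) = heat_kernel \<alpha> s x z * ?h' z"
          using s by (subst perturb_op_identity_0[OF \<beta>]) (simp_all add: norm_neg_pow_mult mult.assoc)
      qed
      then show "(\<integral>\<^sup>+z. ?p s x z * ((\<integral>\<^sup>+y. heat_kernel \<alpha> (t - s) z y * ?h y \<partial>lborel) +
          ?k * (\<integral>\<^sup>+u\<in>{0<..<t - s}. (\<integral>\<^sup>+y. heat_kernel \<alpha> u z y * ?h' y \<partial>lborel) \<partial>lborel)) \<partial>lborel) * indicator {0<..<t} s =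
        (\<integral>\<^sup>+y. heat_kernel \<alpha> s x y * ?h' y \<partial>lborel) * indicator {0<..<t} s"
        unfolding perturb_int_def perturb_op_0 by (auto split: split_indicator)
    qed
  next
    case (Suc n)
    have m: "?h' \<in> borel_measurable borel" by measurable
    show ?case unfolding comb[of "Suc n"] Suc.IH by (rule perturb_int_Suc[OF m, symmetric])
  }
qed

text \<open>The case \<beta> = 0 with \<kappa>_0 = 0. It turns the mass of order n+1 into a time
  integral of order n, the source of monotonicity in time and of the absorption arguments.\<close>

lemma perturb_op_one_Suc:
  fixes x :: "'a::euclidean_space"
  assumes "\<alpha> < DIM('a)"
  shows "perturb_op \<alpha> (Suc n) t (\<lambda>_. 1) x = perturb_int \<alpha> n t (norm_neg_pow \<alpha>) x"
proof -
  have "norm_neg_pow 0 = (\<lambda>_::'a. 1)" by (rule ext) simp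
  with perturb_op_identity_Suc[of 0 n t x] assms show ?thesis by (simp add: kappa_const_def)
qed

lemma perturb_op_one_0: "0 < t \<Longrightarrow> perturb_op \<alpha> 0 t (\<lambda>_. 1) (x :: 'a::euclidean_space) = 1"
  unfolding perturb_op_0 heat_kernel_def
  by (subst nn_integral_lborel_affine[where c=1 and t=x]) (auto simp: nn_integral_stable_density[OF \<alpha>])

text \<open>Running the unperturbed kernel up to time r keeps exactly the part of the n-th term
  whose first interaction happens after r, hence only an inequality for n > 0; for n = 0 it is the
  semigroup law.\<close>

lemma perturb_op_superadditive:
  fixes x :: "'a::euclidean_space"
  assumes [measurable]: "f \<in> borel_measurable borel" and r: "0 < r" "r < t"
  shows "(\<integral>\<^sup>+w. heat_kernel \<alpha> r x w * perturb_op \<alpha> n (t - r) f w \<partial>lborel) \<le> perturb_op \<alpha> n t f x"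
proof (cases n)
  case 0
  have "(\<integral>\<^sup>+w. heat_kernel \<alpha> r x w * perturb_op \<alpha> 0 (t - r) f w \<partial>lborel) =
    (\<integral>\<^sup>+w. (\<integral>\<^sup>+y. heat_kernel \<alpha> r x w * heat_kernel \<alpha> (t - r) w y * f y \<partial>lborel) \<partial>lborel)"
    unfolding perturb_op_0 by (simp only: mult.assoc) (subst nn_integral_cmult, auto)
  also have "\<dots> = (\<integral>\<^sup>+y. (\<integral>\<^sup>+w. heat_kernel \<alpha> r x w * heat_kernel \<alpha> (t - r) w y * f y \<partial>lborel) \<partial>lborel)"
    by (rule lborel_pair.Fubini') measurable
  also have "\<dots> = perturb_op \<alpha> 0 t f x"
    unfolding perturb_op_0 using r heat_kernel_semigroup[OF \<alpha>, of r "t - r" x] by (subst nn_integral_multc) auto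
  finally show ?thesis using 0 by simp
next
  case (Suc m)
  let ?F = "\<lambda>s z. norm_neg_pow \<alpha> z * perturb_op \<alpha> m s f z"
  let ?J = "\<lambda>w s. heat_kernel \<alpha> r x w * (\<integral>\<^sup>+z. heat_kernel \<alpha> s w z * ?F (t - r - s) z \<partial>lborel)"
  have "(\<integral>\<^sup>+w. heat_kernel \<alpha> r x w * perturb_op \<alpha> (Suc m) (t - r) f w \<partial>lborel) =
    (\<integral>\<^sup>+w. (\<integral>\<^sup>+s. ?J w s * indicator {0<..<t - r} s \<partial>lborel) \<partial>lborel)"
    unfolding perturb_op_Suc[OF assms(1)] by (simp only: mult.assoc) (subst nn_integral_cmult, auto)
  also have "\<dots> = (\<integral>\<^sup>+s. (\<integral>\<^sup>+w. ?J w s * indicator {0<..<t - r} s \<partial>lborel) \<partial>lborel)"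
    by (rule lborel_pair.Fubini') measurable
  also have "\<dots> = (\<integral>\<^sup>+s. (\<integral>\<^sup>+z. heat_kernel \<alpha> (r + s) x z * ?F (t - (r + s)) z \<partial>lborel) * indicator {0<..<t - r} s \<partial>lborel)"
  proof (rule nn_integral_cong)
    fix s
    show "(\<integral>\<^sup>+w. ?J w s * indicator {0<..<t - r} s \<partial>lborel) =
      (\<integral>\<^sup>+z. heat_kernel \<alpha> (r + s) x z * ?F (t - (r + s)) z \<partial>lborel) * indicator {0<..<t - r} s"
    proof (cases "s \<in> {0<..<t - r}")
      case True
      then have s: "0 < s" by simp
      have "(\<integral>\<^sup>+w. ?J w s \<partial>lborel) =
        (\<integral>\<^sup>+w. (\<integral>\<^sup>+z. heat_kernel \<alpha> r x w * heat_kernel \<alpha> s w z * ?F (t - r - s) z \<partial>lborel) \<partial>lborel)"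
        by (simp only: mult.assoc) (subst nn_integral_cmult, auto)
      also have "\<dots> = (\<integral>\<^sup>+z. (\<integral>\<^sup>+w. heat_kernel \<alpha> r x w * heat_kernel \<alpha> s w z * ?F (t - r - s) z \<partial>lborel) \<partial>lborel)"
        by (rule lborel_pair.Fubini') measurable
      also have "\<dots> = (\<integral>\<^sup>+z. heat_kernel \<alpha> (r + s) x z * ?F (t - r - s) z \<partial>lborel)"
        using heat_kernel_semigroup[OF \<alpha> r(1) s, of x] by (subst nn_integral_multc) auto
      finally show ?thesis using True by (simp add: diff_diff_eq)
    qed simp
  qed
  \<comment> \<open>The time of the first interaction, counted from the start, is r+s and ranges
    over (r,t).\<close>
  also have "\<dots> = (\<integral>\<^sup>+s. (\<integral>\<^sup>+z. heat_kernel \<alpha> s x z * ?F (t - s) z \<partial>lborel) * indicator {r<..<t} s \<partial>lborel)"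
    by (subst (2) nn_integral_real_affine[where c=1 and t=r]) (auto intro!: nn_integral_cong split: split_indicator)
  also have "\<dots> \<le> perturb_op \<alpha> (Suc m) t f x"
    unfolding perturb_op_Suc[OF assms(1)] using r
    by (intro nn_integral_mono) (auto simp: mult.assoc split: split_indicator)
  finally show ?thesis using Suc by simp
qed

end

section \<open>Interpolation of powers and power series in the coupling\<close>

text \<open>Split at |y| = R. For \<beta> > 0 a large R makes the coefficient of the constant
  function small; R stays free so that later estimates can tune that coefficient.\<close>

lemma norm_neg_pow_interpolate:
  fixes y :: "'a::euclidean_space"
  assumes \<beta>: "0 \<le> \<beta>" "\<beta> \<le> b" and R: "0 < R"
  shows "norm_neg_pow \<beta> y \<le> ennreal (R powr (-\<beta>)) + ennreal (R powr (b - \<beta>)) * norm_neg_pow b y"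
proof (cases "y = 0")
  case True
  then show ?thesis
  proof (cases "b = 0")
    case True
    with \<beta> R show ?thesis by (simp add: add_increasing2)
  next
    case False
    have "ennreal (R powr (b - \<beta>)) * norm_neg_pow b y = \<infinity>"
      using False True R by (simp add: norm_neg_pow_def ennreal_mult_eq_top_iff)
    then show ?thesis by simp
  qed
next
  case False
  then have y: "0 < norm y" by simp
  have "norm y powr (-\<beta>) \<le> R powr (-\<beta>) + R powr (b - \<beta>) * norm y powr (-b)"
  proof (cases "R \<le> norm y")
    case True
    then have "norm y powr (-\<beta>) \<le> R powr (-\<beta>)" using \<beta> R by (intro powr_mono2') auto
    then show ?thesis by (simp add: add_increasing2)
  next
    case False
    have "norm y powr (-\<beta>) = norm y powr (b - \<beta>) * norm y powr (-b)"
      unfolding powr_add[symmetric] by simp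
    also have "\<dots> \<le> R powr (b - \<beta>) * norm y powr (-b)"
      using False \<beta> y by (intro mult_right_mono powr_mono2) auto
    finally show ?thesis by (simp add: add_increasing)
  qed
  then have "ennreal (norm y powr (-\<beta>)) \<le> ennreal (R powr (-\<beta>) + R powr (b - \<beta>) * norm y powr (-b))"
    by (rule ennreal_leI)
  also have "\<dots> = ennreal (R powr (-\<beta>)) + ennreal (R powr (b - \<beta>)) * ennreal (norm y powr (-b))"
    by (simp add: ennreal_mult')
  finally show ?thesis using False by (simp add: norm_neg_pow_nonzero)
qed

lemma suminf_ennreal_Suc: "(\<Sum>n. f n) = f 0 + (\<Sum>n. f (Suc n) :: ennreal)"
  using sums_Suc[OF summable_sums[OF summableI, of "\<lambda>n. f (Suc n)"]]
  by (simp add: sums_iff add.commute)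

text \<open>Only finite partial sums, each continuous in the coupling, pass to the limit;
  convergence at \<open>k\<close> itself is not presupposed.\<close>

lemma suminf_power_left_limit:
  fixes a :: "nat \<Rightarrow> ennreal"
  assumes k: "0 \<le> k0" "k0 < k" and le: "\<And>l. k0 \<le> l \<Longrightarrow> l < k \<Longrightarrow> (\<Sum>n. ennreal l ^ n * a n) \<le> B"
  shows "(\<Sum>n. ennreal k ^ n * a n) \<le> B"
proof (rule suminf_le_const[OF summableI])
  fix N
  \<comment> \<open>The sequence starts at \<open>k0\<close>, stays in [k0,k) and tends to
    \<open>k\<close>.\<close>
  define l where "l j = k - (k - k0) * inverse (real (Suc j))" for j
  have l: "k0 \<le> l j" "l j < k" for j
  proof -
    have "(k - k0) * inverse (real (Suc j)) \<le> (k - k0) * 1"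
      using k by (intro mult_left_mono) (auto simp: field_simps)
    then show "k0 \<le> l j" by (simp add: l_def)
    show "l j < k" using k by (simp add: l_def)
  qed
  have "l \<longlonglongrightarrow> k - (k - k0) * 0"
    unfolding l_def by (intro tendsto_intros LIMSEQ_inverse_real_of_nat)
  then have lim: "l \<longlonglongrightarrow> k" by simp
  have "(\<lambda>j. \<Sum>n<N. ennreal (l j ^ n) * a n) \<longlonglongrightarrow> (\<Sum>n<N. ennreal (k ^ n) * a n)"
  proof (rule tendsto_sum)
    fix n
    have "(\<lambda>j. ennreal (l j ^ n)) \<longlonglongrightarrow> ennreal (k ^ n)"
      by (intro tendsto_ennrealI tendsto_power lim)
    \<comment> \<open>The value \<open>a n\<close> may be infinite, and c \<mapsto> c * \<infinity>
      is discontinuous at 0, so k > 0 matters.\<close>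
    moreover have "ennreal (k ^ n) \<noteq> 0" using k by (simp add: ennreal_eq_0_iff not_le)
    ultimately show "(\<lambda>j. ennreal (l j ^ n) * a n) \<longlonglongrightarrow> ennreal (k ^ n) * a n"
      by (intro tendsto_mult_ennreal tendsto_const) auto
  qed
  moreover have "(\<Sum>n<N. ennreal (l j ^ n) * a n) \<le> B" for j
  proof -
    have "0 \<le> l j" using l(1)[of j] k by simp
    then have "(\<Sum>n<N. ennreal (l j ^ n) * a n) = (\<Sum>n<N. ennreal (l j) ^ n * a n)"
      by (simp add: ennreal_power)
    also have "\<dots> \<le> (\<Sum>n. ennreal (l j) ^ n * a n)" by (intro sum_le_suminf summableI) auto
    also have "\<dots> \<le> B" by (intro le l)
    finally show ?thesis .
  qed
  ultimately have "(\<Sum>n<N. ennreal (k ^ n) * a n) \<le> B"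
    by (intro LIMSEQ_le_const2) auto
  then show "(\<Sum>n<N. ennreal k ^ n * a n) \<le> B" using k by (simp add: ennreal_power)
qed

text \<open>The perturbed kernel of coupling \<kappa> acting on \<open>f\<close> (see
  \<open>nn_integral_schroedinger_perturbation\<close>), arranged as a power series in
  \<kappa>.\<close>

definition series_op :: "real \<Rightarrow> real \<Rightarrow> real \<Rightarrow> ('a::euclidean_space \<Rightarrow> ennreal) \<Rightarrow> 'a \<Rightarrow> ennreal" where
  "series_op \<alpha> \<kappa> t f x = (\<Sum>n. ennreal \<kappa> ^ n * perturb_op \<alpha> n t f x)"

definition series_int :: "real \<Rightarrow> real \<Rightarrow> real \<Rightarrow> ('a::euclidean_space \<Rightarrow> ennreal) \<Rightarrow> 'a \<Rightarrow> ennreal" where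
  "series_int \<alpha> \<kappa> t f x = (\<Sum>n. ennreal \<kappa> ^ n * perturb_int \<alpha> n t f x)"

lemma nn_integral_schroedinger_perturbation:
  assumes [measurable]: "f \<in> borel_measurable borel"
  shows "(\<integral>\<^sup>+y. schroedinger_perturbation (heat_kernel \<alpha>) (\<lambda>x. ennreal \<kappa> * norm_neg_pow \<alpha> x) t x y * f y \<partial>lborel) =
    series_op \<alpha> \<kappa> t f x"
proof -
  let ?p = "perturb_term (heat_kernel \<alpha>) (norm_neg_pow \<alpha>)"
  have "(\<integral>\<^sup>+y. schroedinger_perturbation (heat_kernel \<alpha>) (\<lambda>x. ennreal \<kappa> * norm_neg_pow \<alpha> x) t x y * f y \<partial>lborel) =
    (\<integral>\<^sup>+y. (\<Sum>n. ennreal \<kappa> ^ n * (?p n t x y * f y)) \<partial>lborel)"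
    unfolding schroedinger_perturbation_def perturb_term_cmult by (simp add: ennreal_suminf_multc[symmetric] mult.assoc)
  also have "\<dots> = (\<Sum>n. \<integral>\<^sup>+y. ennreal \<kappa> ^ n * (?p n t x y * f y) \<partial>lborel)"
    by (rule nn_integral_suminf) measurable
  also have "\<dots> = series_op \<alpha> \<kappa> t f x"
    unfolding series_op_def perturb_op_def by (subst nn_integral_cmult) auto
  finally show ?thesis .
qed

lemma nn_integral_series_op:
  assumes [measurable]: "f \<in> borel_measurable borel"
  shows "(\<integral>\<^sup>+s\<in>{0<..<t}. series_op \<alpha> \<kappa> s f x \<partial>lborel) = series_int \<alpha> \<kappa> t f x"
proof -
  have "(\<integral>\<^sup>+s\<in>{0<..<t}. series_op \<alpha> \<kappa> s f x \<partial>lborel) =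
    (\<integral>\<^sup>+s. (\<Sum>n. ennreal \<kappa> ^ n * (perturb_op \<alpha> n s f x * indicator {0<..<t} s)) \<partial>lborel)"
    unfolding series_op_def by (simp add: ennreal_suminf_multc[symmetric] mult.assoc)
  also have "\<dots> = (\<Sum>n. \<integral>\<^sup>+s. ennreal \<kappa> ^ n * (perturb_op \<alpha> n s f x * indicator {0<..<t} s) \<partial>lborel)"
    by (rule nn_integral_suminf) measurable
  also have "\<dots> = series_int \<alpha> \<kappa> t f x"
    unfolding series_int_def perturb_int_def by (subst nn_integral_cmult) auto
  finally show ?thesis .
qed

lemma perturb_op_combine:
  assumes [measurable]: "f \<in> borel_measurable borel" "g \<in> borel_measurable borel"
    and le: "\<And>y. h y \<le> a * f y + b * g y"
  shows "perturb_op \<alpha> n t h x \<le> a * perturb_op \<alpha> n t f x + b * perturb_op \<alpha> n t g x"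
proof -
  let ?p = "perturb_term (heat_kernel \<alpha>) (norm_neg_pow \<alpha>) n t x"
  have "perturb_op \<alpha> n t h x \<le> (\<integral>\<^sup>+y. ?p y * (a * f y + b * g y) \<partial>lborel)"
    unfolding perturb_op_def by (intro nn_integral_mono mult_left_mono le) auto
  also have "\<dots> = (\<integral>\<^sup>+y. a * (?p y * f y) + b * (?p y * g y) \<partial>lborel)"
    by (intro nn_integral_cong) (simp only: distrib_left mult_ac)
  also have "\<dots> = a * perturb_op \<alpha> n t f x + b * perturb_op \<alpha> n t g x"
    unfolding perturb_op_def by (subst nn_integral_add, measurable, subst nn_integral_cmult, measurable, subst nn_integral_cmult) auto
  finally show ?thesis .
qed

lemma perturb_int_combine:
  assumes [measurable]: "f \<in> borel_measurable borel" "g \<in> borel_measurable borel"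
    and le: "\<And>y. h y \<le> a * f y + b * g y"
  shows "perturb_int \<alpha> n t h x \<le> a * perturb_int \<alpha> n t f x + b * perturb_int \<alpha> n t g x"
proof -
  have "perturb_int \<alpha> n t h x \<le> (\<integral>\<^sup>+s. (a * perturb_op \<alpha> n s f x + b * perturb_op \<alpha> n s g x) * indicator {0<..<t} s \<partial>lborel)"
    unfolding perturb_int_def by (intro nn_integral_mono mult_right_mono perturb_op_combine assms) auto
  also have "\<dots> = (\<integral>\<^sup>+s. a * (perturb_op \<alpha> n s f x * indicator {0<..<t} s) + b * (perturb_op \<alpha> n s g x * indicator {0<..<t} s) \<partial>lborel)"
    by (simp only: distrib_right mult.assoc)
  also have "\<dots> = a * perturb_int \<alpha> n t f x + b * perturb_int \<alpha> n t g x"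
    unfolding perturb_int_def by (subst nn_integral_add, measurable, subst nn_integral_cmult, measurable, subst nn_integral_cmult) auto
  finally show ?thesis .
qed

lemma suminf_combine:
  fixes u v w :: "nat \<Rightarrow> ennreal"
  assumes "\<And>n. u n \<le> a * v n + b * w n"
  shows "(\<Sum>n. k ^ n * u n) \<le> a * (\<Sum>n. k ^ n * v n) + b * (\<Sum>n. k ^ n * w n)"
proof -
  have "(\<Sum>n. k ^ n * u n) \<le> (\<Sum>n. a * (k ^ n * v n) + b * (k ^ n * w n))"
  proof (intro suminf_le summableI)
    fix n
    have "k ^ n * u n \<le> k ^ n * (a * v n + b * w n)" by (intro mult_left_mono assms) auto
    then show "k ^ n * u n \<le> a * (k ^ n * v n) + b * (k ^ n * w n)" by (simp only: distrib_left mult_ac)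
  qed
  also have "\<dots> = a * (\<Sum>n. k ^ n * v n) + b * (\<Sum>n. k ^ n * w n)"
    by (simp add: suminf_add[OF summableI summableI, symmetric] ennreal_suminf_cmult)
  finally show ?thesis .
qed

lemma series_op_combine:
  assumes "f \<in> borel_measurable borel" "g \<in> borel_measurable borel" "\<And>y. h y \<le> a * f y + b * g y"
  shows "series_op \<alpha> \<kappa> t h x \<le> a * series_op \<alpha> \<kappa> t f x + b * series_op \<alpha> \<kappa> t g x"
  unfolding series_op_def by (intro suminf_combine perturb_op_combine assms)

lemma series_int_combine:
  assumes "f \<in> borel_measurable borel" "g \<in> borel_measurable borel" "\<And>y. h y \<le> a * f y + b * g y"
  shows "series_int \<alpha> \<kappa> t h x \<le> a * series_int \<alpha> \<kappa> t f x + b * series_int \<alpha> \<kappa> t g x"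
  unfolding series_int_def by (intro suminf_combine perturb_int_combine assms)

lemma perturb_int_mono_time: "s \<le> t \<Longrightarrow> perturb_int \<alpha> n s f x \<le> perturb_int \<alpha> n t f x"
  unfolding perturb_int_def by (intro nn_integral_mono) (auto split: split_indicator)

section \<open>Monotonicity of the coupling constant\<close>

text \<open>A form of strict concavity: the derivative of Digamma, the trigamma function, is
  strictly decreasing.\<close>

lemma Digamma_increment_strict_antimono:
  fixes a x y :: real
  assumes "0 < a" "0 < x" "x < y"
  shows "Digamma (y + a) - Digamma y < Digamma (x + a) - Digamma x"
proof (rule DERIV_neg_imp_decreasing[OF \<open>x < y\<close>])
  fix z assume z: "x \<le> z" "z \<le> y"
  have nn: "w \<notin> \<int>\<^sub>\<le>\<^sub>0" if "0 < w" for w :: real using that by (auto elim!: nonpos_Ints_cases)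
  have "((\<lambda>z. Digamma (z + a) - Digamma z) has_real_derivative Polygamma 1 (z + a) - Polygamma 1 z) (at z)"
    using z assms by (auto intro!: derivative_eq_intros nn)
  moreover have "Polygamma 1 (z + a) - Polygamma 1 z < 0"
    using z assms Polygamma_real_strict_antimono[of z "z + a" 1] by simp
  ultimately show "\<exists>d. ((\<lambda>z. Digamma (z + a) - Digamma z) has_real_derivative d) (at z) \<and> d < 0"
    by blast
qed

lemma kappa_const_pos:
  assumes "0 < \<alpha>" "0 < \<beta>" "\<beta> < real d - \<alpha>"
  shows "0 < kappa_const d \<alpha> \<beta>"
  unfolding kappa_const_def using assms by (auto intro!: divide_pos_pos mult_pos_pos Gamma_real_pos)

lemma kappa_const_symmetric:
  assumes "0 < \<beta>" "\<beta> < real d - \<alpha>"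
  shows "kappa_const d \<alpha> (real d - \<alpha> - \<beta>) = kappa_const d \<alpha> \<beta>"
proof -
  have "real d - \<alpha> - \<beta> + \<alpha> = real d - \<beta>" "real d - (real d - \<alpha> - \<beta>) = \<beta> + \<alpha>"
    "real d - (real d - \<alpha> - \<beta>) - \<alpha> = \<beta>" "real d - \<alpha> - \<beta> = real d - \<beta> - \<alpha>" by simp_all
  then show ?thesis using assms unfolding kappa_const_def by (simp only:) (simp add: mult_ac)
qed

text \<open>The derivative of ln \<kappa>_b is half the difference of the Digamma increments of
  length \<alpha>/2 at b/2 and at (d-b-\<alpha>)/2. It is positive exactly because b/2 is the
  smaller argument, that is, b lies below (d-\<alpha>)/2.\<close>

lemma kappa_const_strict_mono:
  assumes \<alpha>: "0 < \<alpha>" and \<beta>: "0 < \<beta>" "\<beta> < \<gamma>" "\<gamma> \<le> (real d - \<alpha>) / 2"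
  shows "kappa_const d \<alpha> \<beta> < kappa_const d \<alpha> \<gamma>"
proof -
  define g where "g b = \<alpha> * ln 2 + ln_Gamma ((b + \<alpha>) / 2) + ln_Gamma ((real d - b) / 2)
      - ln_Gamma (b / 2) - ln_Gamma ((real d - b - \<alpha>) / 2)" for b
  have exp_g: "kappa_const d \<alpha> b = exp (g b)" if "0 < b" "b < real d - \<alpha>" for b
    using that \<alpha> by (simp add: kappa_const_def g_def exp_add exp_diff Gamma_real_pos_exp powr_def)
  have deriv: "(g has_real_derivative (Digamma ((b + \<alpha>) / 2) - Digamma ((real d - b) / 2)
      - Digamma (b / 2) + Digamma ((real d - b - \<alpha>) / 2)) / 2) (at b)" if "0 < b" "b < real d - \<alpha>" for b
    unfolding g_def using that \<alpha> by (auto intro!: derivative_eq_intros simp: field_simps)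
  have "g \<beta> < g \<gamma>"
  proof (rule DERIV_pos_imp_increasing_open[OF \<beta>(2)])
    fix b assume b: "\<beta> < b" "b < \<gamma>"
    then have "0 < b" "b < real d - \<alpha>" "b / 2 < (real d - b - \<alpha>) / 2" using \<beta> \<alpha> by (simp_all add: field_simps)
    moreover from Digamma_increment_strict_antimono[of "\<alpha> / 2" "b / 2" "(real d - b - \<alpha>) / 2"] this \<alpha>
    have "Digamma ((real d - b) / 2) - Digamma ((real d - b - \<alpha>) / 2) < Digamma ((b + \<alpha>) / 2) - Digamma (b / 2)"
      by (simp add: add_divide_distrib[symmetric])
    ultimately show "\<exists>y. (g has_real_derivative y) (at b) \<and> 0 < y"
      using deriv[of b] by (intro exI conjI) (assumption, simp)
  next
    show "continuous_on {\<beta>..\<gamma>} g"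
      using \<beta> \<alpha> by (intro continuous_at_imp_continuous_on ballI DERIV_isCont[OF deriv]) (auto simp: field_simps)
  qed
  then show ?thesis using \<beta> \<alpha> exp_g[of \<beta>] exp_g[of \<gamma>] by (simp add: field_simps)
qed

text \<open>The coupling rises up to (d-\<alpha>)/2 and is symmetric about it, so \<delta> and
  d-\<alpha>-\<delta> are the two ends of the range in which it exceeds \<kappa>_\<delta>. Exponents
  beyond the midpoint are reflected.\<close>

lemma kappa_const_less_between:
  assumes \<alpha>: "0 < \<alpha>" and \<delta>: "0 \<le> \<delta>" and \<beta>: "\<delta> < \<beta>" "\<beta> < real d - \<alpha> - \<delta>"
  shows "kappa_const d \<alpha> \<delta> < kappa_const d \<alpha> \<beta>"
proof (cases "\<delta> = 0")
  case True
  with assms kappa_const_pos[of \<alpha> \<beta> d] show ?thesis by (simp add: kappa_const_def)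
next
  case False
  show ?thesis
  proof (cases "\<beta> \<le> (real d - \<alpha>) / 2")
    case True
    with False assms show ?thesis by (intro kappa_const_strict_mono) auto
  next
    case nle: False
    have "kappa_const d \<alpha> \<delta> < kappa_const d \<alpha> (real d - \<alpha> - \<beta>)"
      using nle False assms by (intro kappa_const_strict_mono) (auto simp: field_simps)
    also have "\<dots> = kappa_const d \<alpha> \<beta>" using False assms by (intro kappa_const_symmetric) auto
    finally show ?thesis .
  qed
qed

section \<open>Finiteness below and at the critical coupling\<close>

context
  fixes \<alpha> :: real
  assumes \<alpha>: "0 < \<alpha>" "\<alpha> < 2" "\<alpha> < DIM('a::euclidean_space)"
begin

lemma norm_neg_pow_shift_interpolate:
  fixes y :: "'a"
  assumes "0 \<le> \<beta>" "\<beta> \<le> b" "0 < R"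
  shows "norm_neg_pow (\<beta> + \<alpha>) y \<le> ennreal (R powr (-(\<beta> + \<alpha>))) * 1 + ennreal (R powr (b - \<beta>)) * norm_neg_pow (b + \<alpha>) y"
  using norm_neg_pow_interpolate[of "\<beta> + \<alpha>" "b + \<alpha>" R y] assms \<alpha> by simp

text \<open>For n > 0 the left side is an integral over (0,s) by \<open>perturb_op_one_Suc\<close>;
  for n = 0 the mass is constantly 1. Hence a time integral of the mass is at most t times its final
  value.\<close>

lemma perturb_op_one_mono_time:
  fixes x :: "'a"
  assumes "0 < s" "s \<le> t"
  shows "perturb_op \<alpha> n s (\<lambda>_. 1) (x) \<le> perturb_op \<alpha> n t (\<lambda>_. 1) x"
proof (cases n)
  case 0
  with assms \<alpha> show ?thesis by (simp add: perturb_op_one_0)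
next
  case (Suc m)
  with assms \<alpha> show ?thesis by (simp add: perturb_op_one_Suc perturb_int_mono_time)
qed

lemma perturb_int_one_le:
  fixes x :: "'a"
  assumes t: "0 < t"
  shows "perturb_int \<alpha> n t (\<lambda>_. 1) (x) \<le> ennreal t * perturb_op \<alpha> n t (\<lambda>_. 1) x"
proof -
  have "perturb_int \<alpha> n t (\<lambda>_. 1) x \<le> (\<integral>\<^sup>+s. perturb_op \<alpha> n t (\<lambda>_. 1) x * indicator {0<..<t} s \<partial>lborel)"
    unfolding perturb_int_def by (intro nn_integral_mono) (auto split: split_indicator intro: perturb_op_one_mono_time)
  also have "\<dots> = ennreal t * perturb_op \<alpha> n t (\<lambda>_. 1) x"
    using t by (subst nn_integral_cmult_indicator) (auto simp: mult.commute)
  finally show ?thesis .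
qed

lemma series_int_one_le:
  fixes x :: "'a"
  assumes t: "0 < t"
  shows "series_int \<alpha> \<kappa> t (\<lambda>_. 1) (x) \<le> ennreal t * series_op \<alpha> \<kappa> t (\<lambda>_. 1) x"
  using suminf_combine[of "\<lambda>n. perturb_int \<alpha> n t (\<lambda>_. 1) x" "ennreal t" "\<lambda>n. perturb_op \<alpha> n t (\<lambda>_. 1) x" 0 "\<lambda>_. 0" "ennreal \<kappa>"]
    perturb_int_one_le[OF t] by (simp add: series_int_def series_op_def)

text \<open>The identities of order n+1 reproduce A_n, and the index shift yields the factor
  \<kappa>. Both multiples of the integral term remain as summands because that term may be
  infinite.\<close>

lemma series_identity:
  fixes x :: "'a"
  assumes \<beta>: "0 \<le> \<beta>" "\<beta> < DIM('a) - \<alpha>" and t: "0 < t" and x: "x \<noteq> 0"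
  shows "series_op \<alpha> \<kappa> t (norm_neg_pow \<beta>) x + ennreal (kappa_const DIM('a) \<alpha> \<beta>) * series_int \<alpha> \<kappa> t (norm_neg_pow (\<beta> + \<alpha>)) x =
    norm_neg_pow \<beta> x + ennreal \<kappa> * series_int \<alpha> \<kappa> t (norm_neg_pow (\<beta> + \<alpha>)) x"
proof -
  let ?J = "series_int \<alpha> \<kappa> t (norm_neg_pow (\<beta> + \<alpha>)) x"
  let ?P = "\<lambda>n. perturb_op \<alpha> n t (norm_neg_pow \<beta>) x" and ?I = "\<lambda>n. perturb_int \<alpha> n t (norm_neg_pow (\<beta> + \<alpha>)) x"
  have "series_op \<alpha> \<kappa> t (norm_neg_pow \<beta>) x + ennreal (kappa_const DIM('a) \<alpha> \<beta>) * ?J =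
    (\<Sum>n. ennreal \<kappa> ^ n * (?P n + ennreal (kappa_const DIM('a) \<alpha> \<beta>) * ?I n))"
    unfolding series_op_def series_int_def ennreal_suminf_cmult[symmetric] suminf_add[OF summableI summableI]
    by (rule arg_cong[where f=suminf], rule ext) (simp only: distrib_left mult_ac)
  also have "\<dots> = (?P 0 + ennreal (kappa_const DIM('a) \<alpha> \<beta>) * ?I 0) + (\<Sum>n. ennreal \<kappa> ^ Suc n * (?P (Suc n) + ennreal (kappa_const DIM('a) \<alpha> \<beta>) * ?I (Suc n)))"
    by (subst suminf_ennreal_Suc) simp
  also have "\<dots> = norm_neg_pow \<beta> x + (\<Sum>n. ennreal \<kappa> ^ Suc n * ?I n)"
    by (simp only: perturb_op_identity_0[OF \<alpha>(1,2) \<beta> t x] perturb_op_identity_Suc[OF \<alpha>(1,2) \<beta>])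
  also have "(\<Sum>n. ennreal \<kappa> ^ Suc n * ?I n) = ennreal \<kappa> * ?J"
    unfolding series_int_def ennreal_suminf_cmult[symmetric] by (simp only: power_Suc mult.assoc)
  finally show ?thesis .
qed

lemma series_op_one:
  fixes x :: "'a"
  assumes t: "0 < t" and x: "x \<noteq> 0"
  shows "series_op \<alpha> \<kappa> t (\<lambda>_. 1) (x) = 1 + ennreal \<kappa> * series_int \<alpha> \<kappa> t (norm_neg_pow \<alpha>) x"
proof -
  have "norm_neg_pow 0 = (\<lambda>_::'a. 1)" by (rule ext) simp
  with series_identity[of 0 t x \<kappa>] assms \<alpha> show ?thesis by (simp add: kappa_const_def)
qed

text \<open>Dropping the nonnegative B_n from the identities leaves \<kappa>_\<beta> A_0 \<le>
  |x|^(-\<beta>) and \<kappa>_\<beta> A_(n+1) \<le> A_n, so the ratio of the majorant is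
  \<kappa>/\<kappa>_\<beta> < 1.\<close>

lemma series_int_finite_subcritical:
  fixes x :: "'a"
  assumes \<beta>: "0 \<le> \<beta>" "\<beta> < DIM('a) - \<alpha>" and t: "0 < t" and x: "x \<noteq> 0" and \<kappa>: "0 \<le> \<kappa>" "\<kappa> < kappa_const DIM('a) \<alpha> \<beta>"
  shows "series_int \<alpha> \<kappa> t (norm_neg_pow (\<beta> + \<alpha>)) x < \<infinity>"
proof -
  let ?I = "\<lambda>n. perturb_int \<alpha> n t (norm_neg_pow (\<beta> + \<alpha>)) x" and ?k = "kappa_const DIM('a) \<alpha> \<beta>"
  have k: "0 < ?k" using \<kappa> by simp
  let ?r = "norm x powr (-\<beta>)"
  have div: "b \<le> ennreal (c / ?k)" if "ennreal ?k * b \<le> ennreal c" "0 \<le> c" for b c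
  proof -
    have "b = ennreal (1 / ?k) * (ennreal ?k * b)" using k by (simp add: mult.assoc[symmetric] ennreal_mult[symmetric])
    also have "\<dots> \<le> ennreal (1 / ?k) * ennreal c" by (intro mult_left_mono that) auto
    also have "\<dots> = ennreal (c / ?k)" using k that by (simp add: ennreal_mult'[symmetric])
    finally show ?thesis .
  qed
  have bound: "?I n \<le> ennreal (?r / ?k ^ Suc n)" for n
  proof (induction n)
    case 0
    have "ennreal ?k * ?I 0 \<le> ennreal ?r"
      using perturb_op_identity_0[OF \<alpha>(1,2) \<beta> t x] x
      by (simp add: norm_neg_pow_nonzero add_increasing) (metis add_increasing order_refl zero_le)
    from div[OF this] show ?case by simp
  next
    case (Suc n)
    have "ennreal ?k * ?I (Suc n) \<le> ?I n"
      unfolding perturb_op_identity_Suc[OF \<alpha>(1,2) \<beta>, of n t x, symmetric] by (simp add: add_increasing)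
    from order_trans[OF this Suc] have "ennreal ?k * ?I (Suc n) \<le> ennreal (?r / ?k ^ Suc n)" .
    from div[OF this] k show ?case by (simp add: mult.commute)
  qed
  have "series_int \<alpha> \<kappa> t (norm_neg_pow (\<beta> + \<alpha>)) x \<le> (\<Sum>n. ennreal (?r / ?k * (\<kappa> / ?k) ^ n))"
    unfolding series_int_def
  proof (intro suminf_le summableI)
    fix n
    have "ennreal \<kappa> ^ n * ?I n \<le> ennreal (\<kappa> ^ n) * ennreal (?r / ?k ^ Suc n)"
      using \<kappa> bound[of n] by (simp add: ennreal_power mult_left_mono)
    also have "\<dots> = ennreal (?r / ?k * (\<kappa> / ?k) ^ n)"
      using \<kappa> by (simp add: ennreal_mult'[symmetric] power_divide mult_ac)
    finally show "ennreal \<kappa> ^ n * ?I n \<le> ennreal (?r / ?k * (\<kappa> / ?k) ^ n)" .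
  qed
  also have "\<dots> < \<infinity>"
    using \<kappa> k by (subst suminf_ennreal2) (auto intro!: summable_mult summable_geometric)
  finally show ?thesis .
qed

text \<open>By \<open>perturb_op_one_Suc\<close> the term u_(n+1) is A_n for the weight
  |y|^(-\<alpha>) \<le> R^(-\<alpha>) + R^\<beta> |y|^(-\<beta>-\<alpha>). The constant part returns
  at most R^(-\<alpha>) t u_n, the rest is summable. Absorption is carried out on partial sums,
  U_(N+1) \<le> C + U_N/2, since the full sum cannot be subtracted before it is known to be
  finite.\<close>

lemma series_op_one_finite_subcritical:
  fixes x :: "'a"
  assumes \<beta>: "0 \<le> \<beta>" "\<beta> < DIM('a) - \<alpha>" and t: "0 < t" and x: "x \<noteq> 0" and \<kappa>: "0 \<le> \<kappa>" "\<kappa> < kappa_const DIM('a) \<alpha> \<beta>"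
  shows "series_op \<alpha> \<kappa> t (\<lambda>_. 1) (x) < \<infinity>"
proof -
  let ?u = "\<lambda>n. perturb_op \<alpha> n t (\<lambda>_. 1) x" and ?A = "\<lambda>n. perturb_int \<alpha> n t (norm_neg_pow (\<beta> + \<alpha>)) x"
  let ?V = "\<lambda>N. (\<Sum>n<N. ennreal \<kappa> ^ n * ?A n)"
  let ?U = "\<lambda>N. (\<Sum>n<N. ennreal \<kappa> ^ n * ?u n)"
  let ?J = "series_int \<alpha> \<kappa> t (norm_neg_pow (\<beta> + \<alpha>)) x"
  \<comment> \<open>Chosen so that \<kappa> R^(-\<alpha>) t = \<kappa> t/(2\<kappa> t + 1) \<le>
    1/2; the summand 1 keeps R positive when \<kappa> = 0.\<close>
  define R where "R = (2 * \<kappa> * t + 1) powr (1 / \<alpha>)"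
  have pos: "0 < 2 * \<kappa> * t + 1" using \<kappa> t by (simp add: add_nonneg_pos)
  then have R: "0 < R" unfolding R_def by (simp only: powr_gt_zero less_imp_neq[symmetric] not_False_eq_True)
  from pos have "R powr (-\<alpha>) = 1 / (2 * \<kappa> * t + 1)"
    using \<alpha> by (simp add: R_def powr_powr powr_minus divide_inverse)
  then have "R powr (-\<alpha>) * (2 * \<kappa> * t + 1) = 1" using pos by simp
  then have "\<kappa> * (R powr (-\<alpha>) * t) = (1 - R powr (-\<alpha>)) / 2" by (simp add: algebra_simps)
  then have half: "\<kappa> * (R powr (-\<alpha>) * t) \<le> 1 / 2" by simp
  define C where "C = 1 + ennreal \<kappa> * (ennreal (R powr \<beta>) * ?J)"
  have C: "C < \<infinity>" using series_int_finite_subcritical[OF assms] by (simp add: C_def ennreal_mult_less_top)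
  have step: "?u (Suc n) \<le> ennreal (R powr (-\<alpha>) * t) * ?u n + ennreal (R powr \<beta>) * ?A n" for n
  proof -
    have "?u (Suc n) = perturb_int \<alpha> n t (norm_neg_pow \<alpha>) x"
      by (rule perturb_op_one_Suc[OF \<alpha>])
    also have "\<dots> \<le> ennreal (R powr (-\<alpha>)) * perturb_int \<alpha> n t (\<lambda>_. 1) x + ennreal (R powr \<beta>) * ?A n"
      using norm_neg_pow_shift_interpolate[of 0 \<beta> R] \<beta> R by (intro perturb_int_combine) auto
    also have "\<dots> \<le> ennreal (R powr (-\<alpha>)) * (ennreal t * ?u n) + ennreal (R powr \<beta>) * ?A n"
      by (intro add_mono mult_left_mono perturb_int_one_le t) auto
    finally show ?thesis using t by (simp add: ennreal_mult mult.assoc)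
  qed
  have partial: "?U N \<le> 2 * C" for N
  proof (induction N)
    case (Suc N)
    have "(\<Sum>n<Suc N. ennreal \<kappa> ^ n * ?u n) = 1 + (\<Sum>n<N. ennreal \<kappa> ^ Suc n * ?u (Suc n))"
      by (subst sum.lessThan_Suc_shift) (simp add: perturb_op_one_0[OF \<alpha>(1,2) t])
    also have "\<dots> \<le> 1 + (\<Sum>n<N. ennreal \<kappa> * ennreal (R powr (-\<alpha>) * t) * (ennreal \<kappa> ^ n * ?u n) + ennreal \<kappa> * ennreal (R powr \<beta>) * (ennreal \<kappa> ^ n * ?A n))"
    proof (intro add_left_mono sum_mono)
      fix n
      have "ennreal \<kappa> ^ Suc n * ?u (Suc n) \<le> ennreal \<kappa> ^ Suc n * (ennreal (R powr (-\<alpha>) * t) * ?u n + ennreal (R powr \<beta>) * ?A n)"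
        by (intro mult_left_mono step) auto
      then show "ennreal \<kappa> ^ Suc n * ?u (Suc n) \<le> ennreal \<kappa> * ennreal (R powr (-\<alpha>) * t) * (ennreal \<kappa> ^ n * ?u n) + ennreal \<kappa> * ennreal (R powr \<beta>) * (ennreal \<kappa> ^ n * ?A n)"
        by (simp only: power_Suc distrib_left mult_ac)
    qed
    also have "\<dots> = 1 + (ennreal \<kappa> * ennreal (R powr (-\<alpha>) * t) * ?U N + ennreal \<kappa> * ennreal (R powr \<beta>) * ?V N)"
      by (simp only: sum.distrib sum_distrib_left)
    also have "\<dots> \<le> 1 + (ennreal (1/2) * (2 * C) + ennreal \<kappa> * ennreal (R powr \<beta>) * ?J)"
    proof (intro add_left_mono add_mono mult_mono)
      show "ennreal \<kappa> * ennreal (R powr (-\<alpha>) * t) \<le> ennreal (1/2)"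
        using ennreal_leI[OF half] unfolding ennreal_mult'[OF \<kappa>(1)] .
      show "?V N \<le> ?J"
        unfolding series_int_def by (intro sum_le_suminf summableI) auto
    qed (use Suc.IH in auto)
    also have "\<dots> = C + C"
    proof -
      have "ennreal (1/2) * (2 * C) = C"
      proof -
        have "ennreal (1/2) * 2 = ennreal (1/2) * ennreal 2" by simp
        also have "\<dots> = ennreal (1/2 * 2)" by (rule ennreal_mult'[symmetric]) simp
        finally have "ennreal (1/2) * 2 = 1" by simp
        then show ?thesis by (simp add: mult.assoc[symmetric])
      qed
      then show ?thesis by (simp add: C_def mult.assoc add_ac)
    qed
    finally show ?case by (simp add: mult_2)
  qed simp
  have "series_op \<alpha> \<kappa> t (\<lambda>_. 1) x \<le> 2 * C"
    unfolding series_op_def by (intro suminf_le_const summableI partial)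
  also have "\<dots> < \<infinity>" using C by (simp add: ennreal_mult_less_top)
  finally show ?thesis .
qed

text \<open>It suffices that \<kappa> is subcritical for some larger exponent \<open>b\<close>: with
  R = 1 the weight is at most 1 + |y|^(-b-\<alpha>), and the constant is controlled by the finite
  mass. In this way \<kappa> may exceed \<kappa>_\<beta>.\<close>

lemma series_int_finite_interpolate:
  fixes x :: "'a"
  assumes \<beta>: "0 \<le> \<beta>" "\<beta> \<le> b" "b < DIM('a) - \<alpha>" and t: "0 < t" and x: "x \<noteq> 0" and \<kappa>: "0 \<le> \<kappa>" "\<kappa> < kappa_const DIM('a) \<alpha> b"
  shows "series_int \<alpha> \<kappa> t (norm_neg_pow (\<beta> + \<alpha>)) x < \<infinity>"
proof -
  let ?J = "series_int \<alpha> \<kappa> t (norm_neg_pow (b + \<alpha>)) x"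
  have b: "0 \<le> b" using \<beta> by simp
  have "series_int \<alpha> \<kappa> t (norm_neg_pow (\<beta> + \<alpha>)) x \<le> 1 * series_int \<alpha> \<kappa> t (\<lambda>_. 1) x + 1 * ?J"
    using norm_neg_pow_shift_interpolate[of \<beta> b 1] \<beta> by (intro series_int_combine) auto
  also have "\<dots> \<le> ennreal t * series_op \<alpha> \<kappa> t (\<lambda>_. 1) x + ?J"
    using series_int_one_le[OF t] by (simp add: add_right_mono)
  also have "\<dots> < \<infinity>"
    using series_op_one_finite_subcritical[OF b \<beta>(3) t x \<kappa>] series_int_finite_subcritical[OF b \<beta>(3) t x \<kappa>]
    by (simp add: ennreal_mult_less_top)
  finally show ?thesis .
qed

text \<open>Once the integral term is finite, \<open>series_identity\<close> forces the other term
  to be finite too, and the subtraction can be done in the reals.\<close>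

lemma series_identity_real:
  fixes x :: "'a"
  assumes \<beta>: "0 \<le> \<beta>" "\<beta> < DIM('a) - \<alpha>" and t: "0 < t" and x: "x \<noteq> 0" and \<kappa>: "0 \<le> \<kappa>"
    and fin: "series_int \<alpha> \<kappa> t (norm_neg_pow (\<beta> + \<alpha>)) x < \<infinity>"
  obtains T J where "0 \<le> T" "0 \<le> J" "series_op \<alpha> \<kappa> t (norm_neg_pow \<beta>) x = ennreal T"
    "series_int \<alpha> \<kappa> t (norm_neg_pow (\<beta> + \<alpha>)) x = ennreal J" "T = norm x powr (-\<beta>) + (\<kappa> - kappa_const DIM('a) \<alpha> \<beta>) * J"
proof -
  let ?T = "series_op \<alpha> \<kappa> t (norm_neg_pow \<beta>) x"
  let ?J = "series_int \<alpha> \<kappa> t (norm_neg_pow (\<beta> + \<alpha>)) x"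
  have k0: "0 \<le> kappa_const DIM('a) \<alpha> \<beta>"
    using \<alpha> \<beta> by (auto simp: kappa_const_def intro!: divide_nonneg_nonneg mult_nonneg_nonneg Gamma_real_nonneg)
  obtain J where J: "0 \<le> J" "?J = ennreal J"
    using fin by (cases "?J") auto
  have eq: "?T + ennreal (kappa_const DIM('a) \<alpha> \<beta> * J) = ennreal (norm x powr (-\<beta>) + \<kappa> * J)"
    using series_identity[OF \<beta> t x, of \<kappa>] x \<kappa> k0 J by (simp add: norm_neg_pow_nonzero ennreal_mult)
  obtain T where T: "0 \<le> T" "?T = ennreal T"
    using eq by (cases "?T") auto
  have "T + kappa_const DIM('a) \<alpha> \<beta> * J = norm x powr (-\<beta>) + \<kappa> * J"
    using eq unfolding T(2) using T(1) J(1) k0 \<kappa> by (simp add: ennreal_plus[symmetric] del: ennreal_plus)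
  then have "T = norm x powr (-\<beta>) + (\<kappa> - kappa_const DIM('a) \<alpha> \<beta>) * J" by (simp add: algebra_simps)
  with that T J show ?thesis by blast
qed

end

section \<open>The critical coupling\<close>

context
  fixes \<alpha> :: real
  assumes \<alpha>: "0 < \<alpha>" "\<alpha> < 2" "\<alpha> < DIM('a::euclidean_space)"
begin

lemma series_op_le_subcritical:
  fixes x :: "'a"
  assumes \<delta>: "0 \<le> \<delta>" "\<delta> < DIM('a) - \<alpha>" and t: "0 < t" and x: "x \<noteq> 0"
    and \<kappa>: "0 \<le> \<kappa>" "\<kappa> < kappa_const DIM('a) \<alpha> \<delta>"
  shows "series_op \<alpha> \<kappa> t (norm_neg_pow \<delta>) x \<le> ennreal (norm x powr (-\<delta>))"
proof -
  obtain T J where T: "0 \<le> J" "series_op \<alpha> \<kappa> t (norm_neg_pow \<delta>) x = ennreal T"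
    "T = norm x powr (-\<delta>) + (\<kappa> - kappa_const DIM('a) \<alpha> \<delta>) * J"
    by (rule series_identity_real[OF \<alpha> \<delta> t x \<kappa>(1) series_int_finite_subcritical[OF \<alpha> \<delta> t x \<kappa>]])
  have "(\<kappa> - kappa_const DIM('a) \<alpha> \<delta>) * J \<le> 0" using \<kappa> T by (simp add: mult_nonpos_nonneg)
  then show ?thesis unfolding T(2) T(3) by (intro ennreal_leI) simp
qed

text \<open>For $\kappa = \kappa_\delta$ the identity alone does not exclude that both sides are infinite. The bounds
  below are uniform over couplings $l < \kappa_\delta$, where all quantities are finite, and survive $l \to \kappa_\delta$
  because the partial sums are continuous in $l$.\<close>

lemma series_critical:
  fixes x :: "'a"
  assumes \<delta>: "\<delta> < DIM('a) - \<alpha>" and \<beta>: "0 < \<beta>" "\<beta> < \<delta>"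
    and less: "kappa_const DIM('a) \<alpha> \<beta> < kappa_const DIM('a) \<alpha> \<delta>" and t: "0 < t" and x: "x \<noteq> 0"
  shows "series_op \<alpha> (kappa_const DIM('a) \<alpha> \<delta>) t (\<lambda>_. 1) x < \<infinity>" (is ?P1)
    and "series_int \<alpha> (kappa_const DIM('a) \<alpha> \<delta>) t (norm_neg_pow (\<beta> + \<alpha>)) x < \<infinity>" (is ?P2)
    and "series_op \<alpha> (kappa_const DIM('a) \<alpha> \<delta>) t (norm_neg_pow \<delta>) x \<le> ennreal (norm x powr (-\<delta>))" (is ?P3)
proof -
  let ?Jb = "\<lambda>l. series_int \<alpha> l t (norm_neg_pow (\<beta> + \<alpha>)) x"
  let ?u = "\<lambda>l. series_op \<alpha> l t (\<lambda>_. 1) x"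
  let ?kb = "kappa_const DIM('a) \<alpha> \<beta>" and ?kd = "kappa_const DIM('a) \<alpha> \<delta>"
  \<comment> \<open>Restricting l to [?k0, ?kd) keeps l - \<kappa>_\<beta> away from 0 uniformly in
    l.\<close>
  let ?k0 = "(?kb + ?kd) / 2" and ?hr = "norm x powr (-\<delta>)"
  have d: "\<beta> \<le> \<delta>" "0 \<le> \<delta>" "0 \<le> \<beta>" "\<beta> < DIM('a) - \<alpha>" "0 < DIM('a) - \<alpha>" "\<delta> < DIM('a) - \<alpha>" using \<delta> \<beta> by auto
  have kb: "0 < ?kb" using \<alpha> d \<beta> by (intro kappa_const_pos) auto
  have k: "0 \<le> ?k0" "?k0 < ?kd" "?kb < ?k0" using kb less by (auto simp: field_simps)
  \<comment> \<open>Two estimates are to be closed, with u the mass and Jb the integral term at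
    exponent \<beta>: u \<le> 1 + \<kappa>_\<delta> (R^(-\<alpha>) t u + R^\<beta> Jb) and (?k0 -
    \<kappa>_\<beta>) Jb \<le> S^(-\<beta>) u + D. This R makes the coefficient of u in the first
    one at most 1/4.\<close>
  define R where "R = (4 * ?kd * t + 1) powr (1 / \<alpha>)"
  have p0: "0 < ?kd * t" using kb less t by simp
  then have R: "0 < R" by (simp add: R_def)
  have "R powr (-\<alpha>) = 1 / (4 * ?kd * t + 1)"
    using \<alpha> p0 by (simp add: R_def powr_powr powr_minus divide_inverse)
  then have "R powr (-\<alpha>) * (4 * (?kd * t) + 1) = 1" using p0 by (simp add: mult.assoc)
  then have "?kd * (R powr (-\<alpha>) * t) = (1 - R powr (-\<alpha>)) / 4" by (simp add: algebra_simps)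
  then have R1: "?kd * (R powr (-\<alpha>) * t) \<le> 1 / 4" by simp
  define M where "M = ?kd * R powr \<beta> / (?k0 - ?kb)"
  have M: "0 < M" using R k kb less by (simp add: M_def)
  \<comment> \<open>M is the factor that the second estimate receives when it is inserted into the
    first, and S makes the resulting coefficient M S^(-\<beta>) of u equal to 1/4.\<close>
  define S where "S = (4 * M) powr (1 / \<beta>)"
  have S: "0 < S" using M by (simp add: S_def)
  have S1: "M * S powr (-\<beta>) = 1 / 4"
    using M \<beta> by (simp add: S_def powr_powr powr_minus field_simps)
  define D where "D = S powr (\<delta> - \<beta>) * ?hr"
  have D: "0 \<le> D" by (simp add: D_def)
  \<comment> \<open>The combined estimate is u \<le> 1 + u/2 + M D, that is u \<le> B, a bound
    independent of l.\<close>
  define B where "B = 2 + 2 * (M * D)"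
  define B2 where "B2 = (S powr (-\<beta>) * B + D) / (?k0 - ?kb)"
  have main: "?u l \<le> ennreal B" "?Jb l \<le> ennreal B2"
    "series_op \<alpha> l t (norm_neg_pow \<delta>) x \<le> ennreal ?hr" if l: "?k0 \<le> l" "l < ?kd" for l
  proof -
    have l0: "0 \<le> l" using l k by simp
    show Td: "series_op \<alpha> l t (norm_neg_pow \<delta>) x \<le> ennreal ?hr"
      using \<delta> \<beta> by (intro series_op_le_subcritical t x l0 l) auto
    \<comment> \<open>Below \<kappa>_\<delta> the mass is a real number, which makes the later
      absorption of u/2 legitimate.\<close>
    obtain u where u: "0 \<le> u" "?u l = ennreal u"
      using series_op_one_finite_subcritical[OF \<alpha> d(2,6) t x l0 l(2)]
      by (cases "?u l") auto
    have finb: "?Jb l < \<infinity>"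
      by (rule series_int_finite_interpolate[OF \<alpha> d(3,1,6) t x l0 l(2)])
    have fina: "series_int \<alpha> l t (norm_neg_pow (0 + \<alpha>)) x < \<infinity>"
      by (rule series_int_finite_interpolate[OF \<alpha> order_refl d(2,6) t x l0 l(2)])
    obtain Tb Jb where T: "0 \<le> Tb" "0 \<le> Jb" "series_op \<alpha> l t (norm_neg_pow \<beta>) x = ennreal Tb"
      "?Jb l = ennreal Jb" "Tb = norm x powr (-\<beta>) + (l - ?kb) * Jb"
      by (rule series_identity_real[OF \<alpha> d(3,4) t x l0 finb])
    obtain Ja where Ja: "0 \<le> Ja" "series_int \<alpha> l t (norm_neg_pow \<alpha>) x = ennreal Ja"
      using fina by (cases "series_int \<alpha> l t (norm_neg_pow \<alpha>) x") auto
    have "ennreal u = ennreal (1 + l * Ja)"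
      using series_op_one[OF \<alpha> t x, of l] l0 Ja u by (simp add: ennreal_mult)
    then have e1: "u = 1 + l * Ja" using u(1) l0 Ja(1) by (subst (asm) ennreal_inj) auto
    have "ennreal Ja \<le> ennreal (R powr (-\<alpha>)) * series_int \<alpha> l t (\<lambda>_. 1) x + ennreal (R powr \<beta>) * ennreal Jb"
      unfolding Ja(2)[symmetric] T(4)[symmetric]
      using norm_neg_pow_shift_interpolate[OF \<alpha>, of 0 \<beta> R] \<beta> R by (intro series_int_combine) auto
    also have "\<dots> \<le> ennreal (R powr (-\<alpha>)) * (ennreal t * ennreal u) + ennreal (R powr \<beta>) * ennreal Jb"
      unfolding u(2)[symmetric] by (intro add_mono mult_left_mono series_int_one_le \<alpha> t) auto
    also have "\<dots> = ennreal (R powr (-\<alpha>) * (t * u) + R powr \<beta> * Jb)"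
      using t u T by (simp add: ennreal_mult)
    finally have e2: "Ja \<le> R powr (-\<alpha>) * (t * u) + R powr \<beta> * Jb"
      using t u T by (subst (asm) ennreal_le_iff) auto
    have "ennreal Tb \<le> ennreal (S powr (-\<beta>)) * ?u l + ennreal (S powr (\<delta> - \<beta>)) * series_op \<alpha> l t (norm_neg_pow \<delta>) x"
      unfolding T(3)[symmetric]
      using norm_neg_pow_interpolate[of \<beta> \<delta> S] \<beta> S by (intro series_op_combine) auto
    also have "\<dots> \<le> ennreal (S powr (-\<beta>)) * ennreal u + ennreal (S powr (\<delta> - \<beta>)) * ennreal ?hr"
      unfolding u(2)[symmetric] by (intro add_mono mult_left_mono Td) auto
    also have "\<dots> = ennreal (S powr (-\<beta>) * u + D)"
      using u by (simp add: ennreal_mult D_def)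
    finally have e3: "Tb \<le> S powr (-\<beta>) * u + D"
      using u D by (subst (asm) ennreal_le_iff) auto
    have "(?k0 - ?kb) * Jb \<le> (l - ?kb) * Jb" using l T by (intro mult_right_mono) auto
    also have "\<dots> \<le> Tb" using T(5) by simp
    finally have "(?k0 - ?kb) * Jb \<le> Tb" .
    then have "Jb \<le> Tb / (?k0 - ?kb)"
      using k by (subst pos_le_divide_eq) (simp_all add: mult.commute)
    also have "\<dots> \<le> (S powr (-\<beta>) * u + D) / (?k0 - ?kb)"
      using e3 k by (intro divide_right_mono) auto
    finally have e4: "Jb \<le> (S powr (-\<beta>) * u + D) / (?k0 - ?kb)" .
    have kR: "0 \<le> ?kd * R powr \<beta>" using kb less by simp
    have "u \<le> 1 + ?kd * Ja" unfolding e1 using l Ja by (intro add_left_mono mult_right_mono) auto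
    also have "\<dots> \<le> 1 + ?kd * (R powr (-\<alpha>) * (t * u) + R powr \<beta> * Jb)"
      using kb less by (intro add_left_mono mult_left_mono e2) auto
    also have "\<dots> = 1 + ?kd * (R powr (-\<alpha>) * t) * u + ?kd * R powr \<beta> * Jb"
      by (simp add: algebra_simps)
    also have "\<dots> \<le> 1 + 1 / 4 * u + ?kd * R powr \<beta> * ((S powr (-\<beta>) * u + D) / (?k0 - ?kb))"
      by (intro add_mono mult_right_mono mult_left_mono R1 e4 kR u order_refl)
    also have "?kd * R powr \<beta> * ((S powr (-\<beta>) * u + D) / (?k0 - ?kb)) = M * S powr (-\<beta>) * u + M * D"
      by (simp only: M_def times_divide_eq_right times_divide_eq_left distrib_left mult.assoc add_divide_distrib)
    finally have "u \<le> B" unfolding S1 B_def by simp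
    then show "?u l \<le> ennreal B" unfolding u(2) by (rule ennreal_leI)
    have "Jb \<le> B2"
      unfolding B2_def using e4 \<open>u \<le> B\<close> k
      by (elim order_trans) (intro divide_right_mono add_right_mono mult_left_mono; simp)
    then show "?Jb l \<le> ennreal B2" unfolding T(4) by (rule ennreal_leI)
  qed
  have "series_op \<alpha> ?kd t (\<lambda>_. 1) x \<le> ennreal B"
    using main(1) unfolding series_op_def by (rule suminf_power_left_limit[OF k(1,2)])
  then show ?P1 by (rule order.strict_trans1) simp
  have "series_int \<alpha> ?kd t (norm_neg_pow (\<beta> + \<alpha>)) x \<le> ennreal B2"
    using main(2) unfolding series_int_def by (rule suminf_power_left_limit[OF k(1,2)])
  then show ?P2 by (rule order.strict_trans1) simp
  show ?P3
    using main(3) unfolding series_op_def by (rule suminf_power_left_limit[OF k(1,2)])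
qed

section \<open>Invariance away from the origin\<close>

text \<open>The upper bound is part of \<open>series_critical\<close>. For the lower bound,
  \<kappa>_b < \<kappa>_\<delta> for b < \<delta> gives a nonnegative correction, so |x|^(-b) is at
  most the value on h_b, which interpolation bounds by R^(-b) u + R^(\<delta>-b) s with u the mass
  and s the value on h_\<delta>. Then b tends to \<delta> at fixed R.\<close>

lemma series_op_invariant:
  fixes x :: "'a"
  assumes \<delta>: "0 < \<delta>" "\<delta> \<le> (DIM('a) - \<alpha>) / 2" and t: "0 < t" and x: "x \<noteq> 0"
  shows "series_op \<alpha> (kappa_const DIM('a) \<alpha> \<delta>) t (norm_neg_pow \<delta>) x = ennreal (norm x powr (-\<delta>))"
proof -
  let ?kd = "kappa_const DIM('a) \<alpha> \<delta>" and ?r = "norm x"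
  let ?U = "series_op \<alpha> ?kd t (\<lambda>_. 1) x"
  let ?T = "series_op \<alpha> ?kd t (norm_neg_pow \<delta>) x"
  have d: "\<delta> < DIM('a) - \<alpha>" using \<delta> \<alpha> by (simp add: field_simps)
  have kd: "0 \<le> ?kd" using \<alpha> \<delta> d by (intro less_imp_le kappa_const_pos) auto
  have less: "kappa_const DIM('a) \<alpha> b < ?kd" if "0 < b" "b < \<delta>" for b
    using that \<delta> \<alpha> by (intro kappa_const_strict_mono) auto
  note crit = series_critical[OF d _ _ less t x]
  have le: "?T \<le> ennreal (?r powr (-\<delta>))"
    using \<delta> by (intro crit(3)[of "\<delta> / 2"]) auto
  then obtain s where s: "0 \<le> s" "?T = ennreal s"
    by (cases "?T") (auto simp: top_unique)
  obtain u where u: "0 \<le> u" "?U = ennreal u"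
    using crit(1)[of "\<delta> / 2"] \<delta> by (cases "?U") auto
  have bound: "?r powr (-b) \<le> R powr (-b) * u + R powr (\<delta> - b) * s" if b: "0 < b" "b < \<delta>" and R: "0 < R" for b R
  proof -
    have b': "0 \<le> b" "b < DIM('a) - \<alpha>" using b d by auto
    obtain T J where T: "0 \<le> J" "series_op \<alpha> ?kd t (norm_neg_pow b) x = ennreal T"
      "T = ?r powr (-b) + (?kd - kappa_const DIM('a) \<alpha> b) * J"
      by (rule series_identity_real[OF \<alpha> b' t x kd crit(2)[OF b b]])
    have "ennreal (?r powr (-b)) \<le> ennreal T"
      unfolding T(3) using less[OF b] T(1) by (intro ennreal_leI) simp
    also have "\<dots> \<le> ennreal (R powr (-b)) * ?U + ennreal (R powr (\<delta> - b)) * ?T"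
      unfolding T(2)[symmetric]
      using norm_neg_pow_interpolate[of b \<delta> R] b R by (intro series_op_combine) auto
    also have "\<dots> = ennreal (R powr (-b) * u + R powr (\<delta> - b) * s)"
      using u s by (simp add: ennreal_mult)
    finally show ?thesis using u s by (subst (asm) ennreal_le_iff) auto
  qed
  have bound\<delta>: "?r powr (-\<delta>) \<le> R powr (-\<delta>) * u + s" if R: "0 < R" for R
  proof -
    have "((\<lambda>b. R powr (-b) * u + R powr (\<delta> - b) * s) \<longlongrightarrow> R powr (-\<delta>) * u + R powr (\<delta> - \<delta>) * s) (at_left \<delta>)"
      using R by (intro tendsto_intros) auto
    moreover have "((\<lambda>b. ?r powr (-b)) \<longlongrightarrow> ?r powr (-\<delta>)) (at_left \<delta>)"
      using x by (intro tendsto_intros) auto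
    moreover have "eventually (\<lambda>b. ?r powr (-b) \<le> R powr (-b) * u + R powr (\<delta> - b) * s) (at_left \<delta>)"
      using eventually_at_left_real[OF \<delta>(1)] by eventually_elim (use bound[OF _ _ R] in auto)
    ultimately have "?r powr (-\<delta>) \<le> R powr (-\<delta>) * u + R powr (\<delta> - \<delta>) * s"
      by (intro tendsto_le[of "at_left \<delta>"]) auto
    then show ?thesis using R by simp
  qed
  \<comment> \<open>The mass u is finite and \<delta> > 0, so its contribution R^(-\<delta>) u
    disappears as R grows.\<close>
  have "?r powr (-\<delta>) \<le> 0 * u + s"
  proof (rule tendsto_lowerbound)
    show "((\<lambda>R. R powr (-\<delta>) * u + s) \<longlongrightarrow> 0 * u + s) at_top"
      using \<delta> by (intro tendsto_intros tendsto_neg_powr filterlim_ident) auto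
    show "eventually (\<lambda>R. ?r powr (-\<delta>) \<le> R powr (-\<delta>) * u + s) at_top"
      using eventually_gt_at_top[of 0] by eventually_elim (rule bound\<delta>)
  qed simp
  then have "ennreal (?r powr (-\<delta>)) \<le> ennreal s" by (intro ennreal_leI) simp
  with le s show ?thesis by (simp add: antisym)
qed

section \<open>Behaviour at the origin\<close>

lemma heat_kernel_norm_neg_pow_scale:
  assumes r: "0 < r"
  shows "(\<integral>\<^sup>+y. heat_kernel \<alpha> (r powr \<alpha>) (0::'a) y * norm_neg_pow \<delta> y \<partial>lborel) =
    ennreal (r powr (-\<delta>)) * (\<integral>\<^sup>+y. heat_kernel \<alpha> 1 (0::'a) y * norm_neg_pow \<delta> y \<partial>lborel)"
proof -
  let ?r = "heat_kernel \<alpha> (r powr \<alpha>) (0::'a)"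
  let ?I = "(\<integral>\<^sup>+y. heat_kernel \<alpha> 1 (0::'a) y * norm_neg_pow \<delta> y \<partial>lborel)"
  have "(\<integral>\<^sup>+y. ?r y * norm_neg_pow \<delta> y \<partial>lborel) =
    ennreal (\<bar>r\<bar> ^ DIM('a)) * (\<integral>\<^sup>+w. ?r (0 + r *\<^sub>R w) * norm_neg_pow \<delta> (0 + r *\<^sub>R w) \<partial>lborel)"
    using r by (intro nn_integral_lborel_affine) auto
  also have "(\<integral>\<^sup>+w. ?r (0 + r *\<^sub>R w) * norm_neg_pow \<delta> (0 + r *\<^sub>R w) \<partial>lborel) =
    (\<integral>\<^sup>+w. ennreal (r powr (- DIM('a)) * r powr (-\<delta>)) * (heat_kernel \<alpha> 1 (0::'a) w * norm_neg_pow \<delta> w) \<partial>lborel)"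
  proof (rule nn_integral_cong_AE, use AE_lborel_singleton[of "0::'a"] in eventually_elim)
    fix w :: 'a assume w: "w \<noteq> 0"
    have "stable_density \<alpha> (r powr \<alpha>) (r *\<^sub>R w) = r powr (- DIM('a)) * stable_density \<alpha> 1 w"
      using stable_density_scale[OF \<alpha>(1,2), of 1 r w] r by simp
    with w r stable_density_nonneg[OF \<alpha>(1,2), of 1 w] show "?r (0 + r *\<^sub>R w) * norm_neg_pow \<delta> (0 + r *\<^sub>R w) =
      ennreal (r powr (- DIM('a)) * r powr (-\<delta>)) * (heat_kernel \<alpha> 1 (0::'a) w * norm_neg_pow \<delta> w)"
      by (simp add: heat_kernel_def norm_neg_pow_nonzero powr_mult ennreal_mult mult_ac)
  qed
  also have "\<dots> = ennreal (r powr (- DIM('a)) * r powr (-\<delta>)) * ?I"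
    by (rule nn_integral_cmult) measurable
  also have "ennreal (\<bar>r\<bar> ^ DIM('a)) * \<dots> = ennreal (\<bar>r\<bar> ^ DIM('a) * (r powr (- DIM('a)) * r powr (-\<delta>))) * ?I"
    by (simp add: mult.assoc ennreal_mult)
  also have "\<bar>r\<bar> ^ DIM('a) * (r powr (- DIM('a)) * r powr (-\<delta>)) = r powr (-\<delta>)"
    using r by (simp add: powr_minus powr_realpow)
  finally show ?thesis .
qed

text \<open>For 0 < r < t invariance over the time t-r holds off the origin, hence almost
  everywhere. Applying the heat kernel for time r and using \<open>perturb_op_superadditive\<close>
  termwise bounds P_r h_\<delta>(0) by the value at time t, while the former is a positive multiple
  of r^(-\<delta>/\<alpha>).\<close>

lemma series_op_at_origin:
  assumes \<delta>: "0 < \<delta>" "\<delta> \<le> (DIM('a) - \<alpha>) / 2" and t: "0 < t"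
  shows "series_op \<alpha> (kappa_const DIM('a) \<alpha> \<delta>) t (norm_neg_pow \<delta>) (0::'a) = \<infinity>"
proof -
  let ?kd = "kappa_const DIM('a) \<alpha> \<delta>" and ?h = "norm_neg_pow \<delta> :: 'a \<Rightarrow> ennreal"
  let ?R = "\<lambda>r. (\<integral>\<^sup>+w. heat_kernel \<alpha> r (0::'a) w * ?h w \<partial>lborel)"
  let ?T = "series_op \<alpha> ?kd t ?h 0"
  let ?Q = "\<lambda>n r w. (heat_kernel \<alpha> r (0::'a) w * perturb_op \<alpha> n (t - r) ?h w)"
  let ?c = "\<integral>\<^sup>+y. heat_kernel \<alpha> 1 (0::'a) y * ?h y \<partial>lborel"
  have hm: "?h \<in> borel_measurable borel" by measurable
  have c: "?c \<noteq> 0"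
  proof
    assume "?c = 0"
    then have "AE y in lborel. heat_kernel \<alpha> 1 (0::'a) y * ?h y = 0"
      by (subst (asm) nn_integral_0_iff_AE) auto
    then have "AE y in lborel. ennreal (stable_density \<alpha> 1 (y::'a)) = 0"
      using AE_lborel_singleton[of "0::'a"]
    proof eventually_elim
      case (elim y)
      then show ?case by (auto simp: heat_kernel_def norm_neg_pow_nonzero ennreal_eq_0_iff)
    qed
    then have "(\<integral>\<^sup>+y. ennreal (stable_density \<alpha> 1 (y::'a)) \<partial>lborel) = 0"
      by (subst nn_integral_0_iff_AE) auto
    then show False using nn_integral_stable_density[OF \<alpha>(1,2), of 1, where 'a='a] by simp
  qed
  have ge: "?R r \<le> ?T" if r: "0 < r" "r < t" for r
  proof -
    have "?R r = (\<integral>\<^sup>+w. (\<Sum>n. ennreal ?kd ^ n * ?Q n r w) \<partial>lborel)"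
    proof (rule nn_integral_cong_AE, use AE_lborel_singleton[of "0::'a"] in eventually_elim)
      fix w :: 'a assume w: "w \<noteq> 0"
      have "?h w = (\<Sum>n. ennreal ?kd ^ n * perturb_op \<alpha> n (t - r) ?h w)"
        using series_op_invariant[OF \<delta> _ w, of "t - r"] r w by (simp add: series_op_def norm_neg_pow_nonzero)
      then have "heat_kernel \<alpha> r (0::'a) w * ?h w = (\<Sum>n. heat_kernel \<alpha> r (0::'a) w * (ennreal ?kd ^ n * perturb_op \<alpha> n (t - r) ?h w))"
        by (simp only: ennreal_suminf_cmult)
      then show "heat_kernel \<alpha> r (0::'a) w * ?h w = (\<Sum>n. ennreal ?kd ^ n * ?Q n r w)"
        by (simp only: mult_ac)
    qed
    also have "\<dots> = (\<Sum>n. \<integral>\<^sup>+w. ennreal ?kd ^ n * ?Q n r w \<partial>lborel)"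
      by (rule nn_integral_suminf) measurable
    also have "\<dots> \<le> ?T"
      unfolding series_op_def
    proof (intro suminf_le summableI)
      fix n
      have "(\<integral>\<^sup>+w. ennreal ?kd ^ n * ?Q n r w \<partial>lborel) =
        ennreal ?kd ^ n * (\<integral>\<^sup>+w. heat_kernel \<alpha> r (0::'a) w * perturb_op \<alpha> n (t - r) ?h w \<partial>lborel)"
        by (rule nn_integral_cmult) measurable
      also have "\<dots> \<le> ennreal ?kd ^ n * perturb_op \<alpha> n t ?h 0"
        by (intro mult_left_mono perturb_op_superadditive[OF \<alpha>(1,2) hm r]) auto
      finally show "(\<integral>\<^sup>+w. ennreal ?kd ^ n * ?Q n r w \<partial>lborel) \<le> ennreal ?kd ^ n * perturb_op \<alpha> n t ?h 0" .
    qed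
    finally show ?thesis .
  qed
  show ?thesis
  proof (rule ccontr)
    assume "?T \<noteq> \<infinity>"
    then obtain s where s: "0 \<le> s" "?T = ennreal s"
      by (cases "?T") auto
    have le: "ennreal (r powr (-\<delta>)) * ?c \<le> ennreal s" if "0 < r" "r powr \<alpha> < t" for r
      using ge[of "r powr \<alpha>"] that unfolding heat_kernel_norm_neg_pow_scale[OF that(1)] s(2) by simp
    \<comment> \<open>r0^\<alpha> = t/2 is one admissible time: it shows that \<open>?c\<close> is
      finite, and every r < r0 is admissible as well.\<close>
    define r0 where "r0 = (t / 2) powr (1 / \<alpha>)"
    have r0: "0 < r0" "r0 powr \<alpha> < t" using t \<alpha> by (simp_all add: r0_def powr_powr)
    have "?c \<noteq> \<infinity>"
      using le[OF r0] r0(1) by (auto simp: ennreal_mult_top ennreal_eq_0_iff top_unique)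
    then obtain c where cr: "0 < c" "?c = ennreal c"
      using c by (cases ?c) (auto simp: less_le)
    have bnd: "r powr (-\<delta>) * c \<le> s" if "0 < r" "r < r0" for r
    proof -
      have "r powr \<alpha> < r0 powr \<alpha>" using that \<alpha> by (intro powr_less_mono2) auto
      then have "ennreal (r powr (-\<delta>)) * ennreal c \<le> ennreal s" using le[of r] that r0 cr by simp
      then show ?thesis using cr s by (simp add: ennreal_mult[symmetric])
    qed
    \<comment> \<open>The second entry forces r^(-\<delta>) \<ge> s/c + 1, which contradicts
      r^(-\<delta>) c \<le> s.\<close>
    define r where "r = min (r0 / 2) ((s / c + 1) powr (- 1 / \<delta>))"
    have sc: "0 < s / c + 1" using s cr by (simp add: add_nonneg_pos)
    then have r: "0 < r" "r < r0" using r0 by (auto simp: r_def min_less_iff_disj)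
    have "((s / c + 1) powr (- 1 / \<delta>)) powr (-\<delta>) \<le> r powr (-\<delta>)"
      using r \<delta> by (intro powr_mono2') (auto simp: r_def)
    moreover have "((s / c + 1) powr (- 1 / \<delta>)) powr (-\<delta>) = s / c + 1"
      using \<delta> sc by (simp add: powr_powr)
    ultimately have "(s / c + 1) * c \<le> r powr (-\<delta>) * c" using cr by (intro mult_right_mono) auto
    also have "\<dots> \<le> s" by (rule bnd[OF r])
    finally show False using cr by (simp add: distrib_right)
  qed
qed

text \<open>Below the midpoint some exponent b above \<beta> has \<kappa>_b > \<kappa>_\<delta>, and
  interpolation applies. At \<delta> = (d-\<alpha>)/2 there is no such b; then \<beta> < \<delta>,
  and \<open>series_critical\<close> takes over.\<close>

lemma series_int_finite:
  fixes x :: "'a"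
  assumes \<delta>: "0 \<le> \<delta>" "\<delta> \<le> (DIM('a) - \<alpha>) / 2" and \<beta>: "0 \<le> \<beta>" "\<beta> < DIM('a) - \<alpha> - \<delta>" and t: "0 < t" and x: "x \<noteq> 0"
  shows "series_int \<alpha> (kappa_const DIM('a) \<alpha> \<delta>) t (norm_neg_pow (\<beta> + \<alpha>)) x < \<infinity>"
proof (cases "\<delta> < (DIM('a) - \<alpha>) / 2")
  case True
  \<comment> \<open>The midpoint between max \<beta> \<delta> and d-\<alpha>-\<delta>.\<close>
  define b where "b = (max \<beta> \<delta> + (DIM('a) - \<alpha> - \<delta>)) / 2"
  have b: "\<beta> \<le> b" "\<delta> < b" "b < DIM('a) - \<alpha> - \<delta>" "b < DIM('a) - \<alpha>"
    using True \<beta> \<delta> by (auto simp: b_def max_def field_simps)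
  have "0 \<le> kappa_const DIM('a) \<alpha> \<delta>"
    using \<alpha> \<delta> True kappa_const_pos[of \<alpha> \<delta> "DIM('a)"] by (cases "\<delta> = 0") (auto simp: kappa_const_def field_simps)
  moreover have "kappa_const DIM('a) \<alpha> \<delta> < kappa_const DIM('a) \<alpha> b"
    using \<alpha> \<delta> b by (intro kappa_const_less_between) auto
  ultimately show ?thesis by (intro series_int_finite_interpolate[OF \<alpha> \<beta>(1) b(1,4) t x])
next
  case False
  then have \<delta>eq: "\<delta> = (DIM('a) - \<alpha>) / 2" using \<delta> by simp
  with \<alpha> \<beta> have d: "0 < \<delta>" "\<delta> < DIM('a) - \<alpha>" "\<beta> < \<delta>" by (auto simp: field_simps)
  have less: "kappa_const DIM('a) \<alpha> b < kappa_const DIM('a) \<alpha> \<delta>" if "0 < b" "b < \<delta>" for b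
    using that \<delta> \<alpha> by (intro kappa_const_strict_mono) auto
  note crit = series_critical[OF d(2) _ _ less t x]
  show ?thesis
  proof (cases "\<beta> = 0")
    case False
    with \<beta> d show ?thesis by (intro crit(2)) auto
  next
    \<comment> \<open>\<open>series_critical\<close> covers only \<beta> > 0. For \<beta> = 0 the
      integral term is recovered from the finite mass, which equals 1 + \<kappa> times this term
      with \<kappa> > 0.\<close>
    case True
    have "0 < kappa_const DIM('a) \<alpha> \<delta>" using \<alpha> d by (intro kappa_const_pos) auto
    moreover have "series_op \<alpha> (kappa_const DIM('a) \<alpha> \<delta>) t (\<lambda>_. 1) x < \<infinity>"
      using d by (intro crit(1)[of "\<delta> / 2"]) auto
    ultimately show ?thesis
      using True unfolding series_op_one[OF \<alpha> t x]
      by (auto simp: less_top[symmetric] ennreal_mult_eq_top_iff ennreal_eq_0_iff)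
  qed
qed

end

theorem theorem3p1:
  fixes \<alpha> \<delta> \<kappa> :: real
    and q :: "'a::euclidean_space \<Rightarrow> ennreal"
    and pt :: "real \<Rightarrow> 'a \<Rightarrow> 'a \<Rightarrow> ennreal"
  assumes "0 < \<alpha>" and "\<alpha> < min 2 (real DIM('a))"
    and "\<delta> \<in> {0..(real DIM('a) - \<alpha>) / 2}"
    and "\<kappa> = kappa_const DIM('a) \<alpha> \<delta>"
    and "q = (\<lambda>x. ennreal \<kappa> * norm_neg_pow \<alpha> x)"
    and "pt = schroedinger_perturbation (heat_kernel \<alpha>) q"
  shows "(\<forall>t>0. \<forall>x. (\<integral>\<^sup>+y. pt t x y * norm_neg_pow \<delta> y \<partial>lborel) = norm_neg_pow \<delta> x) \<and>
    (\<forall>\<beta>\<in>{0..<real DIM('a) - \<alpha> - \<delta>}. \<forall>t>0. \<forall>x. x \<noteq> 0 \<longrightarrow>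
       enn2ereal (\<integral>\<^sup>+y. pt t x y * norm_neg_pow \<beta> y \<partial>lborel) =
         enn2ereal (norm_neg_pow \<beta> x) +
         ereal (\<kappa> - kappa_const DIM('a) \<alpha> \<beta>) *
           enn2ereal (\<integral>\<^sup>+s\<in>{0<..<t}. (\<integral>\<^sup>+y. pt s x y * norm_neg_pow (\<beta> + \<alpha>) y \<partial>lborel) \<partial>lborel) \<and>
       (\<integral>\<^sup>+y. pt t x y * norm_neg_pow \<beta> y \<partial>lborel) < \<infinity>)"
proof -
  have \<alpha>: "0 < \<alpha>" "\<alpha> < 2" "\<alpha> < DIM('a)" and \<delta>: "0 \<le> \<delta>" "\<delta> \<le> (DIM('a) - \<alpha>) / 2"
    using assms(1-3) by auto
  have \<kappa>0: "0 \<le> \<kappa>"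
    using kappa_const_pos[of \<alpha> \<delta> "DIM('a)"] \<alpha> \<delta> unfolding assms(4)
    by (cases "\<delta> = 0") (auto simp: kappa_const_def field_simps)
  have op: "(\<integral>\<^sup>+y. pt t x y * norm_neg_pow b y \<partial>lborel) = series_op \<alpha> \<kappa> t (norm_neg_pow b) x" for t x b
    unfolding assms(5,6) by (rule nn_integral_schroedinger_perturbation) measurable
  have int: "(\<integral>\<^sup>+s\<in>{0<..<t}. series_op \<alpha> \<kappa> s (norm_neg_pow b) x \<partial>lborel) = series_int \<alpha> \<kappa> t (norm_neg_pow b) x" for t b and x :: 'a
    by (rule nn_integral_series_op) measurable
  have inv: "series_op \<alpha> \<kappa> t (norm_neg_pow \<delta>) x = norm_neg_pow \<delta> x" if t: "0 < t" for t and x :: 'a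
  proof (cases "\<delta> = 0")
    case True
    then have \<kappa>: "\<kappa> = 0" and one: "norm_neg_pow \<delta> = (\<lambda>_::'a. 1)"
      by (simp_all add: assms(4) kappa_const_def fun_eq_iff)
    \<comment> \<open>With coupling 0 only the term n = 0 survives, where 0^0 = 1, and the claim is
      conservation of mass.\<close>
    show ?thesis
      unfolding series_op_def \<kappa> one by (subst suminf_ennreal_Suc) (simp add: perturb_op_one_0[OF \<alpha>(1,2) t])
  next
    case False
    with \<delta> have d: "0 < \<delta>" by simp
    show ?thesis
    proof (cases "x = 0")
      case True
      with d show ?thesis
        unfolding assms(4) by (simp only: series_op_at_origin[OF \<alpha> d \<delta>(2) t]) (simp add: norm_neg_pow_def)
    next
      case False
      then show ?thesis
        unfolding assms(4) series_op_invariant[OF \<alpha> d \<delta>(2) t False] by (simp only: norm_neg_pow_nonzero not_False_eq_True)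
    qed
  qed
  have ident: "enn2ereal (series_op \<alpha> \<kappa> t (norm_neg_pow \<beta>) x) = enn2ereal (norm_neg_pow \<beta> x) +
       ereal (\<kappa> - kappa_const DIM('a) \<alpha> \<beta>) * enn2ereal (series_int \<alpha> \<kappa> t (norm_neg_pow (\<beta> + \<alpha>)) x) \<and>
      series_op \<alpha> \<kappa> t (norm_neg_pow \<beta>) x < \<infinity>"
    if b: "\<beta> \<in> {0..<real DIM('a) - \<alpha> - \<delta>}" and t: "0 < t" and x: "x \<noteq> 0" for \<beta> t and x :: 'a
  proof -
    have \<beta>: "0 \<le> \<beta>" "\<beta> < DIM('a) - \<alpha> - \<delta>" "\<beta> < DIM('a) - \<alpha>" using b \<delta> by auto
    obtain T J where "0 \<le> T" "0 \<le> J" "series_op \<alpha> \<kappa> t (norm_neg_pow \<beta>) x = ennreal T"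
      "series_int \<alpha> \<kappa> t (norm_neg_pow (\<beta> + \<alpha>)) x = ennreal J"
      "T = norm x powr (-\<beta>) + (\<kappa> - kappa_const DIM('a) \<alpha> \<beta>) * J"
      by (rule series_identity_real[OF \<alpha> \<beta>(1,3) t x \<kappa>0 series_int_finite[OF \<alpha> \<delta> \<beta>(1,2) t x, folded assms(4)]])
    with x show ?thesis by (simp add: norm_neg_pow_nonzero enn2ereal_ennreal)
  qed
  show ?thesis
    unfolding op int using inv ident by (intro conjI allI ballI impI) simp_all
qed

end
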